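(* Let $C_\Phi:\mathcal{A}(\mathbb{C}_+)\to\mathcal{A}(\mathbb{C}_+)$, $C_\Phi f=f\circ\Phi$, be a bounded composition operator with symbol $\Phi:\mathbb{C}_+\to\mathbb{C}_+$. Then the following statements are equivalent: (a) $\Phi(\mathbb{C}_+)\subset\mathbb{C}_\varepsilon$ for some $\varepsilon>0$. (b) $C_\Phi$ is compact. (c) $C_\Phi$ is weakly compact. (d) $C_\Phi:\mathcal{A}(\mathbb{C}_+)\to\mathcal{A}(\mathbb{C}_+)$ does not fix a copy of $c_0$.
   Context: For $\theta\in\mathbb{R}$, $\mathbb{C}_\theta=\{s\in\mathbb{C}:\mathrm{Re}(s)>\theta\}$ and $\mathbb{C}_+=\mathbb{C}_0$. $\mathcal{A}(\mathbb{C}_+)$ (the algebra of Dirichlet series) is the set of Dirichlet series $\sum_{n\ge1}a_nn^{-s}$ convergent in $\mathbb{C}_+$ whose sum is a uniformly continuous function on $\mathbb{C}_+$; it is a Banach algebra with the norm $\|f\|_\infty=\sup_{s\in\mathbb{C}_+}|f(s)|$. Given Banach spaces $X,Y,E$, a bounded operator $T:X\to Y$ fixes a copy of $E$ if there is a subspace $Z\subseteq X$ isomorphic to $E$ such that $T:Z\to T(Z)$ is an isomorphism. $c_0$ is the Banach space of complex null sequences with the sup norm. *)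

theory Defs
  imports "HOL-Analysis.Analysis"
begin

class complex_normed_vector = real_normed_vector +
  fixes scaleC :: "complex \<Rightarrow> 'a \<Rightarrow> 'a"  (infixr \<open>*\<^sub>C\<close> 75)
  assumes scaleC_add_right: "c *\<^sub>C (x + y) = c *\<^sub>C x + c *\<^sub>C y"
    and scaleC_add_left: "(c + d) *\<^sub>C x = c *\<^sub>C x + d *\<^sub>C x"
    and scaleC_scaleC: "c *\<^sub>C d *\<^sub>C x = (c * d) *\<^sub>C x"
    and scaleC_of_real: "complex_of_real r *\<^sub>C x = r *\<^sub>R x"
    and norm_scaleC: "norm (c *\<^sub>C x) = cmod c * norm x"

instantiation complex :: complex_normed_vector
begin
definition scaleC_complex :: "complex \<Rightarrow> complex \<Rightarrow> complex"
  where "scaleC_complex c x = c * x"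
instance
  by standard (auto simp: scaleC_complex_def algebra_simps norm_mult scaleR_conv_of_real)
end

definition csubspace :: "'a::complex_normed_vector set \<Rightarrow> bool"
  where "csubspace S \<longleftrightarrow> 0 \<in> S \<and> (\<forall>x\<in>S. \<forall>y\<in>S. x + y \<in> S) \<and> (\<forall>c. \<forall>x\<in>S. c *\<^sub>C x \<in> S)"

definition bounded_clinear_on ::
    "'a::complex_normed_vector set \<Rightarrow> ('a \<Rightarrow> 'b::complex_normed_vector) \<Rightarrow> bool"
  where "bounded_clinear_on S T \<longleftrightarrow>
    (\<forall>x\<in>S. \<forall>y\<in>S. T (x + y) = T x + T y) \<and>
    (\<forall>c. \<forall>x\<in>S. T (c *\<^sub>C x) = c *\<^sub>C T x) \<and>
    (\<exists>K. \<forall>x\<in>S. norm (T x) \<le> norm x * K)"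

abbreviation bounded_clinear ::
    "('a::complex_normed_vector \<Rightarrow> 'b::complex_normed_vector) \<Rightarrow> bool"
  where "bounded_clinear T \<equiv> bounded_clinear_on UNIV T"

lemma bounded_clinear_iff:
  "bounded_clinear T \<longleftrightarrow> bounded_linear T \<and> (\<forall>c x. T (c *\<^sub>C x) = c *\<^sub>C T x)"
proof
  assume *: "bounded_clinear T"
  have "T (r *\<^sub>R x) = r *\<^sub>R T x" for r x
  proof -
    have "T (complex_of_real r *\<^sub>C x) = complex_of_real r *\<^sub>C T x"
      using * by (simp add: bounded_clinear_on_def)
    then show ?thesis by (simp add: scaleC_of_real)
  qed
  with * have "bounded_linear T"
    by (auto simp: bounded_clinear_on_def bounded_linear_def bounded_linear_axioms_def
        intro!: linearI)
  with * show "bounded_linear T \<and> (\<forall>c x. T (c *\<^sub>C x) = c *\<^sub>C T x)"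
    by (simp add: bounded_clinear_on_def)
next
  assume "bounded_linear T \<and> (\<forall>c x. T (c *\<^sub>C x) = c *\<^sub>C T x)"
  then show "bounded_clinear T"
    unfolding bounded_clinear_on_def
    by (auto simp: bounded_linear.bounded linear_simps)
qed

definition cisomorphism ::
    "'a::complex_normed_vector set \<Rightarrow> 'b::complex_normed_vector set \<Rightarrow> ('a \<Rightarrow> 'b) \<Rightarrow> bool"
  where "cisomorphism S S' T \<longleftrightarrow>
    bij_betw T S S' \<and> bounded_clinear_on S T \<and> bounded_clinear_on S' (inv_into S T)"

definition compact_operator ::
    "('a::complex_normed_vector \<Rightarrow> 'b::complex_normed_vector) \<Rightarrow> bool"
  where "compact_operator T \<longleftrightarrow> bounded_clinear T \<and> compact (closure (T ` cball 0 1))"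

definition weak_topology :: "'a::complex_normed_vector topology"
  where "weak_topology =
    topology_generated_by {\<phi> -` U | (\<phi> :: 'a \<Rightarrow> complex) U. bounded_clinear \<phi> \<and> open U}"

definition weakly_compact_operator ::
    "('a::complex_normed_vector \<Rightarrow> 'b::complex_normed_vector) \<Rightarrow> bool"
  where "weakly_compact_operator T \<longleftrightarrow>
    bounded_clinear T \<and> compactin weak_topology (weak_topology closure_of (T ` cball 0 1))"

text \<open>The space \<open>E\<close> of which \<open>T\<close> fixes a copy is given as a type.\<close>

definition fixes_copy ::
    "'e::complex_normed_vector itself \<Rightarrow>
     ('a::complex_normed_vector \<Rightarrow> 'b::complex_normed_vector) \<Rightarrow> bool"
  where "fixes_copy (_ :: 'e itself) T \<longleftrightarrow>
    (\<exists>Z. csubspace Z \<and> (\<exists>J :: 'a \<Rightarrow> 'e. cisomorphism Z UNIV J) \<and> cisomorphism Z (T ` Z) T)"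

lemma supnorm_ge0:
  assumes "S \<noteq> {}" "bdd_above ((\<lambda>s. cmod (f s)) ` S)"
  shows "0 \<le> (SUP s\<in>S. cmod (f s))"
proof -
  from assms obtain s where "s \<in> S" by auto
  then show ?thesis using assms by (intro cSUP_upper2[of _ _ s]) auto
qed

lemma supnorm_eq0:
  assumes "S \<noteq> {}" "bdd_above ((\<lambda>s. cmod (f s)) ` S)"
  shows "(SUP s\<in>S. cmod (f s)) = 0 \<longleftrightarrow> (\<forall>s\<in>S. f s = 0)"
proof
  assume *: "(SUP s\<in>S. cmod (f s)) = 0"
  show "\<forall>s\<in>S. f s = 0"
  proof
    fix s assume "s \<in> S"
    then have "cmod (f s) \<le> 0" using cSUP_upper[OF _ assms(2), of s] * by simp
    then show "f s = 0" by simp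
  qed
next
  assume *: "\<forall>s\<in>S. f s = 0"
  then have "(SUP s\<in>S. cmod (f s)) = (SUP s\<in>S. 0)" by (intro SUP_cong) auto
  then show "(SUP s\<in>S. cmod (f s)) = 0" using assms(1) by simp
qed

lemma supnorm_triangle:
  assumes "S \<noteq> {}" "bdd_above ((\<lambda>s. cmod (f s)) ` S)" "bdd_above ((\<lambda>s. cmod (g s)) ` S)"
  shows "(SUP s\<in>S. cmod (f s + g s)) \<le> (SUP s\<in>S. cmod (f s)) + (SUP s\<in>S. cmod (g s))"
proof (rule cSUP_least[OF assms(1)])
  fix s assume "s \<in> S"
  have "cmod (f s + g s) \<le> cmod (f s) + cmod (g s)" by (rule norm_triangle_ineq)
  also have "\<dots> \<le> (SUP s\<in>S. cmod (f s)) + (SUP s\<in>S. cmod (g s))"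
    by (intro add_mono cSUP_upper \<open>s \<in> S\<close> assms)
  finally show "cmod (f s + g s) \<le> (SUP s\<in>S. cmod (f s)) + (SUP s\<in>S. cmod (g s))" .
qed

lemma supnorm_scale:
  assumes "S \<noteq> {}" "bdd_above ((\<lambda>s. cmod (f s)) ` S)"
  shows "(SUP s\<in>S. cmod (c * f s)) = cmod c * (SUP s\<in>S. cmod (f s))"
proof (rule antisym)
  have le: "cmod (c * f s) \<le> cmod c * (SUP s\<in>S. cmod (f s))" if "s \<in> S" for s
    unfolding norm_mult by (intro mult_left_mono cSUP_upper that assms) simp
  show "(SUP s\<in>S. cmod (c * f s)) \<le> cmod c * (SUP s\<in>S. cmod (f s))"
    by (rule cSUP_least[OF assms(1) le])
  have bdd: "bdd_above ((\<lambda>s. cmod (c * f s)) ` S)" using le by (rule bdd_aboveI2)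
  show "cmod c * (SUP s\<in>S. cmod (f s)) \<le> (SUP s\<in>S. cmod (c * f s))"
  proof (cases "c = 0")
    case True
    then show ?thesis using assms(1) by simp
  next
    case False
    have "(SUP s\<in>S. cmod (f s)) \<le> (SUP s\<in>S. cmod (c * f s)) / cmod c"
    proof (rule cSUP_least[OF assms(1)])
      fix s assume "s \<in> S"
      then have "cmod (c * f s) \<le> (SUP s\<in>S. cmod (c * f s))" by (intro cSUP_upper bdd)
      then show "cmod (f s) \<le> (SUP s\<in>S. cmod (c * f s)) / cmod c"
        using False by (simp add: norm_mult field_simps)
    qed
    then show ?thesis using False by (simp add: field_simps)
  qed
qed

typedef c0 = "{x :: nat \<Rightarrow> complex. x \<longlonglongrightarrow> 0}"
  morphisms c0_nth Abs_c0
  by (rule exI[of _ "\<lambda>_. 0"]) simp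

setup_lifting type_definition_c0

lemma bdd_c0: "bdd_above ((\<lambda>n. cmod (c0_nth x n)) ` UNIV)"
proof -
  have "c0_nth x \<longlonglongrightarrow> 0" using c0_nth[of x] by simp
  then have "Bseq (c0_nth x)" by (intro convergent_imp_Bseq) (auto simp: convergent_def)
  then obtain K where "\<And>n. cmod (c0_nth x n) \<le> K" by (auto simp: Bseq_def)
  then show ?thesis by (intro bdd_aboveI2)
qed

instantiation c0 :: complex_normed_vector
begin

lift_definition zero_c0 :: c0 is "\<lambda>_. 0" by simp
lift_definition plus_c0 :: "c0 \<Rightarrow> c0 \<Rightarrow> c0" is "\<lambda>x y n. x n + y n"
  by (auto intro: tendsto_add_zero)
lift_definition uminus_c0 :: "c0 \<Rightarrow> c0" is "\<lambda>x n. - x n"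
  by (auto intro: tendsto_minus_cancel)
lift_definition minus_c0 :: "c0 \<Rightarrow> c0 \<Rightarrow> c0" is "\<lambda>x y n. x n - y n"
  using tendsto_diff by fastforce
lift_definition scaleR_c0 :: "real \<Rightarrow> c0 \<Rightarrow> c0" is "\<lambda>r x n. complex_of_real r * x n"
  by (auto intro: tendsto_mult_right_zero)
lift_definition scaleC_c0 :: "complex \<Rightarrow> c0 \<Rightarrow> c0" is "\<lambda>c x n. c * x n"
  by (auto intro: tendsto_mult_right_zero)

definition norm_c0 :: "c0 \<Rightarrow> real"
  where "norm_c0 x = (SUP n. cmod (c0_nth x n))"
definition sgn_c0 :: "c0 \<Rightarrow> c0"
  where "sgn_c0 x = inverse (norm x) *\<^sub>R x"
definition dist_c0 :: "c0 \<Rightarrow> c0 \<Rightarrow> real"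
  where "dist_c0 x y = norm (x - y)"
definition uniformity_c0 :: "(c0 \<times> c0) filter"
  where "uniformity_c0 = (INF e\<in>{0<..}. principal {(x, y). dist x y < e})"
definition open_c0 :: "c0 set \<Rightarrow> bool"
  where "open_c0 U \<longleftrightarrow> (\<forall>x\<in>U. \<forall>\<^sub>F (x', y) in uniformity. x' = x \<longrightarrow> y \<in> U)"

instance
proof
  fix x y z :: c0 and c d :: complex and r q :: real
  show "x + y + z = x + (y + z)" by transfer (simp add: add.assoc)
  show "x + y = y + x" by transfer (simp add: add.commute)
  show "0 + x = x" by transfer simp
  show "- x + x = 0" by transfer simp
  show "x - y = x + - y" by transfer simp
  show "r *\<^sub>R (x + y) = r *\<^sub>R x + r *\<^sub>R y" by transfer (simp add: algebra_simps)
  show "(r + q) *\<^sub>R x = r *\<^sub>R x + q *\<^sub>R x" by transfer (simp add: algebra_simps)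
  show "r *\<^sub>R q *\<^sub>R x = (r * q) *\<^sub>R x" by transfer (simp add: algebra_simps)
  show "1 *\<^sub>R x = x" by transfer simp
  show "c *\<^sub>C (x + y) = c *\<^sub>C x + c *\<^sub>C y" by transfer (simp add: algebra_simps)
  show "(c + d) *\<^sub>C x = c *\<^sub>C x + d *\<^sub>C x" by transfer (simp add: algebra_simps)
  show "c *\<^sub>C d *\<^sub>C x = (c * d) *\<^sub>C x" by transfer (simp add: algebra_simps)
  show "complex_of_real r *\<^sub>C x = r *\<^sub>R x" by transfer simp
  show "(norm x = 0) = (x = 0)"
    unfolding norm_c0_def by (subst supnorm_eq0[OF _ bdd_c0]; transfer; auto)
  show "norm (x + y) \<le> norm x + norm y"
    using supnorm_triangle[OF _ bdd_c0 bdd_c0, of x y] by (simp add: norm_c0_def plus_c0.rep_eq)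
  show "norm (r *\<^sub>R x) = \<bar>r\<bar> * norm x"
    using supnorm_scale[OF _ bdd_c0, of "complex_of_real r" x]
    by (simp add: norm_c0_def scaleR_c0.rep_eq)
  show "norm (c *\<^sub>C x) = cmod c * norm x"
    using supnorm_scale[OF _ bdd_c0, of c x] by (simp add: norm_c0_def scaleC_c0.rep_eq)
qed (simp_all add: sgn_c0_def dist_c0_def uniformity_c0_def open_c0_def)

end

definition half_plane :: "real \<Rightarrow> complex set"
  where "half_plane \<theta> = {s. Re s > \<theta>}"

text \<open>Functions on the half-plane are represented by functions on \<open>\<complex>\<close> that vanish off it,
  so that equality of functions is equality on the half-plane. Boundedness is not part of the
  definition; it is a consequence (lemma \<open>bdd_dirichlet\<close>).\<close>

definition dirichlet_functions :: "(complex \<Rightarrow> complex) set"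
  where "dirichlet_functions = {f.
    (\<forall>s. s \<notin> half_plane 0 \<longrightarrow> f s = 0) \<and>
    uniformly_continuous_on (half_plane 0) f \<and>
    (\<exists>a :: nat \<Rightarrow> complex. \<forall>s\<in>half_plane 0.
       (\<lambda>n. a (Suc n) * of_nat (Suc n) powr (- s)) sums f s)}"

lemma half_plane_nonempty: "half_plane \<theta> \<noteq> {}"
proof -
  have "complex_of_real (\<theta> + 1) \<in> half_plane \<theta>" by (simp add: half_plane_def)
  then show ?thesis by blast
qed

lemma dirichlet_functions_zero: "(\<lambda>_. 0) \<in> dirichlet_functions"
  unfolding dirichlet_functions_def
  by (auto intro!: exI[of _ "\<lambda>_. 0"] uniformly_continuous_on_const)

lemma dirichlet_functions_scale:
  assumes "f \<in> dirichlet_functions"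
  shows "(\<lambda>s. c * f s) \<in> dirichlet_functions"
proof -
  from assms obtain a where
    a: "\<forall>s\<in>half_plane 0. (\<lambda>n. a (Suc n) * of_nat (Suc n) powr (- s)) sums f s"
    by (auto simp: dirichlet_functions_def)
  have "uniformly_continuous_on (half_plane 0) (\<lambda>s. c * f s)"
    using assms bounded_linear.uniformly_continuous_on[OF bounded_linear_mult_right]
    by (auto simp: dirichlet_functions_def)
  moreover have "(\<lambda>n. (c * a (Suc n)) * of_nat (Suc n) powr (- s)) sums (c * f s)"
    if "s \<in> half_plane 0" for s
    using sums_mult[OF a[rule_format, OF that], of c] by (simp add: mult.assoc)
  ultimately show ?thesis
    using assms by (auto simp: dirichlet_functions_def intro!: exI[of _ "\<lambda>n. c * a n"])
qed

lemma dirichlet_functions_add: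
  assumes "f \<in> dirichlet_functions" "g \<in> dirichlet_functions"
  shows "(\<lambda>s. f s + g s) \<in> dirichlet_functions"
proof -
  from assms obtain a b where
    a: "\<forall>s\<in>half_plane 0. (\<lambda>n. a (Suc n) * of_nat (Suc n) powr (- s)) sums f s" and
    b: "\<forall>s\<in>half_plane 0. (\<lambda>n. b (Suc n) * of_nat (Suc n) powr (- s)) sums g s"
    by (auto simp: dirichlet_functions_def)
  have "uniformly_continuous_on (half_plane 0) (\<lambda>s. f s + g s)"
    using assms by (auto simp: dirichlet_functions_def intro: uniformly_continuous_on_add)
  moreover have "(\<lambda>n. (a (Suc n) + b (Suc n)) * of_nat (Suc n) powr (- s)) sums (f s + g s)"
    if "s \<in> half_plane 0" for s
    using sums_add[OF a[rule_format, OF that] b[rule_format, OF that]]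
    by (simp add: distrib_right)
  ultimately show ?thesis
    using assms by (auto simp: dirichlet_functions_def intro!: exI[of _ "\<lambda>n. a n + b n"])
qed

typedef dirichlet_algebra = dirichlet_functions
  morphisms dirichlet_fun Abs_dirichlet
  using dirichlet_functions_zero by blast

setup_lifting type_definition_dirichlet_algebra

lemma bdd_dirichlet: "bdd_above ((\<lambda>s. cmod (dirichlet_fun f s)) ` half_plane 0)"
proof -
  define F where "F = dirichlet_fun f"
  have F: "F \<in> dirichlet_functions" unfolding F_def by (rule dirichlet_fun)
  then obtain a where
    a: "\<And>s. s \<in> half_plane 0 \<Longrightarrow> (\<lambda>n. a (Suc n) * of_nat (Suc n) powr (- s)) sums F s"
    by (auto simp: dirichlet_functions_def)
  have nrm: "cmod (of_nat (Suc n) powr s) = real (Suc n) powr Re s" for n s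
    by (subst norm_powr_real_powr) (auto simp del: of_nat_Suc)

  have "(\<lambda>n. a (Suc n) * of_nat (Suc n) powr (- 1)) \<longlonglongrightarrow> 0"
    using a[of 1] by (intro summable_LIMSEQ_zero) (auto simp: half_plane_def sums_iff)
  then have "Bseq (\<lambda>n. a (Suc n) * of_nat (Suc n) powr (- 1))"
    by (intro convergent_imp_Bseq) (auto simp: convergent_def)
  then obtain K where "K > 0"
    and K: "\<And>n. cmod (a (Suc n) * of_nat (Suc n) powr (- 1)) \<le> K"
    by (auto simp: Bseq_def)
  have aK: "cmod (a (Suc n)) \<le> K * real (Suc n)" for n
  proof -
    have "cmod (a (Suc n)) * real (Suc n) powr (- 1) \<le> K"
      using K[of n] nrm[of n "- 1"] by (simp add: norm_mult del: of_nat_Suc)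
    then show ?thesis by (simp add: powr_minus_divide field_simps del: of_nat_Suc)
  qed
  define G where "G n = K * real (Suc n) powr (- 2)" for n
  have sG: "summable G"
  proof -
    have "summable (\<lambda>n. real n powr (- 2))" by (subst summable_real_powr_iff) simp
    then show ?thesis unfolding G_def
      by (intro summable_mult) (subst (asm) summable_Suc_iff[symmetric])
  qed
  have far: "cmod (F s) \<le> suminf G" if "Re s \<ge> 3" for s
  proof -
    have s: "s \<in> half_plane 0" using that by (simp add: half_plane_def)
    have le: "cmod (a (Suc n) * of_nat (Suc n) powr (- s)) \<le> G n" for n
    proof -
      have "cmod (a (Suc n) * of_nat (Suc n) powr (- s)) =
          cmod (a (Suc n)) * real (Suc n) powr (- Re s)"
        using nrm[of n "- s"] by (simp add: norm_mult del: of_nat_Suc)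
      also have "\<dots> \<le> (K * real (Suc n)) * real (Suc n) powr (- 3)"
        using that \<open>K > 0\<close> by (intro mult_mono aK powr_mono) auto
      also have "\<dots> = K * (real (Suc n) powr 1 * real (Suc n) powr (- 3))"
        by (simp del: of_nat_Suc)
      also have "\<dots> = G n" unfolding G_def by (subst powr_add[symmetric]) simp
      finally show ?thesis .
    qed
    have "F s = (\<Sum>n. a (Suc n) * of_nat (Suc n) powr (- s))"
      using a[OF s] by (simp add: sums_iff)
    also have "cmod \<dots> \<le> suminf G" by (rule norm_suminf_le[OF le sG])
    finally show ?thesis .
  qed
  have "uniformly_continuous_on (half_plane 0) F"
    using F by (simp add: dirichlet_functions_def)
  then obtain d where "d > 0" and
    d: "\<And>s t. s \<in> half_plane 0 \<Longrightarrow> t \<in> half_plane 0 \<Longrightarrow> dist t s < d \<Longrightarrow> dist (F t) (F s) < 1"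
    unfolding uniformly_continuous_on_def by (metis zero_less_one)
  define h where "h = d / 2"
  have h: "h > 0" "h < d" using \<open>d > 0\<close> by (auto simp: h_def)
  have step: "cmod (F s) \<le> cmod (F (s + of_real (real m * h))) + real m"
    if "s \<in> half_plane 0" for s m
  proof (induction m)
    case (Suc m)
    let ?u = "s + of_real (real m * h)" and ?v = "s + of_real (real (Suc m) * h)"
    have Re: "Re ?u > 0" "Re ?v > 0"
      using that h by (auto simp: half_plane_def intro!: add_pos_nonneg)
    have "?u - ?v = of_real (- h)" by (simp add: algebra_simps)
    then have "dist ?u ?v = h" using h unfolding dist_norm by (simp del: of_real_minus)
    then have "dist (F ?u) (F ?v) < 1"
      using Re h by (intro d) (simp_all add: half_plane_def)
    then have "cmod (F ?u) \<le> cmod (F ?v) + 1"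
      using norm_triangle_sub[of "F ?u" "F ?v"] by (simp add: dist_norm)
    with Suc show ?case by simp
  qed simp
  obtain m where m: "3 \<le> real m * h"
    using ex_less_of_nat_mult[OF h(1), of 3] by (auto intro: less_imp_le)
  have "cmod (F s) \<le> suminf G + real m" if "s \<in> half_plane 0" for s
  proof -
    have "Re (s + of_real (real m * h)) \<ge> 3" using that m by (simp add: half_plane_def)
    from far[OF this] step[OF that, of m] show ?thesis by linarith
  qed
  then show ?thesis unfolding F_def by (rule bdd_aboveI2)
qed

instantiation dirichlet_algebra :: complex_normed_vector
begin

lift_definition zero_dirichlet_algebra :: dirichlet_algebra is "\<lambda>_. 0"
  by (rule dirichlet_functions_zero)
lift_definition plus_dirichlet_algebra ::
    "dirichlet_algebra \<Rightarrow> dirichlet_algebra \<Rightarrow> dirichlet_algebra" is "\<lambda>f g s. f s + g s"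
  by (rule dirichlet_functions_add)
lift_definition uminus_dirichlet_algebra ::
    "dirichlet_algebra \<Rightarrow> dirichlet_algebra" is "\<lambda>f s. - f s"
  using dirichlet_functions_scale[of _ "- 1"] by simp
lift_definition minus_dirichlet_algebra ::
    "dirichlet_algebra \<Rightarrow> dirichlet_algebra \<Rightarrow> dirichlet_algebra" is "\<lambda>f g s. f s - g s"
  using dirichlet_functions_add dirichlet_functions_scale[of _ "- 1"] by fastforce
lift_definition scaleR_dirichlet_algebra ::
    "real \<Rightarrow> dirichlet_algebra \<Rightarrow> dirichlet_algebra" is "\<lambda>r f s. complex_of_real r * f s"
  by (rule dirichlet_functions_scale)
lift_definition scaleC_dirichlet_algebra ::
    "complex \<Rightarrow> dirichlet_algebra \<Rightarrow> dirichlet_algebra" is "\<lambda>c f s. c * f s"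
  by (rule dirichlet_functions_scale)

definition norm_dirichlet_algebra :: "dirichlet_algebra \<Rightarrow> real"
  where "norm_dirichlet_algebra f = (SUP s\<in>half_plane 0. cmod (dirichlet_fun f s))"
definition sgn_dirichlet_algebra :: "dirichlet_algebra \<Rightarrow> dirichlet_algebra"
  where "sgn_dirichlet_algebra f = inverse (norm f) *\<^sub>R f"
definition dist_dirichlet_algebra :: "dirichlet_algebra \<Rightarrow> dirichlet_algebra \<Rightarrow> real"
  where "dist_dirichlet_algebra f g = norm (f - g)"
definition uniformity_dirichlet_algebra :: "(dirichlet_algebra \<times> dirichlet_algebra) filter"
  where "uniformity_dirichlet_algebra = (INF e\<in>{0<..}. principal {(f, g). dist f g < e})"
definition open_dirichlet_algebra :: "dirichlet_algebra set \<Rightarrow> bool"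
  where "open_dirichlet_algebra U \<longleftrightarrow>
    (\<forall>f\<in>U. \<forall>\<^sub>F (f', g) in uniformity. f' = f \<longrightarrow> g \<in> U)"

instance
proof
  fix x y z :: dirichlet_algebra and c d :: complex and r q :: real
  note ne = half_plane_nonempty[of 0]
  show "x + y + z = x + (y + z)" by transfer (simp add: add.assoc)
  show "x + y = y + x" by transfer (simp add: add.commute)
  show "0 + x = x" by transfer simp
  show "- x + x = 0" by transfer simp
  show "x - y = x + - y" by transfer simp
  show "r *\<^sub>R (x + y) = r *\<^sub>R x + r *\<^sub>R y" by transfer (simp add: algebra_simps)
  show "(r + q) *\<^sub>R x = r *\<^sub>R x + q *\<^sub>R x" by transfer (simp add: algebra_simps)
  show "r *\<^sub>R q *\<^sub>R x = (r * q) *\<^sub>R x" by transfer (simp add: algebra_simps)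
  show "1 *\<^sub>R x = x" by transfer simp
  show "c *\<^sub>C (x + y) = c *\<^sub>C x + c *\<^sub>C y" by transfer (simp add: algebra_simps)
  show "(c + d) *\<^sub>C x = c *\<^sub>C x + d *\<^sub>C x" by transfer (simp add: algebra_simps)
  show "c *\<^sub>C d *\<^sub>C x = (c * d) *\<^sub>C x" by transfer (simp add: algebra_simps)
  show "complex_of_real r *\<^sub>C x = r *\<^sub>R x" by transfer simp
  have "(\<forall>s\<in>half_plane 0. dirichlet_fun x s = 0) = (x = 0)"
    by transfer (auto simp: dirichlet_functions_def)
  then show "(norm x = 0) = (x = 0)"
    unfolding norm_dirichlet_algebra_def supnorm_eq0[OF ne bdd_dirichlet] .
  show "norm (x + y) \<le> norm x + norm y"
    using supnorm_triangle[OF ne bdd_dirichlet bdd_dirichlet, of x y]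
    by (simp add: norm_dirichlet_algebra_def plus_dirichlet_algebra.rep_eq)
  show "norm (r *\<^sub>R x) = \<bar>r\<bar> * norm x"
    using supnorm_scale[OF ne bdd_dirichlet, of "complex_of_real r" x]
    by (simp add: norm_dirichlet_algebra_def scaleR_dirichlet_algebra.rep_eq)
  show "norm (c *\<^sub>C x) = cmod c * norm x"
    using supnorm_scale[OF ne bdd_dirichlet, of c x]
    by (simp add: norm_dirichlet_algebra_def scaleC_dirichlet_algebra.rep_eq)
qed (simp_all add: sgn_dirichlet_algebra_def dist_dirichlet_algebra_def
    uniformity_dirichlet_algebra_def open_dirichlet_algebra_def)

end

definition comp_fun :: "(complex \<Rightarrow> complex) \<Rightarrow> (complex \<Rightarrow> complex) \<Rightarrow> complex \<Rightarrow> complex"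
  where "comp_fun \<Phi> f = (\<lambda>s. if s \<in> half_plane 0 then f (\<Phi> s) else 0)"

text \<open>Meaningful only if \<open>comp_fun \<Phi>\<close> maps \<open>dirichlet_functions\<close> into itself, since
  \<open>Abs_dirichlet\<close> is unspecified elsewhere.\<close>

definition composition_operator ::
    "(complex \<Rightarrow> complex) \<Rightarrow> dirichlet_algebra \<Rightarrow> dirichlet_algebra"
  where "composition_operator \<Phi> f = Abs_dirichlet (comp_fun \<Phi> (dirichlet_fun f))"

end

theory Submission
  imports Defs "HOL-Complex_Analysis.Complex_Analysis" "HOL-Real_Asymp.Real_Asymp"
begin

text \<open>By Perron's formula, the partial sums of a series in \<open>\<A>(\<complex>\<^sub>+)\<close> converge uniformly on
  \<open>\<complex>\<^sub>\<epsilon>\<close> at a rate depending only on \<open>\<epsilon>\<close> and on the norm. Hence the algebra is complete and, by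
  extraction of a subsequence with convergent coefficients, its bounded sequences are precompact
  for uniform convergence on \<open>\<complex>\<^sub>\<epsilon>\<close>; so the operator is compact if \<open>\<Phi>\<close> maps into \<open>\<complex>\<^sub>\<epsilon>\<close>.
  Otherwise \<open>2\<^bsup>- \<Phi>\<^esup>\<close> accumulates at a point of the unit circle. Differences \<open>q\<^bsup>a\<^esup> - q\<^bsup>b\<^esup>\<close> of powers of
  a function \<open>q\<close> of \<open>2\<^bsup>- s\<^esup>\<close> peaking at that point, with \<open>a < b\<close> chosen by a gliding hump, span a
  copy of \<open>c0\<close> that the operator fixes, and the images of their partial sums have no weak
  cluster point.\<close>

section \<open>Convergence and holomorphy of Dirichlet series\<close>

text \<open>The implications proved are (a) to (b), (b) to (c), (b) to (d) and, by contraposition,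
  (c) to (a) and (d) to (a); the last two share one sequence of humps. The obstacle to compactness
  is that membership in the algebra gives pointwise convergence of each series, with no rate common
  to the unit ball. Boundedness supplies one: the contour in Perron's formula can be moved left to
  Re w = - \<epsilon> / 2, where the integrand is at most
  \<open>norm f * x powr (- \<epsilon> / 2) / cmod w\<close>. As the integral of the kernel 1 / w
  converges only conditionally, it is cut at a height that is a power of x; this costs a logarithm,
  which the negative power of x outweighs. In the converse direction, a single power of q equals 1
  at the peak. A difference of two powers vanishes there, so each hump is small both near the peak
  and far from it, and humps can be placed one inside the other. Evaluation where the n-th hump is
  high recovers the n-th coordinate up to a small error; this yields the lower bound for c0 and the
  discrepancy of the iterated limits alike.\<close>

definition dirichlet_term :: "nat \<Rightarrow> complex \<Rightarrow> complex"
  where "dirichlet_term n s = of_nat (Suc n) powr (- s)"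

text \<open>Indices are shifted by one throughout: \<open>b n\<close> is the coefficient of (n +
  1)^(-s). Being a relation, it can be used with any coefficient sequence at hand, such as a
  difference of two.\<close>

definition dirichlet_coeffs :: "(nat \<Rightarrow> complex) \<Rightarrow> dirichlet_algebra \<Rightarrow> bool"
  where "dirichlet_coeffs b f \<longleftrightarrow>
    (\<forall>s\<in>half_plane 0. (\<lambda>n. b n * dirichlet_term n s) sums dirichlet_fun f s)"

lemma half_plane_iff [simp]: "s \<in> half_plane \<theta> \<longleftrightarrow> \<theta> < Re s"
  by (simp add: half_plane_def)

lemma open_half_plane: "open (half_plane \<theta>)"
  unfolding half_plane_def by (rule open_halfspace_Re_gt)

lemma convex_half_plane: "convex (half_plane \<theta>)"
  unfolding half_plane_def by (rule convex_halfspace_Re_gt)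

lemma norm_dirichlet_term: "cmod (dirichlet_term n s) = real (Suc n) powr (- Re s)"
  unfolding dirichlet_term_def by (subst norm_powr_real_powr) (auto simp del: of_nat_Suc)

lemma dirichlet_term_add: "dirichlet_term n (s + t) = dirichlet_term n s * dirichlet_term n t"
  by (simp add: dirichlet_term_def powr_add[symmetric] add.commute del: of_nat_Suc)

lemma dirichlet_term_exp: "dirichlet_term n s = exp (- s * of_real (ln (real (Suc n))))"
proof -
  have "Ln (of_nat (Suc n)) = of_real (ln (real (Suc n)))"
    using Ln_of_real[of "real (Suc n)"] by simp
  then show ?thesis by (simp add: dirichlet_term_def powr_def del: of_nat_Suc)
qed

lemma holomorphic_dirichlet_term [holomorphic_intros]:
  "g holomorphic_on S \<Longrightarrow> (\<lambda>s. dirichlet_term n (g s)) holomorphic_on S"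
  unfolding dirichlet_term_exp by (intro holomorphic_intros)

lemma dirichlet_coeffs_ex: obtains b where "dirichlet_coeffs b f"
proof -
  from dirichlet_fun[of f] obtain a where
    "\<forall>s\<in>half_plane 0. (\<lambda>n. a (Suc n) * of_nat (Suc n) powr (- s)) sums dirichlet_fun f s"
    unfolding dirichlet_functions_def by auto
  then have "dirichlet_coeffs (\<lambda>n. a (Suc n)) f"
    by (simp add: dirichlet_coeffs_def dirichlet_term_def)
  then show ?thesis by (rule that)
qed

lemma dirichlet_functionsI:
  assumes "\<And>s. Re s \<le> 0 \<Longrightarrow> f s = 0" "uniformly_continuous_on (half_plane 0) f"
    "\<And>s. 0 < Re s \<Longrightarrow> (\<lambda>n. b n * dirichlet_term n s) sums f s"
  shows "f \<in> dirichlet_functions"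
  unfolding dirichlet_functions_def mem_Collect_eq
proof (intro conjI)
  show "\<exists>a. \<forall>s\<in>half_plane 0. (\<lambda>n. a (Suc n) * of_nat (Suc n) powr (- s)) sums f s"
    using assms(3) by (intro exI[of _ "\<lambda>n. b (n - 1)"]) (auto simp: dirichlet_term_def)
qed (use assms in \<open>auto simp: not_less\<close>)

lemma norm_dirichlet_fun_le: "cmod (dirichlet_fun f s) \<le> norm f"
proof (cases "s \<in> half_plane 0")
  case True
  then show ?thesis unfolding norm_dirichlet_algebra_def by (rule cSUP_upper[OF _ bdd_dirichlet])
next
  case False
  then have "dirichlet_fun f s = 0" using dirichlet_fun[of f] by (auto simp: dirichlet_functions_def)
  then show ?thesis by simp
qed

lemma norm_dirichlet_leI:
  "(\<And>s. 0 < Re s \<Longrightarrow> cmod (dirichlet_fun f s) \<le> B) \<Longrightarrow> norm f \<le> B"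
  unfolding norm_dirichlet_algebra_def by (intro cSUP_least half_plane_nonempty) auto

lemma dirichlet_fun_eqI:
  "(\<And>s. 0 < Re s \<Longrightarrow> dirichlet_fun f s = dirichlet_fun g s) \<Longrightarrow> f = g"
  using norm_dirichlet_leI[of "f - g" 0] by (simp add: minus_dirichlet_algebra.rep_eq)

lemmas dirichlet_fun_simps =
  zero_dirichlet_algebra.rep_eq plus_dirichlet_algebra.rep_eq uminus_dirichlet_algebra.rep_eq
  minus_dirichlet_algebra.rep_eq scaleR_dirichlet_algebra.rep_eq scaleC_dirichlet_algebra.rep_eq

lemma bounded_clinear_eval: "bounded_clinear (\<lambda>f. dirichlet_fun f s)"
  unfolding bounded_clinear_on_def
  by (auto simp: dirichlet_fun_simps scaleC_complex_def norm_dirichlet_fun_le intro!: exI[of _ 1])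

lemma bounded_linear_eval: "bounded_linear (\<lambda>f. dirichlet_fun f s)"
  using bounded_clinear_eval[of s] bounded_clinear_iff by blast

lemma dirichlet_fun_sum: "dirichlet_fun (\<Sum>i\<in>I. f i) s = (\<Sum>i\<in>I. dirichlet_fun (f i) s)"
  by (rule linear_sum[OF bounded_linear.linear[OF bounded_linear_eval]])

lemma dirichlet_coeffs_diff:
  "dirichlet_coeffs b f \<Longrightarrow> dirichlet_coeffs c g \<Longrightarrow> dirichlet_coeffs (\<lambda>n. b n - c n) (f - g)"
  unfolding dirichlet_coeffs_def by (auto simp: dirichlet_fun_simps left_diff_distrib intro!: sums_diff)

text \<open>Mean value inequality for z powr (- w) on the segment from n + 1 to n + 2, where the
  derivative is largest at the left end.\<close>

lemma norm_dirichlet_term_diff: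
  assumes "0 < Re w"
  shows "cmod (dirichlet_term n w - dirichlet_term (Suc n) w) \<le> cmod w * real (Suc n) powr (- Re w - 1)"
proof -
  let ?S = "closed_segment (of_nat (Suc n)) (of_nat (Suc (Suc n))) :: complex set"
  have S: "\<exists>t. real (Suc n) \<le> t \<and> z = of_real t" if "z \<in> ?S" for z
  proof -
    from that obtain u where u: "0 \<le> u" "u \<le> 1"
      "z = (1 - u) *\<^sub>R of_nat (Suc n) + u *\<^sub>R of_nat (Suc (Suc n))"
      by (auto simp: in_segment)
    then have "z = of_real (real (Suc n) + u)"
      by (simp add: scaleR_conv_of_real algebra_simps)
    with u show ?thesis by (intro exI[of _ "real (Suc n) + u"]) auto
  qed
  have "cmod (of_nat (Suc n) powr - w - of_nat (Suc (Suc n)) powr - w) \<le>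
      cmod w * real (Suc n) powr (- Re w - 1) * cmod (of_nat (Suc n) - of_nat (Suc (Suc n)))"
  proof (rule field_differentiable_bound)
    fix z assume "z \<in> ?S"
    then obtain t where t: "real (Suc n) \<le> t" "z = of_real t" using S by blast
    then have "0 < t" by simp
    then have "z \<notin> \<real>\<^sub>\<le>\<^sub>0" using t by (auto simp: complex_nonpos_Reals_iff)
    then show "((\<lambda>z. z powr - w) has_field_derivative (- w) * z powr (- w - 1)) (at z within ?S)"
      by (auto intro!: derivative_eq_intros)
    have "cmod (z powr (- w - 1)) = t powr (- Re w - 1)"
      using \<open>0 < t\<close> t by (simp add: norm_powr_real_powr)
    also have "\<dots> \<le> real (Suc n) powr (- Re w - 1)"
      using t assms by (intro powr_mono2') auto
    finally show "cmod (- w * z powr (- w - 1)) \<le> cmod w * real (Suc n) powr (- Re w - 1)"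
      by (simp add: norm_mult mult_left_mono)
  qed auto
  then show ?thesis by (simp add: dirichlet_term_def norm_minus_commute)
qed

lemma sum_by_parts:
  fixes c u :: "nat \<Rightarrow> 'a::comm_ring_1"
  shows "(\<Sum>k<N. c k * u k) = (\<Sum>k<N. c k) * u N + (\<Sum>k<N. (\<Sum>j<Suc k. c j) * (u k - u (Suc k)))"
  by (induction N) (simp_all add: algebra_simps)

text \<open>Abel summation against the series at \<delta>: convergence there bounds the partial sums
  \<open>C\<close>, and the remaining factors (n + 1)^(\<delta> - s) tend to 0 with summable
  differences. The gap between \<delta> and 2 * \<delta> provides the decay; boundedness of
  \<open>X\<close> controls the factor |s - \<delta>| in the differences.\<close>

lemma dirichlet_series_uniform_limit:
  assumes sums: "\<And>s. 0 < Re s \<Longrightarrow> (\<lambda>n. b n * dirichlet_term n s) sums f s"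
    and X: "bounded X" "\<And>s. s \<in> X \<Longrightarrow> 2 * \<delta> \<le> Re s" and "0 < \<delta>"
  shows "uniform_limit X (\<lambda>N s. \<Sum>n<N. b n * dirichlet_term n s) f sequentially"
proof -
  define c where "c n = b n * dirichlet_term n (of_real \<delta>)" for n
  define C where "C N = (\<Sum>n<N. c n)" for N
  obtain R where R: "\<And>s. s \<in> X \<Longrightarrow> cmod s \<le> R" and "0 < R"
    using X(1) by (metis bounded_pos)
  have "c sums f (of_real \<delta>)" unfolding c_def using \<open>0 < \<delta>\<close> by (intro sums) simp
  then have "convergent C" unfolding C_def sums_def convergent_def by blast
  then obtain K where K: "\<And>n. cmod (C n) \<le> K" "0 < K"
    using convergent_imp_Bseq[of C] by (auto simp: Bseq_def)
  define u where "u n s = dirichlet_term n (s - of_real \<delta>)" for n s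
  have cu: "b n * dirichlet_term n s = c n * u n s" for n s
    using dirichlet_term_add[of n "of_real \<delta>" "s - of_real \<delta>"] by (simp add: c_def u_def)
  have u_le: "cmod (u n s) \<le> real (Suc n) powr - \<delta>" if "s \<in> X" for n s
    using X(2)[OF that] by (auto simp: u_def norm_dirichlet_term intro!: powr_mono)
  have lim0: "uniform_limit X (\<lambda>N s. C N * u N s) (\<lambda>_. 0) sequentially"
  proof (rule uniform_limit_null_comparison)
    have "\<forall>s\<in>X. cmod (C N * u N s) \<le> K * real (Suc N) powr - \<delta>" for N
      using K u_le unfolding norm_mult by (intro ballI mult_mono) (auto intro: less_imp_le)
    then show "\<forall>\<^sub>F N in sequentially. \<forall>s\<in>X. cmod (C N * u N s) \<le> K * real (Suc N) powr - \<delta>"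
      by simp
    have "(\<lambda>N. K * real (Suc N) powr - \<delta>) \<longlonglongrightarrow> 0" using \<open>0 < \<delta>\<close> by real_asymp
    then show "uniform_limit X (\<lambda>N s. K * real (Suc N) powr - \<delta>) (\<lambda>_. 0) sequentially"
      by (auto simp: uniform_limit_iff tendsto_iff elim: eventually_mono)
  qed
  have lim1: "uniform_limit X (\<lambda>N s. \<Sum>k<N. C (Suc k) * (u k s - u (Suc k) s))
      (\<lambda>s. \<Sum>k. C (Suc k) * (u k s - u (Suc k) s)) sequentially"
  proof (rule Weierstrass_m_test)
    fix n s assume s: "s \<in> X"
    have "cmod (s - of_real \<delta>) \<le> R + \<delta>"
      using norm_triangle_ineq4[of s "of_real \<delta>"] R[OF s] \<open>0 < \<delta>\<close> by simp
    moreover have "real (Suc n) powr (- Re (s - of_real \<delta>) - 1) \<le> real (Suc n) powr (- \<delta> - 1)"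
      using X(2)[OF s] by (intro powr_mono) auto
    moreover have "0 < Re (s - of_real \<delta>)" using X(2)[OF s] \<open>0 < \<delta>\<close> by simp
    ultimately have "cmod (u n s - u (Suc n) s) \<le> (R + \<delta>) * real (Suc n) powr (- \<delta> - 1)"
      unfolding u_def by (intro order_trans[OF norm_dirichlet_term_diff] mult_mono) (use \<open>0 < R\<close> \<open>0 < \<delta>\<close> in auto)
    then show "cmod (C (Suc n) * (u n s - u (Suc n) s)) \<le> K * ((R + \<delta>) * real (Suc n) powr (- \<delta> - 1))"
      using K by (simp add: norm_mult mult_mono less_imp_le)
  next
    have "summable (\<lambda>n. real n powr (- \<delta> - 1))" using \<open>0 < \<delta>\<close> by (simp add: summable_real_powr_iff)
    then show "summable (\<lambda>n. K * ((R + \<delta>) * real (Suc n) powr (- \<delta> - 1)))"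
      by (intro summable_mult) (subst (asm) summable_Suc_iff[symmetric])
  qed
  have eq: "(\<Sum>n<N. b n * dirichlet_term n s) =
      C N * u N s + (\<Sum>k<N. C (Suc k) * (u k s - u (Suc k) s))" for N s
    unfolding cu C_def by (rule sum_by_parts)
  have "uniform_limit X (\<lambda>N s. \<Sum>n<N. b n * dirichlet_term n s)
      (\<lambda>s. 0 + (\<Sum>k. C (Suc k) * (u k s - u (Suc k) s))) sequentially"
    unfolding eq by (intro uniform_limit_add lim0 lim1)
  moreover have "0 + (\<Sum>k. C (Suc k) * (u k s - u (Suc k) s)) = f s" if "s \<in> X" for s
  proof (rule LIMSEQ_unique)
    show "(\<lambda>N. \<Sum>n<N. b n * dirichlet_term n s) \<longlonglongrightarrow> 0 + (\<Sum>k. C (Suc k) * (u k s - u (Suc k) s))"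
      by (rule tendsto_uniform_limitI[OF calculation that])
    have "0 < Re s" using X(2)[OF that] \<open>0 < \<delta>\<close> by simp
    then show "(\<lambda>N. \<Sum>n<N. b n * dirichlet_term n s) \<longlonglongrightarrow> f s"
      using sums unfolding sums_def by blast
  qed
  ultimately show ?thesis by (simp cong: uniform_limit_cong')
qed

lemma dirichlet_series_holomorphic:
  assumes sums: "\<And>s. 0 < Re s \<Longrightarrow> (\<lambda>n. b n * dirichlet_term n s) sums f s"
  shows "f holomorphic_on half_plane 0"
proof (rule holomorphic_uniform_sequence[OF open_half_plane])
  show "(\<lambda>s. \<Sum>n<N. b n * dirichlet_term n s) holomorphic_on half_plane 0" for N
    by (intro holomorphic_intros)
  fix x assume x: "x \<in> half_plane 0"
  have Re: "Re x / 2 \<le> Re s" if "s \<in> cball x (Re x / 2)" for s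
    using that abs_Re_le_cmod[of "x - s"] by (auto simp: dist_norm)
  show "\<exists>d>0. cball x d \<subseteq> half_plane 0 \<and>
      uniform_limit (cball x d) (\<lambda>N s. \<Sum>n<N. b n * dirichlet_term n s) f sequentially"
    using x Re by (intro exI[of _ "Re x / 2"] conjI
        dirichlet_series_uniform_limit[OF sums, of _ "Re x / 4"]) fastforce+
qed

lemma holomorphic_dirichlet_fun: "dirichlet_fun f holomorphic_on half_plane 0"
proof -
  obtain b where "dirichlet_coeffs b f" by (rule dirichlet_coeffs_ex)
  then show ?thesis
    by (intro dirichlet_series_holomorphic[of b]) (auto simp: dirichlet_coeffs_def)
qed

section \<open>Coefficient bounds\<close>

lemma geometric_mean_tendsto_zero:
  fixes z :: complex
  assumes "cmod z = 1" "z \<noteq> 1"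
  shows "(\<lambda>K. (\<Sum>k<K. z ^ k) / of_nat K) \<longlonglongrightarrow> 0"
proof (rule Lim_null_comparison)
  have "cmod ((\<Sum>k<K. z ^ k) / of_nat K) \<le> 2 / cmod (z - 1) / real K" for K
  proof -
    have "cmod (\<Sum>k<K. z ^ k) = cmod (z ^ K - 1) / cmod (z - 1)"
      using assms(2) by (simp add: geometric_sum norm_divide)
    moreover have "cmod (z ^ K - 1) \<le> 2"
      using norm_triangle_ineq4[of "z ^ K" 1] assms(1) by (simp add: norm_power)
    ultimately have "cmod (\<Sum>k<K. z ^ k) \<le> 2 / cmod (z - 1)"
      by (simp add: divide_right_mono)
    from divide_right_mono[OF this, of "real K"] show ?thesis by (simp add: norm_divide)
  qed
  then show "\<forall>\<^sub>F K in sequentially. cmod ((\<Sum>k<K. z ^ k) / of_nat K) \<le> 2 / cmod (z - 1) / real K"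
    by simp
  show "(\<lambda>K. 2 / cmod (z - 1) / real K) \<longlonglongrightarrow> 0" by real_asymp
qed

lemma cis_neq_1:
  assumes "0 < \<bar>\<theta>\<bar>" "\<bar>\<theta>\<bar> \<le> 1"
  shows "cis \<theta> \<noteq> 1"
proof
  assume "cis \<theta> = 1"
  then have "sin \<theta> = 0" by (metis cis.sel(2) one_complex.sel(2))
  then have "sin \<bar>\<theta>\<bar> = 0" by (simp add: abs_if)
  moreover have "0 < sin \<bar>\<theta>\<bar>" using assms pi_gt3 by (intro sin_gt_zero) auto
  ultimately show False by simp
qed

text \<open>Convergence at 1 bounds the terms there, so the coefficients grow at most linearly, and
  abscissa 3 leaves the summable (n + 1)^(-2).\<close>

lemma dirichlet_coeffs_summable:
  assumes "dirichlet_coeffs b f" "3 \<le> \<sigma>"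
  shows "summable (\<lambda>n. cmod (b n) * real (Suc n) powr - \<sigma>)"
proof -
  have "summable (\<lambda>n. b n * dirichlet_term n 1)"
    using assms(1) by (auto simp: dirichlet_coeffs_def sums_iff)
  then have "(\<lambda>n. b n * dirichlet_term n 1) \<longlonglongrightarrow> 0" by (rule summable_LIMSEQ_zero)
  then have "Bseq (\<lambda>n. b n * dirichlet_term n 1)"
    by (intro convergent_imp_Bseq) (auto simp: convergent_def)
  then obtain K where K: "0 < K" "\<And>n. cmod (b n * dirichlet_term n 1) \<le> K"
    by (auto simp: Bseq_def)
  show ?thesis
  proof (rule summable_comparison_test)
    have "norm (cmod (b n) * real (Suc n) powr - \<sigma>) \<le> K * real (Suc n) powr - 2" for n
    proof -
      have "norm (cmod (b n) * real (Suc n) powr - \<sigma>) =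
          cmod (b n * dirichlet_term n 1) * real (Suc n) powr (1 - \<sigma>)"
        by (simp add: norm_mult norm_dirichlet_term powr_diff powr_minus_divide del: of_nat_Suc)
      also have "\<dots> \<le> K * real (Suc n) powr - 2"
        using K assms(2) by (intro mult_mono powr_mono) auto
      finally show ?thesis .
    qed
    then show "\<exists>N. \<forall>n\<ge>N. norm (cmod (b n) * real (Suc n) powr - \<sigma>) \<le> K * real (Suc n) powr - 2"
      by blast
    have "summable (\<lambda>n. real n powr (- 2))" by (subst summable_real_powr_iff) simp
    then show "summable (\<lambda>n. K * real (Suc n) powr - 2)"
      by (intro summable_mult) (subst (asm) summable_Suc_iff[symmetric])
  qed
qed

text \<open>Discrete form of the mean value formula: the averages of
  \<open>f (3 + i k h) (n + 1)\<^bsup>i k h\<^esup>\<close> over \<open>k\<close> isolate the \<open>n\<close>-th coefficient, the step \<open>h\<close>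
  being so small that none of the other relevant frequencies resonates.\<close>

lemma dirichlet_coeff_bound:
  assumes b: "dirichlet_coeffs b f"
  shows "cmod (b n) \<le> norm f * real (Suc n) ^ 3"
proof -
  define d where "d m = b m * dirichlet_term m 3" for m
  have nd: "cmod (d m) = cmod (b m) * real (Suc m) powr - 3" for m
    by (simp add: d_def norm_mult norm_dirichlet_term)
  have sd: "summable (\<lambda>m. cmod (d m))"
    using dirichlet_coeffs_summable[OF b, of 3] unfolding nd by simp
  have "cmod (d n) \<le> norm f"
  proof (rule field_le_epsilon)
    fix \<eta> :: real assume "0 < \<eta>"
    then obtain M0 where M0: "\<And>M. M \<ge> M0 \<Longrightarrow> norm (\<Sum>i. cmod (d (i + M))) < \<eta>"
      using suminf_exist_split[OF _ sd] by blast
    \<comment> \<open>The terms from \<open>M\<close> on contribute at most \<eta> in total,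
      whatever their phases; \<open>n\<close> itself stays among the finitely many terms that are
      averaged exactly.\<close>
    define M where "M = max M0 (Suc n)"
    have M: "n < M" "(\<Sum>i. cmod (d (i + M))) \<le> \<eta>"
      using M0[of M] by (auto simp: M_def)
    \<comment> \<open>The logarithms involved differ by at most \<open>M\<close>, so the angles
      \<open>\<theta> m\<close> lie in [-1, 1], where 0 is the only multiple of 2 \<pi>.\<close>
    define h where "h = 1 / real M"
    define \<theta> where "\<theta> m = h * (ln (real (Suc n)) - ln (real (Suc m)))" for m
    define t where "t k = Complex 0 (real k * h)" for k
    have \<theta>: "cis (\<theta> m) \<noteq> 1" if m: "m < M" "m \<noteq> n" for m
    proof (rule cis_neq_1)
      have "ln (real (Suc n)) \<noteq> ln (real (Suc m))" using m by simp
      moreover have "0 < h" using M by (simp add: h_def)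
      ultimately show "0 < \<bar>\<theta> m\<bar>" by (simp add: \<theta>_def)
      have ln: "0 \<le> ln (real (Suc j))" "ln (real (Suc j)) \<le> real M" if "j < M" for j
        using ln_add_one_self_le_self[of "real j"] that by (simp_all add: add.commute)
      have "\<bar>ln (real (Suc n)) - ln (real (Suc m))\<bar> \<le> real M"
        using ln[of n] ln[of m] m M by linarith
      then show "\<bar>\<theta> m\<bar> \<le> 1" using M by (simp add: \<theta>_def h_def abs_mult field_simps)
    qed
    have freq: "dirichlet_term m (3 + t k) * dirichlet_term n (- t k) = dirichlet_term m 3 * cis (\<theta> m) ^ k" for m k
    proof -
      have "dirichlet_term m (t k) * dirichlet_term n (- t k) = cis (\<theta> m) ^ k"
        unfolding Complex.DeMoivre
        by (simp add: dirichlet_term_exp exp_add[symmetric] cis_conv_exp t_def \<theta>_def complex_eq_iff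
            algebra_simps Complex_eq exp_of_nat_mult[symmetric] del: of_nat_Suc)
      then show ?thesis by (simp add: dirichlet_term_add)
    qed
    define A where "A K = (\<Sum>m<M. d m * ((\<Sum>k<K. cis (\<theta> m) ^ k) / of_nat K))" for K
    have le: "cmod (A K) \<le> norm f + \<eta>" if "0 < K" for K
    proof -
      have *: "cmod (\<Sum>m<M. d m * cis (\<theta> m) ^ k) \<le> norm f + \<eta>" for k
      proof -
        have "(\<lambda>m. b m * dirichlet_term m (3 + t k) * dirichlet_term n (- t k)) sums
            (dirichlet_fun f (3 + t k) * dirichlet_term n (- t k))"
          using b by (intro sums_mult2) (auto simp: dirichlet_coeffs_def t_def)
        then have s: "(\<lambda>m. d m * cis (\<theta> m) ^ k) sums (dirichlet_fun f (3 + t k) * dirichlet_term n (- t k))"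
          unfolding mult.assoc freq by (simp add: d_def mult.assoc)
        have "(\<Sum>m<M. d m * cis (\<theta> m) ^ k) = dirichlet_fun f (3 + t k) * dirichlet_term n (- t k)
            - (\<Sum>m. d (m + M) * cis (\<theta> (m + M)) ^ k)"
          using suminf_split_initial_segment[of "\<lambda>m. d m * cis (\<theta> m) ^ k" M] s by (simp add: sums_iff)
        also have "cmod \<dots> \<le> norm f + \<eta>"
        proof (rule order_trans[OF norm_triangle_ineq4 add_mono])
          show "cmod (dirichlet_fun f (3 + t k) * dirichlet_term n (- t k)) \<le> norm f"
            by (simp add: norm_mult norm_dirichlet_term t_def norm_dirichlet_fun_le)
          have "cmod (\<Sum>m. d (m + M) * cis (\<theta> (m + M)) ^ k) \<le> (\<Sum>m. cmod (d (m + M)))"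
            using summable_ignore_initial_segment[OF sd] by (intro norm_suminf_le) (auto simp: norm_mult norm_power)
          with M show "cmod (\<Sum>m. d (m + M) * cis (\<theta> (m + M)) ^ k) \<le> \<eta>" by simp
        qed
        finally show ?thesis .
      qed
      have "A K = (\<Sum>m<M. \<Sum>k<K. d m * cis (\<theta> m) ^ k) / of_nat K"
        unfolding A_def by (simp add: sum_divide_distrib sum_distrib_left)
      also have "\<dots> = (\<Sum>k<K. \<Sum>m<M. d m * cis (\<theta> m) ^ k) / of_nat K"
        by (subst sum.swap) simp
      also have "cmod \<dots> \<le> (real K * (norm f + \<eta>)) / real K"
        unfolding norm_divide norm_of_nat
        using sum_norm_bound[of "{..<K}" "\<lambda>k. \<Sum>m<M. d m * cis (\<theta> m) ^ k" "norm f + \<eta>", OF *]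
        by (intro divide_right_mono) auto
      finally show ?thesis using that by simp
    qed
    have "A \<longlonglongrightarrow> (\<Sum>m<M. d m * (if m = n then 1 else 0))"
      unfolding A_def
    proof (intro tendsto_sum tendsto_mult tendsto_const)
      fix m assume "m \<in> {..<M}"
      show "(\<lambda>K. (\<Sum>k<K. cis (\<theta> m) ^ k) / of_nat K) \<longlonglongrightarrow> (if m = n then 1 else 0)"
      proof (cases "m = n")
        case True
        have "\<forall>\<^sub>F K in sequentially. (\<Sum>k<K. cis (\<theta> m) ^ k) / of_nat K = 1"
          using eventually_gt_at_top[of 0] by eventually_elim (simp add: \<theta>_def True)
        with True show ?thesis by (simp add: tendsto_eventually)
      next
        case False
        then show ?thesis using \<theta> \<open>m \<in> {..<M}\<close> by (simp add: geometric_mean_tendsto_zero)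
      qed
    qed
    also have "(\<Sum>m<M. d m * (if m = n then 1 else 0)) = d n"
      using M by (simp add: if_distrib sum.delta cong: if_cong)
    finally show "cmod (d n) \<le> norm f + \<eta>"
      by (rule tendsto_upperbound[OF tendsto_norm])
        (auto intro!: eventually_sequentiallyI[of 1] simp: le)
  qed
  then show ?thesis
    by (simp add: nd powr_minus_divide powr_numeral field_simps del: of_nat_Suc)
qed

section \<open>Perron's formula\<close>

lemma contour_integral_rectpath:
  assumes "continuous_on (path_image (rectpath a c)) f"
  shows "contour_integral (rectpath a c) f =
    contour_integral (linepath a (Complex (Re c) (Im a))) f +
    contour_integral (linepath (Complex (Re c) (Im a)) c) f +
    contour_integral (linepath c (Complex (Re a) (Im c))) f +
    contour_integral (linepath (Complex (Re a) (Im c)) a) f"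
proof -
  note * = contour_integrable_continuous_linepath continuous_on_subset[OF assms]
  have "f contour_integrable_on linepath a (Complex (Re c) (Im a))"
    "f contour_integrable_on linepath (Complex (Re c) (Im a)) c"
    "f contour_integrable_on linepath c (Complex (Re a) (Im c))"
    "f contour_integrable_on linepath (Complex (Re a) (Im c)) a"
    by (intro *; auto simp: rectpath_def Let_def path_image_join)+
  then show ?thesis
    by (simp add: rectpath_def Let_def contour_integral_join contour_integrable_join
        valid_path_join valid_path_linepath add.assoc)
qed

lemma norm_contour_integral_linepath_le:
  assumes "continuous_on (closed_segment a b) f" "\<And>z. z \<in> closed_segment a b \<Longrightarrow> cmod (f z) \<le> B"
    "cmod (b - a) \<le> l"
  shows "cmod (contour_integral (linepath a b) f) \<le> B * l"
proof -
  have "0 \<le> B" using assms(2)[of a] norm_ge_zero[of "f a"] by (simp del: norm_ge_zero)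
  then have "cmod (contour_integral (linepath a b) f) \<le> B * cmod (b - a)"
    using assms by (intro contour_integral_bound_linepath contour_integrable_continuous_linepath)
  also have "\<dots> \<le> B * l" using assms(3) \<open>0 \<le> B\<close> by (rule mult_left_mono)
  finally show ?thesis .
qed

lemma closed_segment_vertical:
  "z \<in> closed_segment (Complex x y) (Complex x y') \<Longrightarrow> Re z = x \<and> Im z \<in> closed_segment y y'"
  by (auto simp: in_segment complex_eq_iff algebra_simps)

lemma closed_segment_horizontal:
  "z \<in> closed_segment (Complex x y) (Complex x' y) \<Longrightarrow> Im z = y \<and> Re z \<in> closed_segment x x'"
  by (auto simp: in_segment complex_eq_iff algebra_simps)

definition vertical :: "real \<Rightarrow> real \<Rightarrow> real \<Rightarrow> complex"
  where "vertical c T = linepath (Complex c (- T)) (Complex c T)"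

lemma path_image_vertical:
  "0 \<le> T \<Longrightarrow> z \<in> path_image (vertical c T) \<Longrightarrow> Re z = c \<and> \<bar>Im z\<bar> \<le> T"
  unfolding vertical_def path_image_linepath
  by (drule closed_segment_vertical) (auto simp: closed_segment_eq_real_ivl)

text \<open>For the kernel \<open>1 / w\<^sup>2\<close>, unlike for \<open>1 / w\<close>, the remote sides of a rectangle of width
  about \<open>T\<close> are controlled by length times supremum.\<close>

lemma perron_square_kernel:
  assumes "0 < c" "c < T" "L \<noteq> 0"
  shows "cmod (contour_integral (vertical c T) (\<lambda>w. exp (of_real L * w) / w ^ 2)
      - (if 0 < L then 2 * pi * \<i> * L else 0)) \<le> 6 * exp (L * c) / T"
proof (cases "0 < L")
  case True
  \<comment> \<open>For L > 0 the exponential decays to the left, so the rectangle is closed on that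
    side and encloses the pole.\<close>
  define a where "a = Complex (- T) (- T)"
  define d where "d = Complex c T"
  define f where "f w = exp (of_real L * w) / w ^ 2" for w :: complex
  let ?R = "rectpath a d"
  have T: "0 < T" using assms by simp
  have box: "0 \<in> box a d" using assms by (auto simp: in_box_complex_iff a_def d_def)
  have nz: "0 \<notin> path_image ?R"
    using path_image_rectpath_inter_box[of a d] box assms by (auto simp: a_def d_def)
  have cont: "continuous_on S f" if "0 \<notin> S" for S
    unfolding f_def using that by (auto intro!: continuous_intros)
  \<comment> \<open>The integrand is the derivative of exp (L w) / w, so its integral over a closed
    path vanishes; this reduces the double pole to Cauchy's formula for a simple one.\<close>
  have "((\<lambda>w. L * (exp (of_real L * w) / w) - f w) has_contour_integral
      (exp (of_real L * pathfinish ?R) / pathfinish ?R - exp (of_real L * pathstart ?R) / pathstart ?R)) ?R"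
    by (rule contour_integral_primitive[of "- {0}" "\<lambda>w. exp (of_real L * w) / w"])
      (use nz in \<open>auto intro!: derivative_eq_intros simp: f_def field_simps power2_eq_square\<close>)
  then have 1: "((\<lambda>w. L * (exp (of_real L * w) / w) - f w) has_contour_integral 0) ?R" by simp
  have "((\<lambda>w. exp (of_real L * w) / (w - 0)) has_contour_integral
      (2 * pi * \<i> * winding_number ?R 0 * exp (of_real L * 0))) ?R"
    using nz by (intro Cauchy_integral_formula_convex_simple[of UNIV]) (auto intro!: holomorphic_intros)
  then have "((\<lambda>w. L * (exp (of_real L * w) / w)) has_contour_integral (L * (2 * pi * \<i>))) ?R"
    using winding_number_rectpath[OF box] by (intro has_contour_integral_lmul) simp
  from has_contour_integral_diff[OF this 1] have "(f has_contour_integral 2 * pi * \<i> * L) ?R"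
    by (simp add: algebra_simps)
  then have "contour_integral ?R f = 2 * pi * \<i> * L" by (rule contour_integral_unique)
  moreover have "contour_integral ?R f = contour_integral (linepath a (Complex c (- T))) f +
    contour_integral (vertical c T) f +
    contour_integral (linepath d (Complex (- T) T)) f +
    contour_integral (linepath (Complex (- T) T) a) f"
    using contour_integral_rectpath[OF cont[OF nz]] by (simp add: a_def d_def vertical_def)
  ultimately have eq: "contour_integral (vertical c T) f - 2 * pi * \<i> * L =
    - (contour_integral (linepath a (Complex c (- T))) f +
    contour_integral (linepath d (Complex (- T) T)) f +
    contour_integral (linepath (Complex (- T) T) a) f)" by (simp add: algebra_simps)
  have bound: "cmod (f w) \<le> exp (L * c) / T ^ 2" if "Re w \<le> c" "T \<le> \<bar>Re w\<bar> \<or> T \<le> \<bar>Im w\<bar>" for w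
  proof -
    have "T \<le> cmod w" using that(2) abs_Re_le_cmod[of w] abs_Im_le_cmod[of w] by linarith
    then show ?thesis
      using that T True unfolding f_def norm_divide norm_power norm_exp_eq_Re
      by (intro frac_le) (auto intro!: power_mono mult_left_mono)
  qed
  \<comment> \<open>Each of the three remaining sides has length at most 2 * T, which makes up the
    constant 6.\<close>
  have h1: "cmod (contour_integral (linepath a (Complex c (- T))) f) \<le> exp (L * c) / T ^ 2 * (2 * T)"
  proof (rule norm_contour_integral_linepath_le)
    show "cmod (f z) \<le> exp (L * c) / T ^ 2" if "z \<in> closed_segment a (Complex c (- T))" for z
      using closed_segment_horizontal[OF that[unfolded a_def]] assms
      by (intro bound) (auto simp: closed_segment_eq_real_ivl)
    show "continuous_on (closed_segment a (Complex c (- T))) f"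
      using T unfolding a_def by (intro cont) (auto dest: closed_segment_horizontal)
  qed (use assms in \<open>auto simp: a_def cmod_def real_sqrt_mult\<close>)
  have h2: "cmod (contour_integral (linepath d (Complex (- T) T)) f) \<le> exp (L * c) / T ^ 2 * (2 * T)"
  proof (rule norm_contour_integral_linepath_le)
    show "cmod (f z) \<le> exp (L * c) / T ^ 2" if "z \<in> closed_segment d (Complex (- T) T)" for z
      using closed_segment_horizontal[OF that[unfolded d_def]] assms
      by (intro bound) (auto simp: closed_segment_eq_real_ivl)
    show "continuous_on (closed_segment d (Complex (- T) T)) f"
      using T unfolding d_def by (intro cont) (auto dest: closed_segment_horizontal)
  qed (use assms in \<open>auto simp: d_def cmod_def real_sqrt_mult\<close>)
  have h3: "cmod (contour_integral (linepath (Complex (- T) T) a) f) \<le> exp (L * c) / T ^ 2 * (2 * T)"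
  proof (rule norm_contour_integral_linepath_le)
    show "cmod (f z) \<le> exp (L * c) / T ^ 2" if "z \<in> closed_segment (Complex (- T) T) a" for z
      using closed_segment_vertical[OF that[unfolded a_def]] assms
      by (intro bound) (auto simp: closed_segment_eq_real_ivl)
    show "continuous_on (closed_segment (Complex (- T) T) a) f"
      using T unfolding a_def by (intro cont) (auto dest: closed_segment_vertical)
  qed (use assms in \<open>auto simp: a_def cmod_def real_sqrt_mult\<close>)
  have "cmod (contour_integral (vertical c T) f - 2 * pi * \<i> * L) \<le> exp (L * c) / T ^ 2 * (2 * T) + exp (L * c) / T ^ 2 * (2 * T) + exp (L * c) / T ^ 2 * (2 * T)"
    unfolding eq norm_minus_cancel by (intro norm_triangle_mono h1 h2 h3)
  also have "\<dots> = 6 * exp (L * c) / T" using T by (simp add: power2_eq_square)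
  finally show ?thesis using True by (simp add: f_def[abs_def])
next
  case False
  then have L: "L < 0" using assms by simp
  \<comment> \<open>For L < 0 the rectangle is closed on the right, away from the pole.\<close>
  define a where "a = Complex c (- T)"
  define d where "d = Complex T T"
  define f where "f w = exp (of_real L * w) / w ^ 2" for w :: complex
  let ?R = "rectpath a d"
  have T: "0 < T" using assms by simp
  have sub: "path_image ?R \<subseteq> half_plane 0"
    using path_image_rectpath_subset_cbox[of a d] assms by (force simp: a_def d_def in_cbox_complex_iff)
  have hol: "f holomorphic_on half_plane 0"
    unfolding f_def by (auto intro!: holomorphic_intros)
  have cont: "continuous_on S f" if "S \<subseteq> half_plane 0" for S
    using hol that holomorphic_on_imp_continuous_on holomorphic_on_subset by blast
  have "(f has_contour_integral 0) ?R"
    by (rule Cauchy_theorem_convex_simple[OF hol convex_half_plane _ sub]) auto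
  then have "contour_integral ?R f = 0" by (rule contour_integral_unique)
  moreover have rev: "contour_integral (linepath (Complex c T) (Complex c (- T))) f =
      - contour_integral (linepath (Complex c (- T)) (Complex c T)) f"
    using closed_segment_vertical[of _ c T "- T"] assms
    by (intro contour_integral_reverse_linepath cont) auto
  moreover have "contour_integral ?R f = contour_integral (linepath a (Complex T (- T))) f +
    contour_integral (linepath (Complex T (- T)) d) f +
    contour_integral (linepath d (Complex c T)) f -
    contour_integral (vertical c T) f"
    using contour_integral_rectpath[OF cont[OF sub]] rev by (simp add: a_def d_def vertical_def)
  ultimately have eq: "contour_integral (vertical c T) f =
    contour_integral (linepath a (Complex T (- T))) f +
    contour_integral (linepath (Complex T (- T)) d) f +
    contour_integral (linepath d (Complex c T)) f" by (simp add: algebra_simps)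
  have bound: "cmod (f w) \<le> exp (L * c) / T ^ 2" if "c \<le> Re w" "T \<le> \<bar>Re w\<bar> \<or> T \<le> \<bar>Im w\<bar>" for w
  proof -
    have "T \<le> cmod w" using that(2) abs_Re_le_cmod[of w] abs_Im_le_cmod[of w] by linarith
    then show ?thesis
      using that T L unfolding f_def norm_divide norm_power norm_exp_eq_Re
      by (intro frac_le) (auto intro!: power_mono mult_left_mono_neg)
  qed
  have h1: "cmod (contour_integral (linepath a (Complex T (- T))) f) \<le> exp (L * c) / T ^ 2 * (2 * T)"
  proof (rule norm_contour_integral_linepath_le)
    show "cmod (f z) \<le> exp (L * c) / T ^ 2" if "z \<in> closed_segment a (Complex T (- T))" for z
      using closed_segment_horizontal[OF that[unfolded a_def]] assms
      by (intro bound) (auto simp: closed_segment_eq_real_ivl)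
    show "continuous_on (closed_segment a (Complex T (- T))) f"
      using assms unfolding a_def by (intro cont) (auto dest!: closed_segment_horizontal simp: closed_segment_eq_real_ivl)
  qed (use assms in \<open>auto simp: a_def cmod_def real_sqrt_mult\<close>)
  have h2: "cmod (contour_integral (linepath d (Complex c T)) f) \<le> exp (L * c) / T ^ 2 * (2 * T)"
  proof (rule norm_contour_integral_linepath_le)
    show "cmod (f z) \<le> exp (L * c) / T ^ 2" if "z \<in> closed_segment d (Complex c T)" for z
      using closed_segment_horizontal[OF that[unfolded d_def]] assms
      by (intro bound) (auto simp: closed_segment_eq_real_ivl)
    show "continuous_on (closed_segment d (Complex c T)) f"
      using assms unfolding d_def by (intro cont) (auto dest!: closed_segment_horizontal simp: closed_segment_eq_real_ivl)
  qed (use assms in \<open>auto simp: d_def cmod_def real_sqrt_mult\<close>)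
  have h3: "cmod (contour_integral (linepath (Complex T (- T)) d) f) \<le> exp (L * c) / T ^ 2 * (2 * T)"
  proof (rule norm_contour_integral_linepath_le)
    show "cmod (f z) \<le> exp (L * c) / T ^ 2" if "z \<in> closed_segment (Complex T (- T)) d" for z
      using closed_segment_vertical[OF that[unfolded d_def]] assms
      by (intro bound) (auto simp: closed_segment_eq_real_ivl)
    show "continuous_on (closed_segment (Complex T (- T)) d) f"
      using T unfolding d_def by (intro cont) (auto dest: closed_segment_vertical)
  qed (use assms in \<open>auto simp: d_def cmod_def real_sqrt_mult\<close>)
  have "cmod (contour_integral (vertical c T) f) \<le> exp (L * c) / T ^ 2 * (2 * T) + exp (L * c) / T ^ 2 * (2 * T) + exp (L * c) / T ^ 2 * (2 * T)"
    unfolding eq by (intro norm_triangle_mono h1 h2 h3)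
  also have "\<dots> = 6 * exp (L * c) / T" using T by (simp add: power2_eq_square)
  finally show ?thesis using False by (simp add: f_def[abs_def])
qed

text \<open>Integration by parts along the segment passes from 1 / w to 1 / w^2 at the price of a
  factor 1 / |L|. The two boundary terms add at most exp (L c) / T each, which raises 6 to
  8.\<close>

lemma perron_kernel:
  assumes "0 < c" "c < T" "L \<noteq> 0"
  shows "cmod (contour_integral (vertical c T) (\<lambda>w. exp (of_real L * w) / w)
      - (if 0 < L then 2 * pi * \<i> else 0)) \<le> 8 * exp (L * c) / (T * \<bar>L\<bar>)"
proof -
  let ?g = "\<lambda>w::complex. exp (of_real L * w) / w"
  let ?I1 = "contour_integral (vertical c T) ?g"
  let ?I2 = "contour_integral (vertical c T) (\<lambda>w. exp (of_real L * w) / w ^ 2)"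
  let ?e = "if 0 < L then 2 * pi * \<i> else 0"
  have nz: "0 \<notin> path_image (vertical c T)" using path_image_vertical[of T 0 c] assms by auto
  have int: "(\<lambda>w. exp (of_real L * w) / w ^ k) contour_integrable_on vertical c T" for k
    unfolding vertical_def using nz unfolding vertical_def path_image_linepath
    by (intro contour_integrable_continuous_linepath) (auto intro!: continuous_intros)
  have "((\<lambda>w. L * ?g w - exp (of_real L * w) / w ^ 2) has_contour_integral
      (?g (pathfinish (vertical c T)) - ?g (pathstart (vertical c T)))) (vertical c T)"
    by (rule contour_integral_primitive[of "- {0}"])
      (use nz in \<open>auto intro!: derivative_eq_intros simp: field_simps power2_eq_square vertical_def\<close>)
  moreover have "((\<lambda>w. L * ?g w - exp (of_real L * w) / w ^ 2) has_contour_integral (L * ?I1 - ?I2)) (vertical c T)"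
    using int[of 1] int[of 2]
    by (intro has_contour_integral_diff has_contour_integral_lmul has_contour_integral_integral) auto
  ultimately have "L * ?I1 - ?I2 = ?g (Complex c T) - ?g (Complex c (- T))"
    by (auto simp: vertical_def dest: has_contour_integral_unique)
  then have "L * (?I1 - ?e) = (?I2 - (if 0 < L then 2 * pi * \<i> * L else 0)) + (?g (Complex c T) - ?g (Complex c (- T)))"
    by (auto simp: algebra_simps)
  also have "cmod \<dots> \<le> 6 * exp (L * c) / T + (exp (L * c) / T + exp (L * c) / T)"
  proof (intro norm_triangle_mono perron_square_kernel assms order_trans[OF norm_triangle_ineq4] add_mono)
    have "T \<le> cmod (Complex c T)" "T \<le> cmod (Complex c (- T))"
      using abs_Im_le_cmod[of "Complex c T"] abs_Im_le_cmod[of "Complex c (- T)"] by auto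
    then show "cmod (?g (Complex c T)) \<le> exp (L * c) / T" "cmod (?g (Complex c (- T))) \<le> exp (L * c) / T"
      using assms by (simp_all add: norm_divide frac_le)
  qed
  finally have "\<bar>L\<bar> * cmod (?I1 - ?e) \<le> 8 * exp (L * c) / T" by (simp add: norm_mult)
  then show ?thesis using assms by (simp add: field_simps)
qed

lemma summable_inverse_Suc_square: "summable (\<lambda>n. inverse (real (Suc n) ^ 2))"
  by (subst summable_Suc_iff[of "\<lambda>n. inverse (real n ^ 2)"]) (simp add: inverse_power_summable)

text \<open>The integral of \<open>1 / \<bar>w\<bar>\<close> along the segment is \<open>2 arsinh (T / \<delta>)\<close>.\<close>

lemma norm_contour_integral_vertical_le:
  assumes "0 < \<delta>" "0 < T" "0 \<le> B" "continuous_on (path_image (vertical (- \<delta>) T)) F"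
    and le: "\<And>w. Re w = - \<delta> \<Longrightarrow> cmod (F w) \<le> B / cmod w"
  shows "cmod (contour_integral (vertical (- \<delta>) T) F) \<le> 2 * B * arsinh (T / \<delta>)"
proof -
  define g where "g t = linepath (Complex (- \<delta>) (- T)) (Complex (- \<delta>) T) t" for t
  \<comment> \<open>\<open>k\<close> is the majorant of the integrand, speed 2 * T included, and at
    the same time the derivative of \<open>B * arsinh (T * (2 * t - 1) / \<delta>)\<close>.\<close>
  define k where "k t = B * (2 * T / \<delta> * (1 / sqrt ((T * (2 * t - 1) / \<delta>)\<^sup>2 + 1)))" for t
  have g: "g t = Complex (- \<delta>) (T * (2 * t - 1))" for t
    by (simp add: g_def linepath_def complex_eq_iff algebra_simps)
  have "F contour_integrable_on vertical (- \<delta>) T"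
    using assms(4) unfolding vertical_def path_image_linepath by (rule contour_integrable_continuous_linepath)
  then have "(F has_contour_integral contour_integral (vertical (- \<delta>) T) F) (vertical (- \<delta>) T)"
    by (rule has_contour_integral_integral)
  then have int: "((\<lambda>t. F (g t) * Complex 0 (2 * T)) has_integral contour_integral (vertical (- \<delta>) T) F) {0..1}"
    unfolding vertical_def has_contour_integral_linepath g_def by (simp add: complex_diff[symmetric] Complex_eq algebra_simps)
  have "(k has_integral (B * arsinh (T * (2 * 1 - 1) / \<delta>) - B * arsinh (T * (2 * 0 - 1) / \<delta>))) {0..1}"
    unfolding k_def
    by (intro fundamental_theorem_of_calculus)
      (use assms(1) in \<open>auto intro!: derivative_eq_intros DERIV_chain2[OF arsinh_real_has_field_derivative]
        simp: mult_ac has_real_derivative_iff_has_vector_derivative[symmetric]\<close>)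
  then have k: "(k has_integral 2 * B * arsinh (T / \<delta>)) {0..1}"
    by (simp add: mult.assoc)
  have "cmod (integral {0..1} (\<lambda>t. F (g t) * Complex 0 (2 * T))) \<le> integral {0..1} k"
  proof (rule integral_norm_bound_integral)
    fix t :: real
    define r where "r = sqrt ((T * (2 * t - 1) / \<delta>)\<^sup>2 + 1)"
    have "cmod (g t) = sqrt (\<delta>\<^sup>2 * ((T * (2 * t - 1) / \<delta>)\<^sup>2 + 1))"
      using assms(1) by (simp add: g cmod_def field_simps power2_eq_square)
    also have "\<dots> = \<delta> * r" using assms(1) by (simp add: real_sqrt_mult r_def)
    finally have "cmod (F (g t)) * (2 * T) \<le> B / (\<delta> * r) * (2 * T)"
      using le[of "g t"] assms(2) by (intro mult_right_mono) (auto simp: g)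
    then show "cmod (F (g t) * Complex 0 (2 * T)) \<le> k t"
      using assms(2) by (simp add: norm_mult k_def r_def complex_norm real_sqrt_mult mult_ac)
  qed (use int k in blast)+
  with int k show ?thesis by (simp add: has_integral_iff)
qed

text \<open>Cutting at a half-integer keeps x at distance at least 1 / 2 from every integer, so the
  exponent L of the kernel never vanishes; ln y \<le> y - 1, applied to quotients, turns this
  distance into a gap of order 1 / x. The sign of L decides whether Perron's integral retains the
  term.\<close>

lemma abs_ln_half_integer_ge:
  assumes "0 < N"
  shows "1 / (4 * (real N + 1 / 2)) \<le> \<bar>ln (real N + 1 / 2) - ln (real (Suc n))\<bar>"
    and "0 < ln (real N + 1 / 2) - ln (real (Suc n)) \<longleftrightarrow> n < N"
proof -
  define x where "x = real N + 1 / 2"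
  have x: "1 < x" using assms by (simp add: x_def)
  have "(n < N \<longrightarrow> 1 / (4 * x) \<le> ln x - ln (real (Suc n))) \<and> (\<not> n < N \<longrightarrow> 1 / (4 * x) \<le> ln (real (Suc n)) - ln x)"
  proof (intro conjI impI)
    assume "n < N"
    then have n: "real (Suc n) \<le> x - 1 / 2" by (simp add: x_def)
    have "ln (real (Suc n) / x) \<le> real (Suc n) / x - 1" using x by (intro ln_le_minus_one) auto
    also have "\<dots> \<le> (x - 1 / 2) / x - 1" using n x by (intro diff_right_mono divide_right_mono) auto
    also have "\<dots> \<le> - (1 / (4 * x))" using x by (simp add: field_simps)
    finally show "1 / (4 * x) \<le> ln x - ln (real (Suc n))" using x by (simp add: ln_div del: of_nat_Suc)
  next
    assume "\<not> n < N"
    then have n: "x + 1 / 2 \<le> real (Suc n)" by (simp add: x_def)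
    have "ln (x / real (Suc n)) \<le> ln (x / (x + 1 / 2))"
      using x n by (intro ln_mono divide_left_mono) auto
    also have "\<dots> \<le> x / (x + 1 / 2) - 1" using x by (intro ln_le_minus_one) auto
    also have "\<dots> \<le> - (1 / (4 * x))" using x by (simp add: field_simps)
    finally show "1 / (4 * x) \<le> ln (real (Suc n)) - ln x" using x by (simp add: ln_div del: of_nat_Suc)
  qed
  moreover have "0 < 1 / (4 * x)" using x by simp
  ultimately show "1 / (4 * (real N + 1 / 2)) \<le> \<bar>ln (real N + 1 / 2) - ln (real (Suc n))\<bar>"
    "0 < ln (real N + 1 / 2) - ln (real (Suc n)) \<longleftrightarrow> n < N"
    unfolding x_def by linarith+
qed

text \<open>The abscissa \<open>5\<close> makes up for the coefficient bound \<open>(n + 1)\<^sup>3\<close>; the height \<open>x ^ 7\<close> outweighs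
  the factor \<open>x ^ 5\<close> from the kernel and \<open>4 * x\<close> from the logarithms.\<close>

lemma perron_partial_sum:
  assumes b: "dirichlet_coeffs b f" and "0 < Re s" "0 < N"
  defines "x \<equiv> real N + 1 / 2"
  shows "cmod (contour_integral (vertical 5 (x ^ 7)) (\<lambda>w. dirichlet_fun f (s + w) * exp (of_real (ln x) * w) / w)
      - 2 * pi * \<i> * (\<Sum>n<N. b n * dirichlet_term n s))
    \<le> 32 / x * (\<Sum>n. inverse (real (Suc n) ^ 2)) * norm f"
proof -
  define T where "T = x ^ 7"
  define d where "d n = b n * dirichlet_term n s" for n
  define L where "L n = ln x - ln (real (Suc n))" for n
  define I where "I n = contour_integral (vertical 5 T) (\<lambda>w. exp (of_real (L n) * w) / w)" for n
  define F where "F w = dirichlet_fun f (s + w) * exp (of_real (ln x) * w) / w" for w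
  have x: "3 / 2 \<le> x" using \<open>0 < N\<close> by (simp add: x_def)
  have "5 < (3 / 2 :: real) ^ 7" by (simp add: eval_nat_numeral)
  also have "\<dots> \<le> T" unfolding T_def using x by (intro power_mono) auto
  finally have T: "5 < T" .
  have L: "1 / (4 * x) \<le> \<bar>L n\<bar>" "0 < L n \<longleftrightarrow> n < N" for n
    using abs_ln_half_integer_ge[OF \<open>0 < N\<close>, of n] unfolding L_def x_def by auto
  have nd: "cmod (d n) * exp (L n * 5) \<le> norm f * x ^ 5 * inverse (real (Suc n) ^ 2)" for n
  proof -
    have "exp (L n) = x / real (Suc n)"
      using x by (simp add: L_def exp_diff del: of_nat_Suc)
    then have "exp (L n * 5) = x ^ 5 * inverse (real (Suc n) ^ 5)"
      using exp_of_nat2_mult[of "L n" 5] by (simp add: power_mult_distrib power_inverse divide_inverse del: of_nat_Suc)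
    moreover have "cmod (d n) \<le> (norm f * real (Suc n) ^ 3) * 1"
      unfolding d_def norm_mult using dirichlet_coeff_bound[OF b, of n] assms(2)
        powr_mono[of "- Re s" 0 "real (Suc n)"]
      by (intro mult_mono) (auto simp: norm_dirichlet_term)
    ultimately have "cmod (d n) * exp (L n * 5) \<le> norm f * real (Suc n) ^ 3 * (x ^ 5 * inverse (real (Suc n) ^ 5))"
      using x by (simp add: mult_right_mono)
    also have "\<dots> = norm f * x ^ 5 * inverse (real (Suc n) ^ 2)"
      by (simp add: field_simps eval_nat_numeral del: of_nat_Suc)
    finally show ?thesis .
  qed
  have nzpath: "0 \<notin> path_image (vertical 5 T)" using path_image_vertical[of T 0 5] T by auto
  have int: "(\<lambda>w. d n * (exp (of_real (L n) * w) / w)) contour_integrable_on vertical 5 T" for n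
    using nzpath unfolding vertical_def path_image_linepath
    by (intro contour_integrable_continuous_linepath) (auto intro!: continuous_intros)
  \<comment> \<open>Uniform convergence on the segment permits integrating the series of f (s + w)
    term by term.\<close>
  have "uniform_limit (path_image (vertical 5 T)) (\<lambda>M w. \<Sum>n<M. d n * (exp (of_real (L n) * w) / w))
      (\<lambda>w. \<Sum>n. d n * (exp (of_real (L n) * w) / w)) sequentially"
  proof (rule Weierstrass_m_test)
    fix n w assume "w \<in> path_image (vertical 5 T)"
    then have w: "Re w = 5" using path_image_vertical[of T w 5] T by auto
    then have "1 \<le> cmod w" using abs_Re_le_cmod[of w] by linarith
    then have "exp (L n * 5) / cmod w \<le> exp (L n * 5) / 1"
      by (intro divide_left_mono) auto
    then have "cmod (d n * (exp (of_real (L n) * w) / w)) \<le> cmod (d n) * exp (L n * 5)"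
      unfolding norm_mult norm_divide using w by (intro mult_left_mono) auto
    also note nd
    finally show "cmod (d n * (exp (of_real (L n) * w) / w)) \<le> norm f * x ^ 5 * inverse (real (Suc n) ^ 2)" .
  qed (intro summable_mult summable_inverse_Suc_square)
  moreover have "(\<Sum>n. d n * (exp (of_real (L n) * w) / w)) = F w" if "w \<in> path_image (vertical 5 T)" for w
  proof -
    have "Re w = 5" using path_image_vertical[OF _ that] T by auto
    then have "(\<lambda>n. b n * dirichlet_term n (s + w) * (exp (of_real (ln x) * w) / w)) sums
        (dirichlet_fun f (s + w) * (exp (of_real (ln x) * w) / w))"
      using b assms(2) by (intro sums_mult2) (auto simp: dirichlet_coeffs_def)
    moreover have "b n * dirichlet_term n (s + w) * (exp (of_real (ln x) * w) / w) =
        d n * (exp (of_real (L n) * w) / w)" for n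
    proof -
      have "dirichlet_term n w * exp (of_real (ln x) * w) = exp (of_real (L n) * w)"
        unfolding dirichlet_term_exp exp_add[symmetric] by (simp add: L_def algebra_simps)
      then show ?thesis by (simp add: d_def dirichlet_term_add)
    qed
    ultimately have "(\<lambda>n. d n * (exp (of_real (L n) * w) / w)) sums
        (dirichlet_fun f (s + w) * (exp (of_real (ln x) * w) / w))"
      by (simp only:)
    then show ?thesis by (simp add: F_def sums_iff)
  qed
  ultimately have ul: "uniform_limit (path_image (vertical 5 T))
      (\<lambda>M w. \<Sum>n<M. d n * (exp (of_real (L n) * w) / w)) F sequentially"
    by (simp cong: uniform_limit_cong')
  have "(\<lambda>M. contour_integral (vertical 5 T) (\<lambda>w. \<Sum>n<M. d n * (exp (of_real (L n) * w) / w)))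
      \<longlonglongrightarrow> contour_integral (vertical 5 T) F"
  proof (rule contour_integral_uniform_limit(2)[OF _ ul])
    show "cmod (vector_derivative (vertical 5 T) (at t)) \<le> 2 * T" for t
      using T by (simp add: vertical_def cmod_def real_sqrt_mult)
    show "\<forall>\<^sub>F M in sequentially. (\<lambda>w. \<Sum>n<M. d n * (exp (of_real (L n) * w) / w)) contour_integrable_on vertical 5 T"
      by (intro always_eventually allI contour_integrable_sum int) auto
  qed (auto simp: vertical_def)
  also have "(\<lambda>M. contour_integral (vertical 5 T) (\<lambda>w. \<Sum>n<M. d n * (exp (of_real (L n) * w) / w))) = (\<lambda>M. \<Sum>n<M. d n * I n)"
  proof
    fix M
    have "(\<lambda>w. exp (of_real (L n) * w) / w) contour_integrable_on vertical 5 T" for n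
      using nzpath unfolding vertical_def path_image_linepath
      by (intro contour_integrable_continuous_linepath) (auto intro!: continuous_intros)
    then show "contour_integral (vertical 5 T) (\<lambda>w. \<Sum>n<M. d n * (exp (of_real (L n) * w) / w)) = (\<Sum>n<M. d n * I n)"
      using int by (simp add: contour_integral_sum I_def contour_integral_lmul del: times_divide_eq_right)
  qed
  finally have lim: "(\<lambda>M. (\<Sum>n<M. d n * I n) - 2 * pi * \<i> * (\<Sum>n<N. d n)) \<longlonglongrightarrow>
      contour_integral (vertical 5 T) F - 2 * pi * \<i> * (\<Sum>n<N. d n)"
    by (intro tendsto_diff tendsto_const)
  have "cmod (contour_integral (vertical 5 T) F - 2 * pi * \<i> * (\<Sum>n<N. d n)) \<le>
      32 / x * (\<Sum>n. inverse (real (Suc n) ^ 2)) * norm f"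
  proof (rule tendsto_upperbound[OF tendsto_norm[OF lim]])
    have "cmod ((\<Sum>n<M. d n * I n) - 2 * pi * \<i> * (\<Sum>n<N. d n)) \<le>
      32 / x * (\<Sum>n. inverse (real (Suc n) ^ 2)) * norm f" if "N \<le> M" for M
    proof -
      have "(\<Sum>n<N. d n) = (\<Sum>n<M. d n * (if 0 < L n then 1 else 0))"
        using that by (intro sum.mono_neutral_cong_left) (auto simp: L)
      then have "(\<Sum>n<M. d n * I n) - 2 * pi * \<i> * (\<Sum>n<N. d n) =
          (\<Sum>n<M. d n * (I n - (if 0 < L n then 2 * pi * \<i> else 0)))"
        by (simp add: sum_distrib_left sum_subtractf[symmetric] algebra_simps if_distrib cong: if_cong)
      also have "cmod \<dots> \<le> (\<Sum>n<M. 32 / x * norm f * inverse (real (Suc n) ^ 2))"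
      proof (rule sum_norm_le)
        fix n
        have L0: "0 < \<bar>L n\<bar>" using L(1)[of n] x by (intro less_le_trans[OF _ L(1)]) auto
        have "cmod (d n * (I n - (if 0 < L n then 2 * pi * \<i> else 0))) \<le>
            cmod (d n) * (8 * exp (L n * 5) / (T * \<bar>L n\<bar>))"
          unfolding norm_mult I_def using L0 T by (intro mult_left_mono perron_kernel) auto
        also have "\<dots> = (cmod (d n) * exp (L n * 5)) * (8 / T) * (1 / \<bar>L n\<bar>)" by simp
        also have "\<dots> \<le> (norm f * x ^ 5 * inverse (real (Suc n) ^ 2)) * (8 / T) * (4 * x)"
        proof (rule mult_mono[OF mult_right_mono[OF nd]])
          show "1 / \<bar>L n\<bar> \<le> 4 * x" using L(1)[of n] L0 x by (simp add: field_simps)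
        qed (use T x in auto)
        \<comment> \<open>8 comes from the kernel and 4 from the logarithms; the powers combine to
          x^5 * x / x^7 = 1 / x.\<close>
        also have "\<dots> = 32 / x * norm f * inverse (real (Suc n) ^ 2)"
          using x by (simp add: T_def field_simps eval_nat_numeral del: of_nat_Suc)
        finally show "cmod (d n * (I n - (if 0 < L n then 2 * pi * \<i> else 0))) \<le>
            32 / x * norm f * inverse (real (Suc n) ^ 2)" .
      qed
      also have "\<dots> = 32 / x * norm f * (\<Sum>n<M. inverse (real (Suc n) ^ 2))"
        by (simp add: sum_distrib_left)
      also have "\<dots> \<le> 32 / x * norm f * (\<Sum>n. inverse (real (Suc n) ^ 2))"
        using x by (intro mult_left_mono sum_le_suminf summable_inverse_Suc_square) auto
      finally show ?thesis by (simp add: mult_ac)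
    qed
    then show "\<forall>\<^sub>F M in sequentially. cmod ((\<Sum>n<M. d n * I n) - 2 * pi * \<i> * (\<Sum>n<N. d n)) \<le>
      32 / x * (\<Sum>n. inverse (real (Suc n) ^ 2)) * norm f"
      by (intro eventually_sequentiallyI)
  qed simp
  then show ?thesis by (simp add: F_def[abs_def] T_def d_def)
qed

text \<open>Cauchy's formula at the pole w = 0, on the rectangle from abscissa - \<epsilon> / 2 to
  5, where s + w remains in the right half-plane because Re s \<ge> \<epsilon>. The three summands
  of the bound come from the right side (Perron's sum), the horizontal sides (x^5 / x^7 times their
  length) and the left side (x powr (- \<epsilon> / 2) times the integral of 1 / |w|).\<close>

lemma dirichlet_truncation_bound:
  assumes b: "dirichlet_coeffs b f" and "0 < \<epsilon>" "\<epsilon> \<le> Re s" "0 < N"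
  defines "x \<equiv> real N + 1 / 2"
  shows "cmod (dirichlet_fun f s - (\<Sum>n<N. b n * dirichlet_term n s)) \<le>
    (32 / x * (\<Sum>n. inverse (real (Suc n) ^ 2)) + 2 * (5 + \<epsilon>) / x ^ 2
      + 2 * x powr (- \<epsilon> / 2) * arsinh (x ^ 7 / (\<epsilon> / 2))) * norm f"
proof -
  define T where "T = x ^ 7"
  define \<delta> where "\<delta> = \<epsilon> / 2"
  define G where "G w = dirichlet_fun f (s + w) * exp (of_real (ln x) * w)" for w
  define F where "F w = G w / w" for w
  define a where "a = Complex (- \<delta>) (- T)"
  define d where "d = Complex 5 T"
  let ?R = "rectpath a d"
  have \<delta>: "0 < \<delta>" "\<delta> < \<epsilon>" using assms(2) by (auto simp: \<delta>_def)
  have x: "1 < x" using \<open>0 < N\<close> by (simp add: x_def)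
  then have T: "0 < T" by (simp add: T_def)
  have box: "0 \<in> box a d" using \<delta> T by (auto simp: in_box_complex_iff a_def d_def)
  have nz: "0 \<notin> path_image ?R"
    using path_image_rectpath_inter_box[of a d] box \<delta> T by (auto simp: a_def d_def)
  have sub: "path_image ?R \<subseteq> half_plane (- \<epsilon>)"
    using path_image_rectpath_subset_cbox[of a d] \<delta> T by (force simp: a_def d_def in_cbox_complex_iff)
  have hol: "G holomorphic_on half_plane (- \<epsilon>)"
  proof -
    have "(dirichlet_fun f \<circ> (\<lambda>w. s + w)) holomorphic_on half_plane (- \<epsilon>)"
      by (rule holomorphic_on_compose_gen[OF _ holomorphic_dirichlet_fun])
        (use assms(3) in \<open>auto intro!: holomorphic_intros\<close>)
    then show ?thesis unfolding G_def by (intro holomorphic_intros) (simp add: o_def)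
  qed
  have cont: "continuous_on S F" if "S \<subseteq> path_image ?R" for S
    unfolding F_def using that nz sub
    by (intro continuous_intros continuous_on_subset[OF holomorphic_on_imp_continuous_on[OF hol]]) auto
  have "((\<lambda>w. G w / (w - 0)) has_contour_integral (2 * pi * \<i> * winding_number ?R 0 * G 0)) ?R"
    using nz sub \<open>0 < \<epsilon>\<close>
    by (intro Cauchy_integral_formula_convex_simple[OF convex_half_plane hol])
      (auto simp: interior_open open_half_plane)
  then have "contour_integral ?R F = 2 * pi * \<i> * dirichlet_fun f s"
    using winding_number_rectpath[OF box]
    by (simp add: F_def[abs_def] G_def contour_integral_unique)
  moreover have pieces: "closed_segment a (Complex 5 (- T)) \<subseteq> path_image ?R"
    "closed_segment d (Complex (- \<delta>) T) \<subseteq> path_image ?R"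
    "closed_segment (Complex (- \<delta>) T) a \<subseteq> path_image ?R"
    by (auto simp: rectpath_def Let_def path_image_join a_def d_def)
  have "contour_integral ?R F = contour_integral (linepath a (Complex 5 (- T))) F +
    contour_integral (vertical 5 T) F +
    contour_integral (linepath d (Complex (- \<delta>) T)) F -
    contour_integral (vertical (- \<delta>) T) F"
    using contour_integral_rectpath[OF cont[OF order_refl]]
      contour_integral_reverse_linepath[OF cont[OF pieces(3)]]
    by (simp add: a_def d_def vertical_def)
  ultimately have eq: "2 * pi * \<i> * dirichlet_fun f s - 2 * pi * \<i> * (\<Sum>n<N. b n * dirichlet_term n s) =
    (contour_integral (vertical 5 T) F - 2 * pi * \<i> * (\<Sum>n<N. b n * dirichlet_term n s)) +
    (contour_integral (linepath a (Complex 5 (- T))) F +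
    contour_integral (linepath d (Complex (- \<delta>) T)) F) -
    contour_integral (vertical (- \<delta>) T) F" by (simp add: algebra_simps)
  have nF: "cmod (F w) \<le> norm f * x powr Re w / cmod w" for w
    unfolding F_def G_def norm_mult norm_divide using x
    by (intro divide_right_mono mult_mono norm_dirichlet_fun_le) (auto simp: powr_def mult.commute)
  have bound: "cmod (F w) \<le> norm f * x ^ 5 / T" if "Re w \<le> 5" "\<bar>Im w\<bar> = T" for w
  proof (rule order_trans[OF nF frac_le])
    show "T \<le> cmod w" using that abs_Im_le_cmod[of w] by simp
    have "x powr Re w \<le> x powr 5" using that x by (intro powr_mono) auto
    then show "norm f * x powr Re w \<le> norm f * x ^ 5" using x by (intro mult_left_mono) (auto simp: powr_numeral)
  qed (use T x in auto)
  have h1: "cmod (contour_integral (linepath a (Complex 5 (- T))) F) \<le> norm f * x ^ 5 / T * (5 + \<epsilon>)"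
  proof (rule norm_contour_integral_linepath_le[OF cont[OF pieces(1)]])
    show "cmod (F z) \<le> norm f * x ^ 5 / T" if "z \<in> closed_segment a (Complex 5 (- T))" for z
      using closed_segment_horizontal[OF that[unfolded a_def]] \<delta> T
      by (intro bound) (auto simp: closed_segment_eq_real_ivl)
  qed (use \<delta> in \<open>auto simp: a_def cmod_def\<close>)
  have h2: "cmod (contour_integral (linepath d (Complex (- \<delta>) T)) F) \<le> norm f * x ^ 5 / T * (5 + \<epsilon>)"
  proof (rule norm_contour_integral_linepath_le[OF cont[OF pieces(2)]])
    show "cmod (F z) \<le> norm f * x ^ 5 / T" if "z \<in> closed_segment d (Complex (- \<delta>) T)" for z
      using closed_segment_horizontal[OF that[unfolded d_def]] \<delta> T
      by (intro bound) (auto simp: closed_segment_eq_real_ivl)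
  qed (use \<delta> in \<open>auto simp: d_def cmod_def\<close>)
  have h3: "cmod (contour_integral (vertical (- \<delta>) T) F) \<le> 2 * (norm f * x powr - \<delta>) * arsinh (T / \<delta>)"
  proof (rule norm_contour_integral_vertical_le[OF \<delta>(1) T])
    show "continuous_on (path_image (vertical (- \<delta>) T)) F"
      using cont[OF pieces(3)] by (simp add: vertical_def a_def closed_segment_commute)
    show "cmod (F w) \<le> norm f * x powr - \<delta> / cmod w" if "Re w = - \<delta>" for w
      using nF[of w] that by simp
  qed simp
  have h0: "cmod (contour_integral (vertical 5 T) F - 2 * pi * \<i> * (\<Sum>n<N. b n * dirichlet_term n s))
    \<le> 32 / x * (\<Sum>n. inverse (real (Suc n) ^ 2)) * norm f"
    using perron_partial_sum[OF b _ \<open>0 < N\<close>, of s] assms(2,3)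
    by (simp add: x_def[symmetric] T_def F_def[abs_def] G_def)
  \<comment> \<open>The factor 2 \<pi> that Cauchy's formula would gain is given away.\<close>
  have "1 * cmod (dirichlet_fun f s - (\<Sum>n<N. b n * dirichlet_term n s)) \<le>
      cmod (2 * pi * \<i>) * cmod (dirichlet_fun f s - (\<Sum>n<N. b n * dirichlet_term n s))"
    using pi_gt3 by (intro mult_right_mono) (auto simp: norm_mult)
  also have "\<dots> = cmod (2 * pi * \<i> * dirichlet_fun f s - 2 * pi * \<i> * (\<Sum>n<N. b n * dirichlet_term n s))"
    unfolding norm_mult[symmetric] by (simp add: right_diff_distrib)
  also have "\<dots> \<le> (32 / x * (\<Sum>n. inverse (real (Suc n) ^ 2)) * norm f +
      (norm f * x ^ 5 / T * (5 + \<epsilon>) + norm f * x ^ 5 / T * (5 + \<epsilon>))) +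
      2 * (norm f * x powr - \<delta>) * arsinh (T / \<delta>)"
    unfolding eq by (intro order_trans[OF norm_triangle_ineq4] add_mono norm_triangle_mono h0 h1 h2 h3)
  also have "norm f * x ^ 5 / T = norm f / x ^ 2"
    using x by (simp add: T_def field_simps eval_nat_numeral)
  finally show ?thesis by (simp add: T_def \<delta>_def algebra_simps)
qed

text \<open>\<open>r\<close> depends on \<epsilon> alone and serves all series and all s at once. It
  tends to 0 because arsinh of a power of x grows only logarithmically.\<close>

lemma dirichlet_truncation:
  assumes "0 < \<epsilon>"
  obtains r :: "nat \<Rightarrow> real" where "r \<longlonglongrightarrow> 0"
    "\<And>b f s N. dirichlet_coeffs b f \<Longrightarrow> \<epsilon> \<le> Re s \<Longrightarrow> 0 < N \<Longrightarrow>
      cmod (dirichlet_fun f s - (\<Sum>n<N. b n * dirichlet_term n s)) \<le> r N * norm f"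
proof
  define Z where "Z = (\<Sum>n. inverse (real (Suc n) ^ 2))"
  define r where "r N = 32 / (real N + 1 / 2) * Z + 2 * (5 + \<epsilon>) / (real N + 1 / 2) ^ 2
      + 2 * (real N + 1 / 2) powr (- \<epsilon> / 2) * arsinh ((real N + 1 / 2) ^ 7 / (\<epsilon> / 2))" for N
  show "r \<longlonglongrightarrow> 0"
  proof -
    have "(\<lambda>N. 32 / (real N + 1 / 2)) \<longlonglongrightarrow> 0" "(\<lambda>N. 2 / (real N + 1 / 2) ^ 2) \<longlonglongrightarrow> 0"
      by real_asymp+
    moreover have "(\<lambda>N. 2 * (real N + 1 / 2) powr (- \<epsilon> / 2) * arsinh ((real N + 1 / 2) ^ 7 / (\<epsilon> / 2))) \<longlonglongrightarrow> 0"
      unfolding arsinh_real_def using assms by real_asymp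
    ultimately have "(\<lambda>N. 32 / (real N + 1 / 2) * Z + 2 / (real N + 1 / 2) ^ 2 * (5 + \<epsilon>)
      + 2 * (real N + 1 / 2) powr (- \<epsilon> / 2) * arsinh ((real N + 1 / 2) ^ 7 / (\<epsilon> / 2))) \<longlonglongrightarrow> 0"
      by (intro tendsto_add_zero tendsto_mult_left_zero)
    then show ?thesis by (simp add: r_def[abs_def] mult.commute)
  qed
  show "cmod (dirichlet_fun f s - (\<Sum>n<N. b n * dirichlet_term n s)) \<le> r N * norm f"
    if "dirichlet_coeffs b f" "\<epsilon> \<le> Re s" "0 < N" for b f s N
    using dirichlet_truncation_bound[OF that(1) assms that(2,3)] by (simp add: r_def Z_def)
qed

section \<open>Completeness and normal families\<close>

text \<open>The uniform limit inherits uniform continuity. That it is again a Dirichlet series is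
  the point: the coefficients converge by \<open>dirichlet_coeff_bound\<close>, and the truncation
  estimate, being uniform over the sequence, passes to the limit.\<close>

lemma dirichlet_Cauchy_convergent:
  fixes f :: "nat \<Rightarrow> dirichlet_algebra"
  assumes "Cauchy f"
  shows "convergent f"
proof -
  have diff: "cmod (dirichlet_fun (f i) s - dirichlet_fun (f j) s) \<le> norm (f i - f j)" for i j s
    using norm_dirichlet_fun_le[of "f i - f j" s] by (simp add: dirichlet_fun_simps)
  have "Cauchy (\<lambda>j. dirichlet_fun (f j) s)" for s
    by (rule bounded_linear.Cauchy[OF bounded_linear_eval assms])
  then have "\<exists>l. (\<lambda>j. dirichlet_fun (f j) s) \<longlonglongrightarrow> l" for s
    by (simp add: Cauchy_convergent_iff convergent_def)
  then obtain h where h: "\<And>s. (\<lambda>j. dirichlet_fun (f j) s) \<longlonglongrightarrow> h s" by metis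
  have close: "\<exists>J. \<forall>j\<ge>J. \<forall>s. cmod (dirichlet_fun (f j) s - h s) \<le> e" if "0 < e" for e
  proof -
    obtain J where J: "\<And>i j. i \<ge> J \<Longrightarrow> j \<ge> J \<Longrightarrow> norm (f i - f j) < e"
      using CauchyD[OF assms \<open>0 < e\<close>] by blast
    have "cmod (dirichlet_fun (f i) s - h s) \<le> e" if "i \<ge> J" for i s
    proof (rule tendsto_upperbound[OF tendsto_norm[OF tendsto_diff[OF tendsto_const h]]])
      show "\<forall>\<^sub>F j in sequentially. cmod (dirichlet_fun (f i) s - dirichlet_fun (f j) s) \<le> e"
        using J[OF that] diff by (intro eventually_sequentiallyI[of J]) (meson order_trans less_imp_le)
    qed simp
    then show ?thesis by blast
  qed
  have "\<forall>j. \<exists>b. dirichlet_coeffs b (f j)" using dirichlet_coeffs_ex by metis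
  then obtain b where b: "\<And>j. dirichlet_coeffs (b j) (f j)" by metis
  have "Cauchy (\<lambda>j. b j n)" for n
  proof (rule CauchyI)
    fix e :: real assume "0 < e"
    then obtain J where J: "\<And>i j. i \<ge> J \<Longrightarrow> j \<ge> J \<Longrightarrow> norm (f i - f j) < e / real (Suc n) ^ 3"
      using CauchyD[OF assms, of "e / real (Suc n) ^ 3"] by (auto simp del: of_nat_Suc)
    have "cmod (b i n - b j n) < e" if "i \<ge> J" "j \<ge> J" for i j
      using dirichlet_coeff_bound[OF dirichlet_coeffs_diff[OF b[of i] b[of j]], of n] J[OF that]
      by (simp add: field_simps del: of_nat_Suc)
    then show "\<exists>M. \<forall>i\<ge>M. \<forall>j\<ge>M. norm (b i n - b j n) < e" by blast
  qed
  then have "\<exists>l. (\<lambda>j. b j n) \<longlonglongrightarrow> l" for n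
    by (simp add: Cauchy_convergent_iff convergent_def)
  then obtain a where a: "\<And>n. (\<lambda>j. b j n) \<longlonglongrightarrow> a n" by metis
  obtain M where M: "0 < M" "\<And>j. norm (f j) \<le> M"
    using Cauchy_Bseq[OF assms] by (auto simp: Bseq_def)
  have "h \<in> dirichlet_functions"
  proof (rule dirichlet_functionsI)
    show "h s = 0" if "Re s \<le> 0" for s
    proof -
      have "dirichlet_fun (f j) s = 0" for j
        using dirichlet_fun[of "f j"] that by (auto simp: dirichlet_functions_def)
      then show ?thesis using h[of s] by (simp add: LIMSEQ_const_iff)
    qed
    show "uniformly_continuous_on (half_plane 0) h"
      unfolding uniformly_continuous_on_def
    proof (intro allI impI)
      fix e :: real assume "0 < e"
      then obtain j where j: "\<And>s. cmod (dirichlet_fun (f j) s - h s) \<le> e / 4"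
        using close[of "e / 4"] by auto
      have "uniformly_continuous_on (half_plane 0) (dirichlet_fun (f j))"
        using dirichlet_fun[of "f j"] by (auto simp: dirichlet_functions_def)
      then obtain d where "d > 0" and d: "\<And>s t. s \<in> half_plane 0 \<Longrightarrow> t \<in> half_plane 0 \<Longrightarrow> dist t s < d \<Longrightarrow>
          dist (dirichlet_fun (f j) t) (dirichlet_fun (f j) s) < e / 2"
        unfolding uniformly_continuous_on_def using \<open>0 < e\<close> by (meson half_gt_zero)
      have "dist (h t) (h s) < e" if "s \<in> half_plane 0" "t \<in> half_plane 0" "dist t s < d" for s t
      proof -
        have "h t - h s = (dirichlet_fun (f j) t - dirichlet_fun (f j) s)
            - ((dirichlet_fun (f j) t - h t) - (dirichlet_fun (f j) s - h s))" by simp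
        also have "cmod \<dots> \<le> cmod (dirichlet_fun (f j) t - dirichlet_fun (f j) s)
            + (cmod (dirichlet_fun (f j) t - h t) + cmod (dirichlet_fun (f j) s - h s))"
          by (rule order_trans[OF norm_triangle_ineq4 add_left_mono[OF norm_triangle_ineq4]])
        also have "\<dots> < e"
          using d[OF that] j[of t] j[of s] unfolding dist_norm by linarith
        finally show ?thesis by (simp add: dist_norm)
      qed
      then show "\<exists>d>0. \<forall>s\<in>half_plane 0. \<forall>t\<in>half_plane 0. dist t s < d \<longrightarrow> dist (h t) (h s) < e"
        using \<open>d > 0\<close> by blast
    qed
    show "(\<lambda>n. a n * dirichlet_term n s) sums h s" if s: "0 < Re s" for s
    proof -
      obtain r where r: "r \<longlonglongrightarrow> 0" "\<And>b f N. dirichlet_coeffs b f \<Longrightarrow> 0 < N \<Longrightarrow>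
          cmod (dirichlet_fun f s - (\<Sum>n<N. b n * dirichlet_term n s)) \<le> r N * norm f"
        using dirichlet_truncation[OF s] by (metis order_refl)
      \<comment> \<open>The absolute value is taken because \<open>r\<close> comes without a
        sign.\<close>
      have "cmod (h s - (\<Sum>n<N. a n * dirichlet_term n s)) \<le> \<bar>r N\<bar> * M" if "0 < N" for N
      proof (rule tendsto_upperbound)
        show "(\<lambda>j. cmod (dirichlet_fun (f j) s - (\<Sum>n<N. b j n * dirichlet_term n s))) \<longlonglongrightarrow>
            cmod (h s - (\<Sum>n<N. a n * dirichlet_term n s))"
          by (intro tendsto_intros h a)
        have "r N * norm (f j) \<le> \<bar>r N\<bar> * M" for j
          using M by (intro mult_mono) auto
        then show "\<forall>\<^sub>F j in sequentially.
            cmod (dirichlet_fun (f j) s - (\<Sum>n<N. b j n * dirichlet_term n s)) \<le> \<bar>r N\<bar> * M"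
          using r(2)[OF b that] by (intro always_eventually allI) (meson order_trans)
      qed simp
      then have "\<forall>\<^sub>F N in sequentially. cmod (h s - (\<Sum>n<N. a n * dirichlet_term n s)) \<le> \<bar>r N\<bar> * M"
        by (intro eventually_sequentiallyI[of 1]) auto
      moreover have "(\<lambda>N. \<bar>r N\<bar> * M) \<longlonglongrightarrow> 0"
        using r(1) by (intro tendsto_mult_left_zero tendsto_rabs_zero)
      ultimately have "(\<lambda>N. h s - (\<Sum>n<N. a n * dirichlet_term n s)) \<longlonglongrightarrow> 0"
        by (rule Lim_null_comparison)
      from tendsto_diff[OF tendsto_const[of "h s"] this] show ?thesis by (simp add: sums_def)
    qed
  qed
  then have H: "dirichlet_fun (Abs_dirichlet h) = h" by (rule Abs_dirichlet_inverse)
  have "f \<longlonglongrightarrow> Abs_dirichlet h"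
  proof (rule LIMSEQ_I)
    fix e :: real assume "0 < e"
    then obtain J where "\<And>j s. j \<ge> J \<Longrightarrow> cmod (dirichlet_fun (f j) s - h s) \<le> e / 2"
      using close[of "e / 2"] by auto
    then have le: "norm (f j - Abs_dirichlet h) \<le> e / 2" if "j \<ge> J" for j
      using that by (intro norm_dirichlet_leI) (simp add: dirichlet_fun_simps H)
    have "norm (f j - Abs_dirichlet h) < e" if "j \<ge> J" for j
      using le[OF that] \<open>0 < e\<close> by linarith
    then show "\<exists>J. \<forall>j\<ge>J. norm (f j - Abs_dirichlet h) < e"
      by blast
  qed
  then show ?thesis by (auto simp: convergent_def)
qed

instance dirichlet_algebra :: banach
  by standard (rule dirichlet_Cauchy_convergent)

text \<open>Along a subsequence every single coefficient converges, which settles the first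
  \<open>N\<close> terms; the remainders of differences are at most
  \<open>\<bar>r N\<bar> * (2 * M)\<close>. The conclusion is a Cauchy condition because the limit
  on Re s \<ge> \<epsilon> need not come from an element of the algebra.\<close>

lemma dirichlet_Montel:
  fixes f :: "nat \<Rightarrow> dirichlet_algebra"
  assumes "\<And>j. norm (f j) \<le> M" "0 < \<epsilon>"
  obtains k :: "nat \<Rightarrow> nat" where "strict_mono k"
    "\<forall>e>0. \<exists>J. \<forall>i\<ge>J. \<forall>j\<ge>J. \<forall>s. \<epsilon> \<le> Re s \<longrightarrow>
      cmod (dirichlet_fun (f (k i)) s - dirichlet_fun (f (k j)) s) \<le> e"
proof -
  have "\<forall>j. \<exists>b. dirichlet_coeffs b (f j)" using dirichlet_coeffs_ex by metis
  then obtain b where b: "\<And>j. dirichlet_coeffs (b j) (f j)" by metis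
  \<comment> \<open>Dividing by (n + 1)^3 gives the bound common to all indices that
    \<open>function_convergent_subsequence\<close> asks for.\<close>
  have "cmod (b j n / of_nat (Suc n) ^ 3) \<le> M" for j n
  proof -
    have "cmod (b j n) \<le> M * real (Suc n) ^ 3"
      using assms(1) by (intro order_trans[OF dirichlet_coeff_bound[OF b]] mult_right_mono) auto
    then show ?thesis by (simp add: norm_divide norm_power divide_le_eq del: of_nat_Suc)
  qed
  note bound = this
  have "\<exists>k :: nat \<Rightarrow> nat. strict_mono k \<and> (\<forall>n. \<exists>l. (\<lambda>j. b (k j) n / of_nat (Suc n) ^ 3) \<longlonglongrightarrow> l)"
    by (rule function_convergent_subsequence[of UNIV "\<lambda>j n. b j n / of_nat (Suc n) ^ 3" M, OF _ bound])
      blast+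
  then obtain k :: "nat \<Rightarrow> nat" where k: "strict_mono k"
      "\<And>n. \<exists>l. (\<lambda>j. b (k j) n / of_nat (Suc n) ^ 3) \<longlonglongrightarrow> l" by blast
  have "\<exists>l. (\<lambda>j. b (k j) n) \<longlonglongrightarrow> l" for n
  proof -
    obtain l where "(\<lambda>j. b (k j) n / of_nat (Suc n) ^ 3) \<longlonglongrightarrow> l" using k(2) by blast
    from tendsto_mult_right[OF this, of "of_nat (Suc n) ^ 3"]
    show ?thesis by (auto simp del: of_nat_Suc)
  qed
  then obtain c where c: "\<And>n. (\<lambda>j. b (k j) n) \<longlonglongrightarrow> c n" by metis
  obtain r where r: "r \<longlonglongrightarrow> 0" "\<And>b f s N. dirichlet_coeffs b f \<Longrightarrow> \<epsilon> \<le> Re s \<Longrightarrow> 0 < N \<Longrightarrow>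
      cmod (dirichlet_fun f s - (\<Sum>n<N. b n * dirichlet_term n s)) \<le> r N * norm f"
    using dirichlet_truncation[OF assms(2)] by metis
  have M: "0 \<le> M" using assms(1)[of 0] norm_ge_zero order_trans by blast
  have "\<exists>J. \<forall>i\<ge>J. \<forall>j\<ge>J. \<forall>s. \<epsilon> \<le> Re s \<longrightarrow>
      cmod (dirichlet_fun (f (k i)) s - dirichlet_fun (f (k j)) s) \<le> e" if "0 < e" for e
  proof -
    have "(\<lambda>N. \<bar>r N\<bar> * (2 * M)) \<longlonglongrightarrow> 0"
      using r(1) by (intro tendsto_mult_left_zero tendsto_rabs_zero)
    then have "\<forall>\<^sub>F N in sequentially. \<bar>r N\<bar> * (2 * M) < e / 2"
      using \<open>0 < e\<close> by (intro order_tendstoD(2)) auto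
    then obtain N where N: "0 < N" "\<bar>r N\<bar> * (2 * M) < e / 2"
      using eventually_happens[OF eventually_conj[OF _ eventually_gt_at_top[of 0]]] by auto
    define D where "D j = (\<Sum>n<N. cmod (b (k j) n - c n))" for j
    have "D \<longlonglongrightarrow> (\<Sum>n<N. cmod (c n - c n))"
      unfolding D_def by (intro tendsto_intros c)
    then have "\<forall>\<^sub>F j in sequentially. D j < e / 4"
      using \<open>0 < e\<close> by (intro order_tendstoD(2)) auto
    then obtain J where J: "\<And>j. j \<ge> J \<Longrightarrow> D j < e / 4" by (auto simp: eventually_sequentially)
    have "cmod (dirichlet_fun (f (k i)) s - dirichlet_fun (f (k j)) s) \<le> e"
      if "i \<ge> J" "j \<ge> J" "\<epsilon> \<le> Re s" for i j s
    proof -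
      let ?g = "f (k i) - f (k j)" and ?b = "\<lambda>n. b (k i) n - b (k j) n"
      have g: "dirichlet_coeffs ?b ?g" by (intro dirichlet_coeffs_diff b)
      have "norm ?g \<le> 2 * M"
        using assms(1)[of "k i"] assms(1)[of "k j"] norm_triangle_ineq4[of "f (k i)" "f (k j)"] by linarith
      then have "r N * norm ?g \<le> \<bar>r N\<bar> * (2 * M)" using M by (intro mult_mono) auto
      then have 1: "cmod (dirichlet_fun ?g s - (\<Sum>n<N. ?b n * dirichlet_term n s)) \<le> e / 2"
        using r(2)[OF g that(3) N(1)] N(2) by linarith
      have "cmod (\<Sum>n<N. ?b n * dirichlet_term n s) \<le> (\<Sum>n<N. cmod (b (k i) n - c n) + cmod (b (k j) n - c n))"
      proof (rule sum_norm_le)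
        fix n
        have "cmod (dirichlet_term n s) \<le> 1"
          using powr_mono[of "- Re s" 0 "real (Suc n)"] that(3) assms(2) by (simp add: norm_dirichlet_term)
        then have "cmod (?b n * dirichlet_term n s) \<le> cmod (?b n) * 1"
          unfolding norm_mult by (intro mult_left_mono) auto
        also have "?b n = (b (k i) n - c n) - (b (k j) n - c n)" by simp
        also note norm_triangle_ineq4[of "b (k i) n - c n" "b (k j) n - c n"]
        finally show "cmod (?b n * dirichlet_term n s) \<le> cmod (b (k i) n - c n) + cmod (b (k j) n - c n)"
          by simp
      qed
      also have "\<dots> = D i + D j" by (simp add: D_def sum.distrib)
      finally have "cmod (\<Sum>n<N. ?b n * dirichlet_term n s) \<le> e / 2" using J[OF that(1)] J[OF that(2)] by linarith
      with 1 have "cmod (dirichlet_fun ?g s) \<le> e"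
        using norm_triangle_sub[of "dirichlet_fun ?g s" "\<Sum>n<N. ?b n * dirichlet_term n s"] by linarith
      then show ?thesis by (simp add: dirichlet_fun_simps)
    qed
    then show ?thesis by blast
  qed
  with k(1) show ?thesis by (intro that[of k]) auto
qed

text \<open>Points of the closure are replaced by points of \<open>S\<close> at distance less than 1
  / (n + 1), which does not affect limits of subsequences.\<close>

lemma compact_closureI_sequentially:
  fixes S :: "'a::metric_space set"
  assumes "\<And>x. (\<And>n. x n \<in> S) \<Longrightarrow> \<exists>(k::nat \<Rightarrow> nat) l. strict_mono k \<and> (\<lambda>n. x (k n)) \<longlonglongrightarrow> l"
  shows "compact (closure S)"
  unfolding compact_eq_seq_compact_metric seq_compact_def
proof (intro allI impI)
  fix y :: "nat \<Rightarrow> 'a" assume y: "\<forall>n. y n \<in> closure S"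
  have "\<exists>z\<in>S. dist z (y n) < inverse (real (Suc n))" for n
    using y by (intro closure_approachable[THEN iffD1, rule_format]) auto
  then obtain x where x: "\<And>n. x n \<in> S" "\<And>n. dist (x n) (y n) < inverse (real (Suc n))" by metis
  then obtain k :: "nat \<Rightarrow> nat" and l where k: "strict_mono k" "(\<lambda>n. x (k n)) \<longlonglongrightarrow> l"
    using assms by blast
  have "(\<lambda>n. dist (x n) (y n)) \<longlonglongrightarrow> 0"
  proof (rule tendsto_sandwich[OF _ _ tendsto_const LIMSEQ_inverse_real_of_nat])
    show "\<forall>\<^sub>F n in sequentially. dist (x n) (y n) \<le> inverse (real (Suc n))"
      using x(2) by (intro always_eventually allI less_imp_le)
  qed simp
  then have "(\<lambda>n. dist (x (k n)) (y (k n))) \<longlonglongrightarrow> 0"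
    using LIMSEQ_subseq_LIMSEQ[OF _ k(1)] by (fastforce simp: o_def)
  moreover have "(\<lambda>n. dist (x (k n)) l) \<longlonglongrightarrow> 0" using k(2) by (rule tendsto_dist_iff[THEN iffD1])
  ultimately have "(\<lambda>n. dist (x (k n)) (y (k n)) + dist (x (k n)) l) \<longlonglongrightarrow> 0" by (rule tendsto_add_zero)
  then have "(\<lambda>n. dist (y (k n)) l) \<longlonglongrightarrow> 0"
    by (rule Lim_null_comparison[rotated]) (simp add: dist_triangle3)
  then have "(\<lambda>n. y (k n)) \<longlonglongrightarrow> l" by (rule tendsto_dist_iff[THEN iffD2])
  moreover have "l \<in> closure S"
    using x(1) k(2) unfolding closure_sequential by (intro exI[of _ "\<lambda>n. x (k n)"]) auto
  ultimately show "\<exists>l\<in>closure S. \<exists>r. strict_mono r \<and> (y \<circ> r) \<longlonglongrightarrow> l"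
    using k(1) by (auto simp: o_def)
qed

section \<open>Compactness for symbols with values in a smaller half-plane\<close>

locale bounded_composition =
  fixes \<Phi> :: "complex \<Rightarrow> complex"
  assumes self_map: "\<Phi> ` half_plane 0 \<subseteq> half_plane 0"
    and preserves: "\<And>f. f \<in> dirichlet_functions \<Longrightarrow> comp_fun \<Phi> f \<in> dirichlet_functions"
    and bounded: "bounded_clinear (composition_operator \<Phi>)"
begin

lemma composition_eval:
  "0 < Re s \<Longrightarrow> dirichlet_fun (composition_operator \<Phi> f) s = dirichlet_fun f (\<Phi> s)"
  unfolding composition_operator_def
  by (subst Abs_dirichlet_inverse[OF preserves[OF dirichlet_fun]]) (simp add: comp_fun_def)

text \<open>The image of f takes only values of f on the range of \<Phi>, so the Cauchy condition of
  \<open>dirichlet_Montel\<close> becomes one in norm, and completeness provides the limit.\<close>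

lemma compact_if_image_in_smaller_half_plane:
  assumes "0 < \<epsilon>" "\<Phi> ` half_plane 0 \<subseteq> half_plane \<epsilon>"
  shows "compact_operator (composition_operator \<Phi>)"
  unfolding compact_operator_def
proof (intro conjI bounded compact_closureI_sequentially)
  fix y :: "nat \<Rightarrow> dirichlet_algebra"
  assume "\<And>n. y n \<in> composition_operator \<Phi> ` cball 0 1"
  then have "\<forall>n. \<exists>f. norm f \<le> 1 \<and> y n = composition_operator \<Phi> f" by fastforce
  then obtain f where f: "\<And>n. norm (f n) \<le> 1" "\<And>n. y n = composition_operator \<Phi> (f n)" by metis
  obtain k :: "nat \<Rightarrow> nat" where k: "strict_mono k"
    "\<forall>e>0. \<exists>J. \<forall>i\<ge>J. \<forall>j\<ge>J. \<forall>s. \<epsilon> \<le> Re s \<longrightarrow>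
      cmod (dirichlet_fun (f (k i)) s - dirichlet_fun (f (k j)) s) \<le> e"
    by (rule dirichlet_Montel[of f 1 \<epsilon>, OF f(1) assms(1)])
  have "Cauchy (\<lambda>n. y (k n))"
  proof (rule CauchyI)
    fix e :: real assume "0 < e"
    then obtain J where J: "\<And>i j s. i \<ge> J \<Longrightarrow> j \<ge> J \<Longrightarrow> \<epsilon> \<le> Re s \<Longrightarrow>
        cmod (dirichlet_fun (f (k i)) s - dirichlet_fun (f (k j)) s) \<le> e / 2"
      using k(2)[rule_format, of "e / 2"] by auto
    have le: "norm (y (k i) - y (k j)) \<le> e / 2" if "i \<ge> J" "j \<ge> J" for i j
    proof (rule norm_dirichlet_leI)
      fix s assume s: "0 < Re s"
      then have "\<Phi> s \<in> half_plane \<epsilon>" using assms(2) by (auto simp del: half_plane_iff simp: half_plane_iff[of _ 0])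
      then show "cmod (dirichlet_fun (y (k i) - y (k j)) s) \<le> e / 2"
        using J[OF that, of "\<Phi> s"] s by (simp add: dirichlet_fun_simps f(2) composition_eval)
    qed
    have "norm (y (k i) - y (k j)) < e" if "i \<ge> J" "j \<ge> J" for i j
      using le[OF that] \<open>0 < e\<close> by linarith
    then show "\<exists>M. \<forall>i\<ge>M. \<forall>j\<ge>M. norm (y (k i) - y (k j)) < e" by blast
  qed
  then show "\<exists>(k::nat \<Rightarrow> nat) l. strict_mono k \<and> (\<lambda>n. y (k n)) \<longlonglongrightarrow> l"
    using k(1) by (auto simp: Cauchy_convergent_iff convergent_def)
qed

end

section \<open>Operators fixing a copy of \<open>c0\<close>, and weak compactness\<close>

lemma scaleC_minus1: "(- 1 :: complex) *\<^sub>C x = - x"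
  using scaleC_of_real[of "- 1" x] by simp

lemma bounded_clinear_on_diff:
  assumes "bounded_clinear_on Z T" "csubspace Z" "x \<in> Z" "y \<in> Z"
  shows "T (x - y) = T x - T y"
proof -
  have "(- 1) *\<^sub>C y \<in> Z" using assms by (simp add: csubspace_def)
  then have "T (x + (- 1) *\<^sub>C y) = T x + (- 1) *\<^sub>C T y"
    using assms by (simp add: bounded_clinear_on_def)
  then show ?thesis by (simp add: scaleC_minus1)
qed

lemma csubspace_diff: "csubspace Z \<Longrightarrow> x \<in> Z \<Longrightarrow> y \<in> Z \<Longrightarrow> x - y \<in> Z"
  unfolding csubspace_def by (metis diff_conv_add_uminus scaleC_minus1)

lemma bounded_clinear_on_bound:
  assumes "bounded_clinear_on Z T"
  obtains K where "0 < K" "\<And>x. x \<in> Z \<Longrightarrow> norm (T x) \<le> K * norm x"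
proof -
  obtain K where K: "\<And>x. x \<in> Z \<Longrightarrow> norm (T x) \<le> norm x * K"
    using assms unfolding bounded_clinear_on_def by blast
  have "norm (T x) \<le> max 1 K * norm x" if "x \<in> Z" for x
    using K[OF that] mult_left_mono[of K "max 1 K" "norm x"] by (simp add: mult.commute)
  then show ?thesis by (intro that[of "max 1 K"]) auto
qed

text \<open>One lower bound for the composite bounds both inverses: \<open>norm x\<close> is at most
  \<open>KT / c\<close> times \<open>norm (S x)\<close>, and \<open>norm (S x)\<close> is at most
  \<open>KS / c\<close> times \<open>norm (T (S x))\<close>.\<close>

lemma fixes_copyI:
  fixes S :: "'e::complex_normed_vector \<Rightarrow> 'a::complex_normed_vector"
    and T :: "'a \<Rightarrow> 'b::complex_normed_vector"
  assumes S: "bounded_clinear S" and T: "bounded_clinear T"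
    and "0 < c" and lower: "\<And>x. c * norm x \<le> norm (T (S x))"
  shows "fixes_copy TYPE('e) T"
proof -
  obtain KS where KS: "0 < KS" "\<And>x. norm (S x) \<le> KS * norm x"
    by (rule bounded_clinear_on_bound[OF S]) auto
  obtain KT where KT: "0 < KT" "\<And>x. norm (T x) \<le> KT * norm x"
    by (rule bounded_clinear_on_bound[OF T]) auto
  have Slin: "S (x + y) = S x + S y" "S (a *\<^sub>C x) = a *\<^sub>C S x" for x y a
    using S by (auto simp: bounded_clinear_on_def)
  have Tlin: "T (x + y) = T x + T y" "T (a *\<^sub>C x) = a *\<^sub>C T x" for x y a
    using T by (auto simp: bounded_clinear_on_def)
  have TSdiff: "T (S x) - T (S y) = T (S (x - y))" for x y
    using S T by (metis (full_types) UNIV_I bounded_clinear_iff linear_diff bounded_linear.linear)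
  have inj: "T (S x) = T (S y) \<longleftrightarrow> x = y" for x y
    using lower[of "x - y"] TSdiff[of x y] \<open>0 < c\<close> by (auto simp: mult_le_0_iff)
  have injS: "inj S" using inj by (metis injI)
  have injT: "inj_on T (range S)" using inj by (auto simp: inj_on_def)
  define J where "J = inv S"
  have J [simp]: "J (S x) = x" for x by (simp add: J_def injS)
  have inv: "inv_into (range S) J x = S x" for x
    by (rule inv_into_f_eq) (auto simp: inj_on_def)
  have invT: "inv_into (range S) T (T (S x)) = S x" for x
    by (rule inv_into_f_f[OF injT]) simp
  have bound: "norm x \<le> norm (T (S x)) / c" for x
    using lower[of x] \<open>0 < c\<close> by (simp add: field_simps)
  have "S 0 = 0" using Slin(2)[of 0 0] scaleC_of_real[of 0] by (metis of_real_0 scaleR_zero_left)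
  show ?thesis unfolding fixes_copy_def
  proof (intro exI[of _ "range S"] conjI exI[of _ J])
    show "csubspace (range S)"
      unfolding csubspace_def using \<open>S 0 = 0\<close> by (auto simp: Slin[symmetric])
    show "cisomorphism (range S) UNIV J" unfolding cisomorphism_def
    proof (intro conjI)
      show "bij_betw J (range S) UNIV"
        by (auto simp: bij_betw_def inj_on_def image_iff intro: exI[of _ "S _"])
      have "norm x \<le> norm (S x) * (KT / c)" for x
        using order_trans[OF bound divide_right_mono[OF KT(2)]] \<open>0 < c\<close> by (simp add: mult_ac)
      then show "bounded_clinear_on (range S) J"
        unfolding bounded_clinear_on_def by (auto simp: Slin[symmetric] intro!: exI[of _ "KT / c"])
      show "bounded_clinear (inv_into (range S) J)"
        unfolding bounded_clinear_on_def inv using S by (simp add: bounded_clinear_on_def)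
    qed
    show "cisomorphism (range S) (T ` range S) T" unfolding cisomorphism_def
    proof (intro conjI)
      show "bij_betw T (range S) (T ` range S)" using injT by (simp add: bij_betw_def)
      show "bounded_clinear_on (range S) T" using T unfolding bounded_clinear_on_def by auto
      have "norm (S x) \<le> norm (T (S x)) * (KS / c)" for x
        using order_trans[OF KS(2) mult_left_mono[OF bound]] KS(1) by (simp add: mult_ac)
      then show "bounded_clinear_on (T ` range S) (inv_into (range S) T)"
        unfolding bounded_clinear_on_def
        by (auto simp: invT Slin[symmetric] Tlin[symmetric] intro!: exI[of _ "KS / c"])
    qed
  qed
qed

text \<open>\<open>S\<close> inverts the isomorphism onto the given space. The lower bound is stated
  for differences, so that it can be applied without linearity of \<open>S\<close>.\<close>

lemma fixes_copyE:
  fixes T :: "'a::complex_normed_vector \<Rightarrow> 'b::complex_normed_vector"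
  assumes "fixes_copy TYPE('e) T"
  obtains K c and S :: "'e::complex_normed_vector \<Rightarrow> 'a" where "0 < K" "0 < c" "\<forall>x. norm (S x) \<le> K * norm x"
    "\<forall>x y. c * norm (x - y) \<le> norm (T (S x) - T (S y))"
proof -
  from assms obtain Z and J :: "'a \<Rightarrow> 'e" where Z: "csubspace Z"
    and J: "cisomorphism Z UNIV J" and T: "cisomorphism Z (T ` Z) T"
    unfolding fixes_copy_def by blast
  define S where "S = inv_into Z J"
  have bij: "bij_betw J Z UNIV" using J by (simp add: cisomorphism_def)
  have SZ: "S x \<in> Z" and JS: "J (S x) = x" for x
    using bij by (auto simp: S_def bij_betw_def inv_into_into f_inv_into_f)
  obtain K where K: "0 < K" "\<And>x. norm (S x) \<le> K * norm x"
    using J unfolding cisomorphism_def S_def by (meson UNIV_I bounded_clinear_on_bound)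
  obtain KJ where KJ: "0 < KJ" "\<And>x. x \<in> Z \<Longrightarrow> norm (J x) \<le> KJ * norm x"
    using J unfolding cisomorphism_def by (meson bounded_clinear_on_bound)
  obtain KT where KT: "0 < KT" "\<And>x. x \<in> T ` Z \<Longrightarrow> norm (inv_into Z T x) \<le> KT * norm x"
    using T unfolding cisomorphism_def by (meson bounded_clinear_on_bound)
  have "1 / (KJ * KT) * norm (x - y) \<le> norm (T (S x) - T (S y))" for x y
  proof -
    let ?u = "S x - S y"
    have u: "?u \<in> Z" using Z SZ by (simp add: csubspace_diff)
    have "J ?u = x - y"
      using bounded_clinear_on_diff[of Z J "S x" "S y"] J Z SZ JS by (simp add: cisomorphism_def)
    moreover have "T ?u = T (S x) - T (S y)"
      using bounded_clinear_on_diff[of Z T "S x" "S y"] T Z SZ by (simp add: cisomorphism_def)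
    moreover have "inv_into Z T (T ?u) = ?u"
      using T u by (auto simp: cisomorphism_def bij_betw_def)
    ultimately have "norm (x - y) \<le> KJ * norm ?u" "norm ?u \<le> KT * norm (T (S x) - T (S y))"
      using KJ(2)[OF u] KT(2)[OF imageI[OF u]] by simp_all
    then have "norm (x - y) \<le> KJ * (KT * norm (T (S x) - T (S y)))"
      using KJ(1) by (meson mult_left_mono less_imp_le order_trans)
    then show ?thesis using KJ KT by (simp add: field_simps)
  qed
  then show ?thesis using K KJ(1) KT(1) by (intro that[of K "1 / (KJ * KT)" S]) auto
qed

lemma c0_nth_le_norm: "cmod (c0_nth x n) \<le> norm x"
  unfolding norm_c0_def by (rule cSUP_upper[OF _ bdd_c0]) simp

lemma norm_c0_leI: "(\<And>n. cmod (c0_nth x n) \<le> B) \<Longrightarrow> norm x \<le> B"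
  unfolding norm_c0_def by (rule cSUP_least) auto

lift_definition c0_unit :: "nat \<Rightarrow> c0" is "\<lambda>m n. if n = m then 1 else 0"
proof -
  show "(\<lambda>n. if n = m then 1 else 0) \<longlonglongrightarrow> (0::complex)" for m :: nat
    by (rule tendsto_eventually, rule eventually_sequentiallyI[of "Suc m"]) auto
qed

text \<open>Unit vectors of c0 have mutual distance at least 1. Scaled into the unit ball by 1 /
  \<open>K\<close>, their images stay separated by \<open>c / K\<close>, so no subsequence of them
  is Cauchy.\<close>

lemma compact_not_fixes_c0:
  fixes T :: "'a::complex_normed_vector \<Rightarrow> 'b::complex_normed_vector"
  assumes "compact_operator T"
  shows "\<not> fixes_copy TYPE(c0) T"
proof
  assume "fixes_copy TYPE(c0) T"
  then obtain K c and S :: "c0 \<Rightarrow> 'a" where S: "0 < K" "0 < c" "\<forall>x. norm (S x) \<le> K * norm x"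
    "\<forall>x y. c * norm (x - y) \<le> norm (T (S x) - T (S y))" by (rule fixes_copyE)
  define y where "y n = T (S (c0_unit n))" for n
  have scale: "T (inverse K *\<^sub>R x) = inverse K *\<^sub>R T x" for x
    using assms by (simp add: compact_operator_def bounded_clinear_iff linear_simps)
  have "norm (c0_unit n) \<le> 1" for n by (rule norm_c0_leI) (simp add: c0_unit.rep_eq)
  then have SK: "norm (S (c0_unit n)) \<le> K" for n
    using S(1) order_trans[OF S(3)[rule_format, of "c0_unit n"] mult_left_mono[of _ 1 K]] by simp
  have "inverse K *\<^sub>R y n \<in> closure (T ` cball 0 1)" for n
  proof -
    have "inverse K *\<^sub>R S (c0_unit n) \<in> cball 0 1" using SK[of n] S(1) by (simp add: field_simps)
    then have "T (inverse K *\<^sub>R S (c0_unit n)) \<in> closure (T ` cball 0 1)"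
      by (rule subsetD[OF closure_subset imageI])
    then show ?thesis by (simp only: y_def scale)
  qed
  moreover have "seq_compact (closure (T ` cball 0 1))"
    using assms by (simp add: compact_operator_def compact_eq_seq_compact_metric)
  ultimately have "\<exists>l\<in>closure (T ` cball 0 1). \<exists>r. strict_mono r \<and> ((\<lambda>n. inverse K *\<^sub>R y n) \<circ> r) \<longlonglongrightarrow> l"
    by (metis seq_compact_def)
  then obtain l r where r: "strict_mono (r :: nat \<Rightarrow> nat)" "(\<lambda>n. inverse K *\<^sub>R y (r n)) \<longlonglongrightarrow> l"
    unfolding o_def by blast
  then have "Cauchy (\<lambda>n. inverse K *\<^sub>R y (r n))" by (intro LIMSEQ_imp_Cauchy)
  then obtain M where M: "\<And>m n. m \<ge> M \<Longrightarrow> n \<ge> M \<Longrightarrow>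
      norm (inverse K *\<^sub>R y (r m) - inverse K *\<^sub>R y (r n)) < inverse K * c"
    using CauchyD[of "\<lambda>n. inverse K *\<^sub>R y (r n)" "inverse K * c"] S(1,2) by auto
  let ?m = "r M" and ?n = "r (Suc M)"
  have ne: "?m \<noteq> ?n" using strict_mono_less[OF r(1), of M "Suc M"] by simp
  have "1 = cmod (c0_nth (c0_unit ?m - c0_unit ?n) ?m)"
    using ne by (simp add: minus_c0.rep_eq c0_unit.rep_eq)
  also have "\<dots> \<le> norm (c0_unit ?m - c0_unit ?n)" by (rule c0_nth_le_norm)
  finally have "c \<le> c * norm (c0_unit ?m - c0_unit ?n)" using S(2) by simp
  also have "\<dots> \<le> norm (y ?m - y ?n)" unfolding y_def using S(4) by blast
  finally have "inverse K * c \<le> norm (inverse K *\<^sub>R y ?m - inverse K *\<^sub>R y ?n)"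
    using S(1) by (simp add: scaleR_diff_right[symmetric] del: scaleR_diff_right)
  with M[of M "Suc M"] show False by simp
qed

section \<open>The weak topology\<close>

lemma topspace_weak_topology [simp]: "topspace (weak_topology :: 'a::complex_normed_vector topology) = UNIV"
proof -
  have "bounded_clinear (\<lambda>x::'a. 0 :: complex)"
    by (auto simp: bounded_clinear_on_def scaleC_complex_def intro: exI[of _ 0])
  then have "(\<lambda>x::'a. 0 :: complex) -` UNIV \<in> {\<phi> -` U | (\<phi> :: 'a \<Rightarrow> complex) U. bounded_clinear \<phi> \<and> open U}"
    by blast
  then show ?thesis unfolding weak_topology_def topology_generated_by_topspace by auto
qed

lemma continuous_map_weak_topology:
  assumes "bounded_clinear (\<phi> :: 'a::complex_normed_vector \<Rightarrow> complex)"
  shows "continuous_map weak_topology euclidean \<phi>"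
  unfolding continuous_map_def
proof (intro conjI allI impI)
  fix U :: "complex set" assume "openin euclidean U"
  then have "openin weak_topology (\<phi> -` U)"
    unfolding weak_topology_def using assms by (intro topology_generated_by_Basis) auto
  then show "openin weak_topology {x \<in> topspace weak_topology. \<phi> x \<in> U}" by (simp add: vimage_def)
qed simp

lemma continuous_map_euclidean_weak_topology:
  "continuous_map euclidean (weak_topology :: 'a::complex_normed_vector topology) id"
  unfolding weak_topology_def
proof (rule continuous_on_generated_topo)
  fix V assume "V \<in> {\<phi> -` U | (\<phi> :: 'a \<Rightarrow> complex) U. bounded_clinear \<phi> \<and> open U}"
  then obtain \<phi> :: "'a \<Rightarrow> complex" and U where *: "V = \<phi> -` U" "bounded_clinear \<phi>" "open U" by blast
  then have "continuous_on UNIV \<phi>" by (simp add: bounded_clinear_iff linear_continuous_on)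
  with * show "openin euclidean (id -` V \<inter> topspace euclidean)" by (simp add: open_vimage)
next
  show "id ` topspace euclidean \<subseteq> \<Union> {\<phi> -` U | (\<phi> :: 'a \<Rightarrow> complex) U. bounded_clinear \<phi> \<and> open U}"
    using topspace_weak_topology[where 'a = 'a] unfolding weak_topology_def topology_generated_by_topspace by simp
qed

text \<open>The norm closure is weakly compact, the norm topology being finer; as the weak topology
  is Hausdorff, it is also weakly closed and hence contains the weak closure. The hypothesis
  \<open>sep\<close> replaces the Hahn-Banach theorem: in the algebra, point evaluations
  separate.\<close>

lemma compact_imp_weakly_compact:
  fixes T :: "'a::complex_normed_vector \<Rightarrow> 'b::complex_normed_vector"
  assumes T: "compact_operator T"
    and sep: "\<And>x y :: 'b. x \<noteq> y \<Longrightarrow> \<exists>\<phi> :: 'b \<Rightarrow> complex. bounded_clinear \<phi> \<and> \<phi> x \<noteq> \<phi> y"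
  shows "weakly_compact_operator T"
proof -
  let ?W = "weak_topology :: 'b topology"
  have "Hausdorff_space ?W" unfolding Hausdorff_space_def
  proof (intro allI impI)
    fix x y :: 'b assume "x \<in> topspace ?W \<and> y \<in> topspace ?W \<and> x \<noteq> y"
    then obtain \<phi> :: "'b \<Rightarrow> complex" where \<phi>: "bounded_clinear \<phi>" "\<phi> x \<noteq> \<phi> y" using sep by blast
    then obtain U V where UV: "open U" "open V" "\<phi> x \<in> U" "\<phi> y \<in> V" "U \<inter> V = {}"
      by (meson hausdorff)
    then have "openin ?W (\<phi> -` U)" "openin ?W (\<phi> -` V)" "disjnt (\<phi> -` U) (\<phi> -` V)"
      using continuous_map_weak_topology[OF \<phi>(1)]
      by (auto simp: continuous_map_def vimage_def disjnt_def)
    with UV show "\<exists>U V. openin ?W U \<and> openin ?W V \<and> x \<in> U \<and> y \<in> V \<and> disjnt U V"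
      by (intro exI[of _ "\<phi> -` U"] exI[of _ "\<phi> -` V"]) auto
  qed
  moreover have K: "compactin ?W (closure (T ` cball 0 1))"
    using image_compactin[OF _ continuous_map_euclidean_weak_topology, of "closure (T ` cball 0 1)"] T
    by (simp add: compact_operator_def)
  ultimately have "closedin ?W (closure (T ` cball 0 1))" by (intro compactin_imp_closedin)
  then have "?W closure_of (T ` cball 0 1) \<subseteq> closure (T ` cball 0 1)"
    by (intro closure_of_minimal closure_subset)
  then have "compactin ?W (?W closure_of (T ` cball 0 1))"
    by (intro closed_compactin[OF K]) auto
  with T show ?thesis by (simp add: weakly_compact_operator_def compact_operator_def)
qed

section \<open>Gliding humps\<close>

text \<open>Applied to the weak closures of the tails of a sequence, this gives a weak cluster point
  directly from the covering definition of compactness.\<close>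

lemma compactin_decreasing_nonempty:
  assumes "compactin X K" "\<And>n::nat. closedin X (C n)" "\<And>n. C n \<subseteq> K" "\<And>n. C n \<noteq> {}"
    and dec: "\<And>m n. m \<le> n \<Longrightarrow> C n \<subseteq> C m"
  obtains y where "\<And>n. y \<in> C n"
proof -
  have "K \<inter> \<Inter> (range C) \<noteq> {}"
  proof (rule compactin_fip[THEN iffD1, THEN conjunct2, rule_format, OF assms(1)])
    show "(\<forall>T\<in>range C. closedin X T) \<and> (\<forall>\<F>. finite \<F> \<and> \<F> \<subseteq> range C \<longrightarrow> K \<inter> \<Inter> \<F> \<noteq> {})"
    proof (intro conjI allI impI)
      fix \<F> assume "finite \<F> \<and> \<F> \<subseteq> range C"
      then obtain I where I: "finite I" "\<F> = C ` I" by (metis finite_subset_image)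
      have "C (Max (insert 0 I)) \<subseteq> K \<inter> \<Inter> \<F>"
        using I assms(3) dec[OF Max_ge[of "insert 0 I"]] by fastforce
      with assms(4) show "K \<inter> \<Inter> \<F> \<noteq> {}" by blast
    qed (use assms(2) in auto)
  qed
  then show ?thesis using that by blast
qed

text \<open>A substitute for a limit along a free ultrafilter: a cluster point of the functionals in
  the compact product of discs.\<close>

lemma generalized_limit_functional:
  fixes e :: "nat \<Rightarrow> 'a::complex_normed_vector \<Rightarrow> complex"
  assumes e: "\<And>n. bounded_clinear (e n)" and le: "\<And>n f. cmod (e n f) \<le> norm f"
  obtains \<psi> :: "'a \<Rightarrow> complex" where "bounded_clinear \<psi>"
    "\<And>f K. closed K \<Longrightarrow> \<forall>\<^sub>F n in sequentially. e n f \<in> K \<Longrightarrow> \<psi> f \<in> K"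
proof -
  define U where "U = (PiE UNIV (\<lambda>f::'a. cball (0::complex) (norm f)))"
  have "compactin (product_topology (\<lambda>_. euclidean) UNIV) U"
    unfolding U_def compactin_PiE by simp
  then have "compact U" unfolding euclidean_product_topology by simp
  moreover have "filtermap e sequentially \<noteq> bot" by (simp add: filtermap_bot_iff)
  moreover have "\<forall>\<^sub>F h in filtermap e sequentially. h \<in> U"
    unfolding eventually_filtermap U_def using le by (simp add: PiE_def Pi_def)
  ultimately obtain \<psi> where \<psi>: "inf (nhds \<psi>) (filtermap e sequentially) \<noteq> bot"
    unfolding compact_filter by blast
  \<comment> \<open>\<open>G\<close> is finer than the sequence and converges to \<psi> pointwise;
    linear identities and closed conditions that hold eventually along \<open>e\<close> therefore
    pass to \<psi>.\<close>
  define G where "G = inf (nhds \<psi>) (filtermap e sequentially)"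
  have G: "G \<noteq> bot" using \<psi> by (simp add: G_def)
  have lim: "((\<lambda>h. h f) \<longlongrightarrow> \<psi> f) G" for f
  proof -
    have "((\<lambda>h. h f) \<longlongrightarrow> \<psi> f) (nhds \<psi>)"
      unfolding tendsto_def eventually_nhds
    proof (intro allI impI)
      fix V :: "complex set" assume "open V" "\<psi> f \<in> V"
      then show "\<exists>N. open N \<and> \<psi> \<in> N \<and> (\<forall>h\<in>N. h f \<in> V)"
        by (intro exI[of _ "(\<lambda>h. h f) -` V"]) (auto intro: open_vimage)
    qed
    then show ?thesis unfolding G_def by (rule tendsto_mono[OF inf_le1])
  qed
  have ev: "\<forall>\<^sub>F h in G. P h" if "\<forall>\<^sub>F n in sequentially. P (e n)" for P
    using that unfolding G_def by (intro filter_leD[OF inf_le2]) (simp add: eventually_filtermap)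
  have closed: "\<psi> f \<in> K" if "closed K" "\<forall>\<^sub>F n in sequentially. e n f \<in> K" for f K
    using Lim_in_closed_set[OF that(1) ev[OF that(2)] G lim] .
  have "\<psi> (f + g) = \<psi> f + \<psi> g" for f g
  proof (rule tendsto_unique[OF G lim])
    have "\<forall>\<^sub>F h in G. h f + h g = h (f + g)"
      using e by (intro ev) (simp add: bounded_clinear_on_def)
    then show "((\<lambda>h. h (f + g)) \<longlongrightarrow> \<psi> f + \<psi> g) G"
      by (rule Lim_transform_eventually[OF tendsto_add[OF lim lim]])
  qed
  moreover have "\<psi> (c *\<^sub>C f) = c *\<^sub>C \<psi> f" for c f
  proof (rule tendsto_unique[OF G lim])
    have "\<forall>\<^sub>F h in G. c * h f = h (c *\<^sub>C f)"
      using e by (intro ev) (simp add: bounded_clinear_on_def scaleC_complex_def)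
    then show "((\<lambda>h. h (c *\<^sub>C f)) \<longlongrightarrow> c *\<^sub>C \<psi> f) G"
      unfolding scaleC_complex_def by (rule Lim_transform_eventually[OF tendsto_mult_left[OF lim]])
  qed
  moreover have "cmod (\<psi> f) \<le> norm f * 1" for f
    using closed[of "cball 0 (norm f)" f] le by simp
  ultimately have "bounded_clinear \<psi>" unfolding bounded_clinear_on_def by blast
  then show ?thesis using closed by (rule that)
qed

text \<open>By the parallelogram law, the closed disc with diameter \<open>[0, 1]\<close>.\<close>

definition peak_disc :: "complex set"
  where "peak_disc = {z. (cmod z)\<^sup>2 + (cmod (1 - z))\<^sup>2 \<le> 1}"

lemma peak_disc_le_1:
  assumes "z \<in> peak_disc"
  shows "cmod z \<le> 1"
proof -
  have "(cmod z)\<^sup>2 + (cmod (1 - z))\<^sup>2 \<le> 1" using assms by (simp add: peak_disc_def)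
  then have "(cmod z)\<^sup>2 \<le> 1\<^sup>2" using zero_le_power2[of "cmod (1 - z)"] unfolding power_one by linarith
  then show ?thesis by (rule power2_le_imp_le) simp
qed

text \<open>Order of choice: \<open>a\<close> so large that powers from \<open>a\<close> on are
  small at distance \<rho> or more from 1; then \<open>w\<close> so close to 1 that w^a is within
  1/16 of 1; then \<open>b\<close> so large that w^b is below 1/16, whence 7/8; last
  \<open>\<rho>'\<close> so small that the difference, which vanishes at 1, is at most \<eta> within
  it.\<close>

lemma gliding_hump_step:
  fixes W :: "complex set"
  assumes W: "W \<subseteq> peak_disc - {1}" "\<And>e. 0 < e \<Longrightarrow> \<exists>z\<in>W. cmod (1 - z) < e"
    and "0 < \<rho>" "0 < \<eta>"
  shows "\<exists>a b w \<rho>'. w \<in> W \<and> 0 < \<rho>' \<and> \<rho>' \<le> \<rho> \<and> \<rho>' \<le> cmod (1 - w) \<and> 7 / 8 \<le> cmod (w ^ a - w ^ b)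
    \<and> (\<forall>z\<in>peak_disc. cmod (1 - z) < \<rho>' \<longrightarrow> cmod (z ^ a - z ^ b) \<le> \<eta>)
    \<and> (\<forall>z\<in>peak_disc. \<rho> \<le> cmod (1 - z) \<longrightarrow> cmod (z ^ a - z ^ b) \<le> \<eta>)"
proof -
  \<comment> \<open>In the disc, |z|^2 \<le> 1 - \<rho>^2 at distance \<rho> or more from 1. The
    maximum covers \<rho> > 1.\<close>
  define r where "r = sqrt (max 0 (1 - \<rho>\<^sup>2))"
  have r: "0 \<le> r" "r < 1" using \<open>0 < \<rho>\<close> by (auto simp: r_def real_sqrt_lt_1_iff)
  have near: "\<exists>d>0. \<forall>z. cmod (1 - z) < d \<longrightarrow> cmod (g z - g 1) < e"
    if "continuous_on UNIV g" "0 < e" for g :: "complex \<Rightarrow> complex" and e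
    using that unfolding continuous_on_iff dist_norm by (metis UNIV_I norm_minus_commute)
  obtain a where a: "r ^ a < \<eta> / 2" using real_arch_pow_inv[of "\<eta> / 2" r] r \<open>0 < \<eta>\<close> by auto
  have "\<exists>d>0. \<forall>z. cmod (1 - z) < d \<longrightarrow> cmod (z ^ a - 1 ^ a) < 1 / 16"
    by (rule near) (auto intro!: continuous_intros)
  then obtain d where d: "0 < d" "\<And>z. cmod (1 - z) < d \<Longrightarrow> cmod (z ^ a - 1 ^ a) < 1 / 16" by blast
  obtain w where w: "w \<in> W" "cmod (1 - w) < d" using W(2) d(1) by blast
  have "w \<in> peak_disc" "w \<noteq> 1" using w W by auto
  then have "(cmod w)\<^sup>2 + (cmod (1 - w))\<^sup>2 \<le> 1" "0 < (cmod (1 - w))\<^sup>2" by (auto simp: peak_disc_def zero_less_power2)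
  then have "(cmod w)\<^sup>2 < 1\<^sup>2" unfolding power_one by linarith
  then have "cmod w < 1" by (rule power2_less_imp_less) simp
  then obtain b0 where b0: "cmod w ^ b0 < 1 / 16" using real_arch_pow_inv[of "1 / 16" "cmod w"] by auto
  define b where "b = a + b0"
  have "cmod (w ^ b) \<le> cmod w ^ b0"
    unfolding b_def norm_power using \<open>cmod w < 1\<close> by (intro power_decreasing) auto
  moreover have "cmod (w ^ a - 1) < 1 / 16" using d(2)[OF w(2)] by simp
  moreover have "1 \<le> cmod (w ^ a - w ^ b) + cmod (w ^ b) + cmod (w ^ a - 1)"
    using norm_triangle_ineq4[of "w ^ a - w ^ b + w ^ b" "w ^ a - 1"] norm_triangle_ineq[of "w ^ a - w ^ b" "w ^ b"]
    by simp
  ultimately have low: "7 / 8 \<le> cmod (w ^ a - w ^ b)" using b0 by linarith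
  have far: "cmod (z ^ a - z ^ b) \<le> \<eta>" if z: "z \<in> peak_disc" "\<rho> \<le> cmod (1 - z)" for z
  proof -
    have "\<rho>\<^sup>2 \<le> (cmod (1 - z))\<^sup>2" using z \<open>0 < \<rho>\<close> by (intro power_mono) auto
    then have "(cmod z)\<^sup>2 \<le> max 0 (1 - \<rho>\<^sup>2)" using z(1) by (simp add: peak_disc_def)
    then have "cmod z \<le> r" unfolding r_def by (rule real_le_rsqrt)
    then have "cmod (z ^ a) \<le> r ^ a" by (simp add: norm_power power_mono)
    moreover have "cmod (z ^ b) \<le> cmod (z ^ a)"
      unfolding b_def norm_power using peak_disc_le_1[OF z(1)] by (intro power_decreasing) auto
    ultimately show ?thesis using a norm_triangle_ineq4[of "z ^ a" "z ^ b"] by linarith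
  qed
  have "\<exists>d>0. \<forall>z. cmod (1 - z) < d \<longrightarrow> cmod ((z ^ a - z ^ b) - (1 ^ a - 1 ^ b)) < \<eta>"
    by (rule near) (use \<open>0 < \<eta>\<close> in \<open>auto intro!: continuous_intros\<close>)
  then obtain d' where d': "0 < d'"
    "\<And>z. cmod (1 - z) < d' \<Longrightarrow> cmod ((z ^ a - z ^ b) - (1 ^ a - 1 ^ b)) < \<eta>" by blast
  show ?thesis
  proof (intro exI conjI)
    show "\<forall>z\<in>peak_disc. cmod (1 - z) < min \<rho> (min (cmod (1 - w)) d') \<longrightarrow> cmod (z ^ a - z ^ b) \<le> \<eta>"
      using d'(2) by (auto intro: less_imp_le)
  qed (use w low far d' \<open>0 < \<rho>\<close> \<open>w \<noteq> 1\<close> in auto)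
qed

text \<open>Every \<open>z\<close> sees at most one hump of height above \<open>\<eta> n\<close>: if the \<open>m\<close>-th one is that high, then
  \<open>z\<close> has distance at least \<open>\<rho> m\<close> from \<open>1\<close>, where all later humps are small.\<close>

lemma gliding_hump_powers:
  fixes W :: "complex set"
  assumes W: "W \<subseteq> peak_disc - {1}" "\<And>e. 0 < e \<Longrightarrow> \<exists>z\<in>W. cmod (1 - z) < e"
  obtains w :: "nat \<Rightarrow> complex" and a b :: "nat \<Rightarrow> nat" where
    "\<forall>n. w n \<in> W" "\<forall>n. 7 / 8 \<le> cmod (w n ^ a n - w n ^ b n)"
    "\<forall>z N. z \<in> peak_disc \<longrightarrow> (\<Sum>n<N. cmod (z ^ a n - z ^ b n)) \<le> 3"
    "\<forall>n N. (\<Sum>m\<in>{..<N} - {n}. cmod (w n ^ a m - w n ^ b m)) \<le> 1 / 8"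
proof -
  \<comment> \<open>The thresholds add up to 1/8, the total allowed to all small humps. Each is
    below 7/8, so that \<open>w n\<close> counts as seeing the n-th hump.\<close>
  define \<eta> :: "nat \<Rightarrow> real" where "\<eta> n = (1 / 2) ^ n / 16" for n
  have \<eta>: "0 < \<eta> n" "\<eta> n < 7 / 8" for n
    using power_le_one[of "1 / 2 :: real" n] by (simp_all add: \<eta>_def)
  have sum_\<eta>: "sum \<eta> I \<le> 1 / 8" if "finite I" for I
  proof -
    have "\<eta> sums (1 / (1 - 1 / 2) / 16)" unfolding \<eta>_def by (intro sums_divide geometric_sums) simp
    then show ?thesis using sum_le_suminf[of \<eta> I] that \<eta>(1) by (simp add: sums_iff less_imp_le)
  qed
  define P where "P n x = (case x of (a, b, w, \<rho>) \<Rightarrow> w \<in> W \<and> 0 < \<rho> \<and> \<rho> \<le> cmod (1 - w)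
      \<and> 7 / 8 \<le> cmod (w ^ a - w ^ b)
      \<and> (\<forall>z\<in>peak_disc. cmod (1 - z) < \<rho> \<longrightarrow> cmod (z ^ a - z ^ b) \<le> \<eta> n))" for n and x :: "nat \<times> nat \<times> complex \<times> real"
  define Q where "Q n x y = (case x of (_, _, _, \<rho>) \<Rightarrow> case y of (a, b, w, \<rho>') \<Rightarrow> \<rho>' \<le> \<rho>
      \<and> (\<forall>z\<in>peak_disc. \<rho> \<le> cmod (1 - z) \<longrightarrow> cmod (z ^ a - z ^ b) \<le> \<eta> (Suc n)))"
    for n and x y :: "nat \<times> nat \<times> complex \<times> real"
  \<comment> \<open>The radius of each hump is the \<rho> of the next step, hence the dependent
    choice of quadruples.\<close>
  have "\<exists>f. \<forall>n. P n (f n) \<and> Q n (f n) (f (Suc n))"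
  proof (rule dependent_nat_choice)
    show "\<exists>x. P 0 x"
      using gliding_hump_step[OF W, of 1 "\<eta> 0"] \<eta> unfolding P_def by (simp add: split_paired_Ex) blast
    show "\<exists>y. P (Suc n) y \<and> Q n x y" if "P n x" for x n
    proof (cases x)
      case (fields a b w \<rho>)
      then have "0 < \<rho>" using that by (simp add: P_def)
      from gliding_hump_step[OF W this \<eta>(1)[of "Suc n"]] show ?thesis
        unfolding fields P_def Q_def by (simp add: split_paired_Ex) blast
    qed
  qed
  then obtain f where f: "\<And>n. P n (f n)" "\<And>n. Q n (f n) (f (Suc n))" by blast
  define a where "a n = fst (f n)" for n
  define b where "b n = fst (snd (f n))" for n
  define w where "w n = fst (snd (snd (f n)))" for n
  define \<rho> where "\<rho> n = snd (snd (snd (f n)))" for n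
  define g where "g n z = cmod (z ^ a n - z ^ b n)" for n z
  have w: "w n \<in> W" and low: "7 / 8 \<le> g n (w n)"
    and near: "\<And>z. z \<in> peak_disc \<Longrightarrow> cmod (1 - z) < \<rho> n \<Longrightarrow> g n z \<le> \<eta> n" for n
    using f(1)[of n] by (auto simp: P_def a_def b_def w_def \<rho>_def g_def split: prod.splits)
  have \<rho>: "\<rho> (Suc n) \<le> \<rho> n"
    and far: "\<And>z. z \<in> peak_disc \<Longrightarrow> \<rho> n \<le> cmod (1 - z) \<Longrightarrow> g (Suc n) z \<le> \<eta> (Suc n)" for n
    using f(2)[of n] by (auto simp: Q_def a_def b_def \<rho>_def g_def split: prod.splits)
  have later: "g n z \<le> \<eta> n" if z: "z \<in> peak_disc" and "m < n" "\<not> g m z \<le> \<eta> m" for m n z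
  proof -
    obtain k where k: "n = Suc k" "m \<le> k" using \<open>m < n\<close> by (cases n) auto
    have "\<rho> k \<le> \<rho> m" using \<rho> k(2) by (rule lift_Suc_antimono_le)
    moreover have "\<rho> m \<le> cmod (1 - z)" using near[OF z, of m] that(3) by linarith
    ultimately show ?thesis unfolding k(1) using z by (intro far) auto
  qed
  have one: "(\<Sum>m\<in>I - {n}. g m z) \<le> 1 / 8" if z: "z \<in> peak_disc" and n: "\<not> g n z \<le> \<eta> n" and I: "finite I" for I n z
  proof -
    have "g m z \<le> \<eta> m" if "m \<noteq> n" for m
      using later[OF z, of m n] later[OF z, of n m] n that by (cases "m < n") auto
    then have "(\<Sum>m\<in>I - {n}. g m z) \<le> sum \<eta> (I - {n})" by (intro sum_mono) auto
    also have "\<dots> \<le> 1 / 8" using I by (intro sum_\<eta>) auto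
    finally show ?thesis .
  qed
  show ?thesis
  proof (rule that[of w a b]; intro allI impI)
    show "7 / 8 \<le> cmod (w n ^ a n - w n ^ b n)" for n using low[of n] by (simp add: g_def)
    show "(\<Sum>n<N. cmod (z ^ a n - z ^ b n)) \<le> 3" if z: "z \<in> peak_disc" for z N
    proof (cases "\<exists>n<N. \<not> g n z \<le> \<eta> n")
      case True
      then obtain n where n: "n < N" "\<not> g n z \<le> \<eta> n" by blast
      \<comment> \<open>The one high hump is at most 2 and the others together at most 1/8, which is
        below 3.\<close>
      have "cmod (z ^ k) \<le> 1" for k using peak_disc_le_1[OF z] by (simp add: norm_power power_le_one)
      then have "g n z \<le> 2"
        using norm_triangle_ineq4[of "z ^ a n" "z ^ b n"] unfolding g_def
        by (meson add_mono order_trans one_add_one[THEN eq_refl])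
      then have "(\<Sum>n<N. g n z) \<le> 3"
        using one[OF z n(2), of "{..<N}"] n(1) by (simp add: sum.remove[of _ n])
      then show ?thesis by (simp add: g_def)
    next
      case False
      then have "(\<Sum>n<N. g n z) \<le> sum \<eta> {..<N}" by (intro sum_mono) auto
      with sum_\<eta>[of "{..<N}"] show ?thesis by (simp add: g_def)
    qed
    show "(\<Sum>m\<in>{..<N} - {n}. cmod (w n ^ a m - w n ^ b m)) \<le> 1 / 8" for n N
      using one[of "w n" n "{..<N}"] w[of n] low[of n] \<eta>(2)[of n] W(1) by (auto simp: g_def)
  qed (rule w)
qed

section \<open>Polynomials in 2^(-s) and the peaking function\<close>

lemma dirichlet_term_in_dirichlet_functions:
  "(\<lambda>s. if 0 < Re s then dirichlet_term n s else 0) \<in> dirichlet_functions"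
proof (rule dirichlet_functionsI)
  define l where "l = ln (real (Suc n))"
  have l: "0 \<le> l" by (simp add: l_def)
  have "cmod (dirichlet_term n s - dirichlet_term n t) \<le> l * cmod (s - t)"
    if "s \<in> half_plane 0" "t \<in> half_plane 0" for s t
  proof (rule field_differentiable_bound[OF convex_half_plane _ _ that])
    fix z assume z: "z \<in> half_plane 0"
    show "(dirichlet_term n has_field_derivative - of_real l * dirichlet_term n z) (at z within half_plane 0)"
      unfolding dirichlet_term_exp l_def by (auto intro!: derivative_eq_intros)
    have "cmod (dirichlet_term n z) \<le> 1"
      using powr_mono[of "- Re z" 0 "real (Suc n)"] z by (simp add: norm_dirichlet_term)
    then show "cmod (- of_real l * dirichlet_term n z) \<le> l"
      using mult_left_mono[of _ 1 l] l by (simp add: norm_mult)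
  qed
  \<comment> \<open>\<open>l + 1\<close> instead of \<open>l\<close>, which is 0 for n = 0, so that
    the modulus of continuity \<open>e / (l + 1)\<close> is meaningful.\<close>
  then have lip: "cmod (dirichlet_term n s - dirichlet_term n t) \<le> (l + 1) * cmod (s - t)"
    if "s \<in> half_plane 0" "t \<in> half_plane 0" for s t
    using that mult_right_mono[of l "l + 1" "cmod (s - t)"] by (meson order_trans norm_ge_zero less_add_one less_imp_le)
  show "uniformly_continuous_on (half_plane 0) (\<lambda>s. if 0 < Re s then dirichlet_term n s else 0)"
    unfolding uniformly_continuous_on_def
  proof (intro allI impI exI conjI ballI)
    fix e :: real and s t assume e: "0 < e" and st: "s \<in> half_plane 0" "t \<in> half_plane 0" "dist t s < e / (l + 1)"
    have "(l + 1) * cmod (t - s) < e"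
      using st(3) l by (simp add: dist_norm field_simps)
    with lip[OF st(2,1)] st show "dist (if 0 < Re t then dirichlet_term n t else 0)
        (if 0 < Re s then dirichlet_term n s else 0) < e"
      by (simp add: dist_norm)
  qed (use l in auto)
  show "(\<lambda>m. (if m = n then 1 else 0) * dirichlet_term m s) sums (if 0 < Re s then dirichlet_term n s else 0)"
    if "0 < Re s" for s
    using sums_single[of n "\<lambda>m. dirichlet_term m s"] that
    by (simp add: if_distrib[of "\<lambda>x. x * _"] cong: if_cong)
qed simp

text \<open>With the shift of indices, the integer 2^k has index 2^k - 1.\<close>

lemma dirichlet_term_power_of_2: "dirichlet_term 1 s ^ k = dirichlet_term (2 ^ k - 1) s"
proof -
  have "real (Suc (2 ^ k - 1)) = 2 ^ k" by (simp add: of_nat_diff)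
  then have "ln (real (Suc (2 ^ k - 1))) = real k * ln 2" by (simp add: ln_realpow del: of_nat_Suc)
  then show ?thesis
    unfolding dirichlet_term_exp exp_of_nat_mult[symmetric] by (simp add: algebra_simps)
qed

lemma dirichlet_polynomial_in_2_powr:
  obtains F where "\<forall>s. 0 < Re s \<longrightarrow> dirichlet_fun F s = (\<Sum>k\<le>m. d k * dirichlet_term 1 s ^ k)"
proof
  define D where "D n = Abs_dirichlet (\<lambda>s. if 0 < Re s then dirichlet_term n s else 0)" for n
  have D: "dirichlet_fun (D n) s = dirichlet_term n s" if "0 < Re s" for n s
    unfolding D_def Abs_dirichlet_inverse[OF dirichlet_term_in_dirichlet_functions] using that by simp
  show "\<forall>s. 0 < Re s \<longrightarrow>
      dirichlet_fun (\<Sum>k\<le>m. d k *\<^sub>C D (2 ^ k - 1)) s = (\<Sum>k\<le>m. d k * dirichlet_term 1 s ^ k)"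
    by (simp add: dirichlet_fun_sum dirichlet_fun_simps D dirichlet_term_power_of_2 scaleC_complex_def del: One_nat_def)
qed

text \<open>The binomial theorem makes the power a linear combination of terms of the algebra, so no
  product of its elements has to be formed.\<close>

lemma dirichlet_peak_power:
  obtains F where "\<forall>s. 0 < Re s \<longrightarrow> dirichlet_fun F s = ((1 + c * dirichlet_term 1 s) / 2) ^ m"
proof -
  obtain F where F: "\<forall>s. 0 < Re s \<longrightarrow>
      dirichlet_fun F s = (\<Sum>k\<le>m. (of_nat (m choose k) * c ^ k / 2 ^ m) * dirichlet_term 1 s ^ k)"
    by (rule dirichlet_polynomial_in_2_powr)
  have "(\<Sum>k\<le>m. (of_nat (m choose k) * c ^ k / 2 ^ m) * u ^ k) = ((1 + c * u) / 2) ^ m" for u :: complex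
    using binomial_ring[of "c * u" 1 m]
    by (simp add: power_divide sum_divide_distrib power_mult_distrib add.commute mult_ac)
  with F show ?thesis by (intro that[of F]) simp
qed

text \<open>Parallelogram law: |1 + v|^2 + |1 - v|^2 = 2 + 2 |v|^2 \<le> 4, divided by 4.\<close>

lemma peak_disc_half:
  assumes "cmod v \<le> 1"
  shows "(1 + v) / 2 \<in> peak_disc"
proof -
  have "(cmod v)\<^sup>2 \<le> 1" using assms by (simp add: power_le_one)
  moreover have "1 - (1 + v) / 2 = (1 - v) / 2" by (simp add: field_simps)
  ultimately show ?thesis
    unfolding peak_disc_def by (simp add: cmod_power2 norm_divide power_divide) (simp add: cmod_power2 power2_eq_square algebra_simps)
qed

section \<open>Composition operators with symbol approaching the boundary\<close>

lemma bounded_linear_scaleC: "bounded_linear (\<lambda>x::'a::complex_normed_vector. c *\<^sub>C x)"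
proof (rule bounded_linear_intro)
  show "c *\<^sub>C r *\<^sub>R x = r *\<^sub>R c *\<^sub>C x" for r and x :: 'a
    unfolding scaleC_of_real[symmetric] scaleC_scaleC by (simp add: mult.commute)
  show "norm (c *\<^sub>C x) \<le> norm x * cmod c" for x :: 'a by (simp add: norm_scaleC)
qed (rule scaleC_add_right)

text \<open>Coefficients of modulus at most \<open>B\<close> give finite sums of norm at most
  \<open>B * C\<close>. For a null sequence, late blocks have small \<open>B\<close>, so the series
  converges by completeness; with \<open>B = norm x\<close> the same estimate bounds
  \<open>S\<close>.\<close>

lemma weakly_unconditionally_Cauchy_c0_map:
  fixes f :: "nat \<Rightarrow> dirichlet_algebra"
  assumes f: "\<And>s N. 0 < Re s \<Longrightarrow> (\<Sum>n<N. cmod (dirichlet_fun (f n) s)) \<le> C"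
  obtains S where "bounded_clinear S" "\<forall>x. (\<lambda>n. c0_nth x n *\<^sub>C f n) sums S x"
proof -
  have C: "0 \<le> C" using f[of 1 0] by simp
  have norm_le: "norm (\<Sum>n\<in>I. x n *\<^sub>C f n) \<le> B * C"
    if I: "finite I" and x: "\<And>n. n \<in> I \<Longrightarrow> cmod (x n) \<le> B" and "0 \<le> B" for I x B
  proof (rule norm_dirichlet_leI)
    fix s assume s: "0 < Re s"
    obtain N where N: "I \<subseteq> {..<N}" using finite_nat_iff_bounded I by blast
    have "cmod (\<Sum>n\<in>I. x n * dirichlet_fun (f n) s) \<le> (\<Sum>n\<in>I. B * cmod (dirichlet_fun (f n) s))"
      using x by (intro sum_norm_le) (auto simp: norm_mult intro: mult_right_mono)
    also have "\<dots> \<le> (\<Sum>n<N. B * cmod (dirichlet_fun (f n) s))"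
      using N \<open>0 \<le> B\<close> by (intro sum_mono2) auto
    also have "\<dots> \<le> B * C"
      unfolding sum_distrib_left[symmetric] using f[OF s] \<open>0 \<le> B\<close> by (intro mult_left_mono)
    finally show "cmod (dirichlet_fun (\<Sum>n\<in>I. x n *\<^sub>C f n) s) \<le> B * C"
      by (simp add: dirichlet_fun_sum dirichlet_fun_simps)
  qed
  have "summable (\<lambda>n. c0_nth x n *\<^sub>C f n)" for x
    unfolding summable_Cauchy
  proof (intro allI impI)
    fix e :: real assume "0 < e"
    define B where "B = e / (2 * (C + 1))"
    have B: "0 < B" "B * C < e" using C \<open>0 < e\<close> by (simp_all add: B_def field_simps add_nonneg_pos)
    have "c0_nth x \<longlonglongrightarrow> 0" using c0_nth[of x] by simp
    from LIMSEQ_D[OF this B(1)] obtain N where "\<And>n. n \<ge> N \<Longrightarrow> cmod (c0_nth x n) < B" by auto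
    then have "norm (\<Sum>k=m..<n. c0_nth x k *\<^sub>C f k) \<le> B * C" if "m \<ge> N" for m n
      using that B by (intro norm_le) (auto intro: less_imp_le)
    then show "\<exists>N. \<forall>m\<ge>N. \<forall>n. norm (\<Sum>k=m..<n. c0_nth x k *\<^sub>C f k) < e"
      using B(2) by (meson le_less_trans)
  qed
  then have sums: "(\<lambda>n. c0_nth x n *\<^sub>C f n) sums (\<Sum>n. c0_nth x n *\<^sub>C f n)" for x
    by (rule summable_sums)
  define S where "S x = (\<Sum>n. c0_nth x n *\<^sub>C f n)" for x
  note S = sums[folded S_def]
  have "S (x + y) = S x + S y" for x y
    using sums_add[OF S[of x] S[of y]] S[of "x + y"]
    by (simp add: plus_c0.rep_eq scaleC_add_left sums_iff)
  moreover have "S (c *\<^sub>C x) = c *\<^sub>C S x" for c x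
    using bounded_linear.sums[OF bounded_linear_scaleC[of c] S[of x]] S[of "c *\<^sub>C x"]
    by (simp add: scaleC_c0.rep_eq scaleC_scaleC sums_iff)
  moreover have "norm (S x) \<le> norm x * C" for x
  proof (rule tendsto_upperbound[OF tendsto_norm[OF S[of x, unfolded sums_def]]])
    have "norm (\<Sum>n<N. c0_nth x n *\<^sub>C f n) \<le> norm x * C" for N
      by (rule norm_le) (simp_all add: c0_nth_le_norm)
    then show "\<forall>\<^sub>F N in sequentially. norm (\<Sum>n<N. c0_nth x n *\<^sub>C f n) \<le> norm x * C"
      by simp
  qed simp
  ultimately have "bounded_clinear S" unfolding bounded_clinear_on_def by blast
  then show ?thesis using S by (intro that[of S]) auto
qed

context bounded_composition
begin

text \<open>If \<open>\<Phi>\<close> comes arbitrarily close to the imaginary axis, then by compactness \<open>2\<^bsup>- \<Phi> s\<^esup>\<close>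
  accumulates at some \<open>\<zeta>\<close> of modulus one, and powers of the peaking function
  \<open>(1 + cnj \<zeta> 2\<^bsup>- s\<^esup>) / 2\<close> at \<open>\<zeta>\<close> are available for a gliding hump.\<close>

lemma gliding_hump:
  assumes "\<nexists>\<epsilon>. 0 < \<epsilon> \<and> \<Phi> ` half_plane 0 \<subseteq> half_plane \<epsilon>"
  obtains t :: "nat \<Rightarrow> complex" and f :: "nat \<Rightarrow> dirichlet_algebra" where
    "\<forall>n. 0 < Re (t n)" "\<forall>n. 7 / 8 \<le> cmod (dirichlet_fun (f n) (\<Phi> (t n)))"
    "\<forall>s N. 0 < Re s \<longrightarrow> (\<Sum>n<N. cmod (dirichlet_fun (f n) s)) \<le> 3"
    "\<forall>n N. (\<Sum>m\<in>{..<N} - {n}. cmod (dirichlet_fun (f m) (\<Phi> (t n)))) \<le> 1 / 8"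
proof -
  have pos: "0 < Re (\<Phi> s)" if "0 < Re s" for s using self_map that by fastforce
  have "\<exists>s. 0 < Re s \<and> Re (\<Phi> s) \<le> inverse (real (Suc k))" for k
    using assms by (force simp: not_less simp del: of_nat_Suc dest!: spec[of _ "inverse (real (Suc k))"])
  then obtain s where s: "\<And>k. 0 < Re (s k)" "\<And>k. Re (\<Phi> (s k)) \<le> inverse (real (Suc k))" by metis
  define u where "u k = dirichlet_term 1 (\<Phi> (s k))" for k
  have lt1: "cmod (dirichlet_term 1 (\<Phi> s)) < 1" if "0 < Re s" for s
    using powr_less_mono[of "- Re (\<Phi> s)" 0 2] pos[OF that] by (simp add: norm_dirichlet_term)
  have "u k \<in> cball 0 1" for k using lt1[OF s(1)[of k]] by (simp add: u_def)
  then obtain \<zeta> r where r: "strict_mono (r :: nat \<Rightarrow> nat)" "(\<lambda>n. u (r n)) \<longlonglongrightarrow> \<zeta>"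
    using compact_imp_seq_compact[OF compact_cball, of "0::complex" 1]
    unfolding seq_compact_def o_def by metis
  \<comment> \<open>The modulus of 2^(-\<Phi>) is 2^(- Re \<Phi>), and the real parts tend to
    0.\<close>
  have "(\<lambda>k. cmod (u k)) \<longlonglongrightarrow> 1"
  proof (rule tendsto_sandwich[of "\<lambda>k. 2 powr - inverse (real (Suc k))" _ _ "\<lambda>_. 1"])
    show "\<forall>\<^sub>F k in sequentially. 2 powr - inverse (real (Suc k)) \<le> cmod (u k)"
      using s(2) by (intro always_eventually allI) (simp add: u_def norm_dirichlet_term powr_mono)
    show "\<forall>\<^sub>F k in sequentially. cmod (u k) \<le> 1"
      using lt1[OF s(1)] by (intro always_eventually allI) (simp add: u_def less_imp_le)
    show "(\<lambda>k. 2 powr - inverse (real (Suc k))) \<longlonglongrightarrow> 1" by real_asymp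
  qed auto
  then have "(\<lambda>n. cmod (u (r n))) \<longlonglongrightarrow> 1"
    using LIMSEQ_subseq_LIMSEQ[OF _ r(1)] by (fastforce simp: o_def)
  then have \<zeta>: "cmod \<zeta> = 1" using tendsto_norm[OF r(2)] LIMSEQ_unique by blast
  define q where "q s = (1 + cnj \<zeta> * dirichlet_term 1 s) / 2" for s
  have q_disc: "q s \<in> peak_disc" if "0 < Re s" for s
    unfolding q_def using powr_mono[of "- Re s" 0 2] that \<zeta>
    by (intro peak_disc_half) (simp add: norm_mult norm_dirichlet_term)
  \<comment> \<open>The peak value itself is not attained, as |2^(-\<Phi>)| < 1; this is what lets
    high powers of a chosen point tend to 0.\<close>
  have q_ne: "q (\<Phi> s) \<noteq> 1" if "0 < Re s" for s
  proof
    assume "q (\<Phi> s) = 1"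
    then have "cnj \<zeta> * dirichlet_term 1 (\<Phi> s) = 1" by (simp add: q_def field_simps)
    then have "cmod (cnj \<zeta> * dirichlet_term 1 (\<Phi> s)) = 1" by simp
    then show False using lt1[OF that] \<zeta> by (simp add: norm_mult)
  qed
  \<comment> \<open>The humps are chosen along the values of q on the range of \<Phi>, so that each
    is high at a point that the composition operator sees.\<close>
  define W where "W = (\<lambda>s. q (\<Phi> s)) ` half_plane 0"
  have "(\<lambda>n. q (\<Phi> (s (r n)))) \<longlonglongrightarrow> (1 + cnj \<zeta> * \<zeta>) / 2"
    unfolding q_def u_def[symmetric] by (intro tendsto_intros r(2)) auto
  also have "cnj \<zeta> * \<zeta> = 1" using \<zeta> by (simp add: complex_norm_square[symmetric] mult.commute)
  finally have q_lim: "(\<lambda>n. q (\<Phi> (s (r n)))) \<longlonglongrightarrow> 1" by simp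
  have near: "\<exists>z\<in>W. cmod (1 - z) < e" if "0 < e" for e
  proof -
    obtain n where "cmod (q (\<Phi> (s (r n))) - 1) < e" using LIMSEQ_D[OF q_lim \<open>0 < e\<close>] by blast
    then show ?thesis using s(1) by (auto simp: W_def norm_minus_commute)
  qed
  have W: "W \<subseteq> peak_disc - {1}" using q_disc pos q_ne by (auto simp: W_def)
  obtain w and a b :: "nat \<Rightarrow> nat" where hump: "\<forall>n. w n \<in> W" "\<forall>n. 7 / 8 \<le> cmod (w n ^ a n - w n ^ b n)"
    "\<forall>z N. z \<in> peak_disc \<longrightarrow> (\<Sum>n<N. cmod (z ^ a n - z ^ b n)) \<le> 3"
    "\<forall>n N. (\<Sum>m\<in>{..<N} - {n}. cmod (w n ^ a m - w n ^ b m)) \<le> 1 / 8"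
    by (rule gliding_hump_powers[OF W near])
  have "\<exists>F. \<forall>s. 0 < Re s \<longrightarrow> dirichlet_fun F s = q s ^ m" for m
    using dirichlet_peak_power[of "cnj \<zeta>" m] unfolding q_def by blast
  then obtain p where p: "\<And>m s. 0 < Re s \<Longrightarrow> dirichlet_fun (p m) s = q s ^ m" by metis
  have "\<exists>t. 0 < Re t \<and> w n = q (\<Phi> t)" for n using hump(1)[rule_format, of n] by (auto simp: W_def)
  then obtain t where t: "\<And>n. 0 < Re (t n)" "\<And>n. w n = q (\<Phi> (t n))" by metis
  define f where "f n = p (a n) - p (b n)" for n
  have f: "dirichlet_fun (f n) s = q s ^ a n - q s ^ b n" if "0 < Re s" for n s
    using that by (simp add: f_def dirichlet_fun_simps p)
  have ft: "dirichlet_fun (f m) (\<Phi> (t n)) = w n ^ a m - w n ^ b m" for m n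
    by (simp add: f pos t(1) t(2)[symmetric])
  show ?thesis
  proof (rule that[of t f])
    show "\<forall>s N. 0 < Re s \<longrightarrow> (\<Sum>n<N. cmod (dirichlet_fun (f n) s)) \<le> 3"
      using hump(3) q_disc by (simp add: f)
  qed (use hump(2,4) t(1) in \<open>simp_all add: ft\<close>)
qed

text \<open>At \<open>t n\<close>, the image of \<open>S x\<close> is the n-th coordinate times a
  factor of modulus at least 7/8, up to an error of at most \<open>norm x / 8\<close>; the supremum
  over n leaves 7/8 - 1/8 = 3/4.\<close>

lemma fixes_c0_if_not_in_smaller_half_plane:
  assumes "\<nexists>\<epsilon>. 0 < \<epsilon> \<and> \<Phi> ` half_plane 0 \<subseteq> half_plane \<epsilon>"
  shows "fixes_copy TYPE(c0) (composition_operator \<Phi>)"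
proof -
  obtain t :: "nat \<Rightarrow> complex" and f :: "nat \<Rightarrow> dirichlet_algebra" where t: "\<forall>n. 0 < Re (t n)" and diag: "\<forall>n. 7 / 8 \<le> cmod (dirichlet_fun (f n) (\<Phi> (t n)))"
    and f: "\<forall>s N. 0 < Re s \<longrightarrow> (\<Sum>n<N. cmod (dirichlet_fun (f n) s)) \<le> 3"
    and off: "\<forall>n N. (\<Sum>m\<in>{..<N} - {n}. cmod (dirichlet_fun (f m) (\<Phi> (t n)))) \<le> 1 / 8"
    by (rule gliding_hump[OF assms])
  obtain S where S: "bounded_clinear S" "\<forall>x. (\<lambda>n. c0_nth x n *\<^sub>C f n) sums S x"
    using weakly_unconditionally_Cauchy_c0_map[of f 3] f by blast
  show ?thesis
  proof (rule fixes_copyI[OF S(1) bounded, of "3 / 4"])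
    fix x
    let ?n = "norm (composition_operator \<Phi> (S x))"
    have lower: "7 / 8 * cmod (c0_nth x n) - 1 / 8 * norm x \<le> ?n" for n
    proof -
      define d where "d m = c0_nth x m * dirichlet_fun (f m) (\<Phi> (t n))" for m
      have "d sums dirichlet_fun (S x) (\<Phi> (t n))"
        using bounded_linear.sums[OF bounded_linear_eval S(2)[rule_format, of x]]
        by (simp add: d_def[abs_def] dirichlet_fun_simps)
      then have lim: "(\<lambda>N. \<Sum>m<N. d m) \<longlonglongrightarrow> dirichlet_fun (S x) (\<Phi> (t n))" by (simp add: sums_def)
      have "7 / 8 * cmod (c0_nth x n) - 1 / 8 * norm x \<le> cmod (\<Sum>m<N. d m)" if "n < N" for N
      proof -
        have "(\<Sum>m<N. d m) = d n + (\<Sum>m\<in>{..<N} - {n}. d m)" using that by (intro sum.remove) auto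
        moreover have "cmod (d n) - cmod (\<Sum>m\<in>{..<N} - {n}. d m) \<le> cmod (d n + (\<Sum>m\<in>{..<N} - {n}. d m))"
          by (rule norm_diff_ineq)
        moreover have "7 / 8 * cmod (c0_nth x n) \<le> cmod (d n)"
          unfolding d_def norm_mult
          using mult_right_mono[OF diag[rule_format, of n], of "cmod (c0_nth x n)"] by (simp add: mult.commute)
        moreover have "cmod (\<Sum>m\<in>{..<N} - {n}. d m) \<le>
            (\<Sum>m\<in>{..<N} - {n}. norm x * cmod (dirichlet_fun (f m) (\<Phi> (t n))))"
          by (intro sum_norm_le) (auto simp: d_def norm_mult intro!: mult_right_mono c0_nth_le_norm)
        moreover have "\<dots> \<le> norm x * (1 / 8)"
          unfolding sum_distrib_left[symmetric] using off by (intro mult_left_mono) auto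
        ultimately show ?thesis by simp
      qed
      then have "7 / 8 * cmod (c0_nth x n) - 1 / 8 * norm x \<le> cmod (dirichlet_fun (S x) (\<Phi> (t n)))"
        by (intro tendsto_lowerbound[OF tendsto_norm[OF lim]] eventually_sequentiallyI[of "Suc n"]) auto
      also have "\<dots> \<le> ?n"
        using norm_dirichlet_fun_le[of "composition_operator \<Phi> (S x)" "t n"] t by (simp add: composition_eval)
      finally show ?thesis .
    qed
    \<comment> \<open>\<open>lower\<close> is solved for the coordinate first, because
      \<open>norm x\<close> is reached only as a supremum over n.\<close>
    have "norm x \<le> 8 / 7 * (?n + 1 / 8 * norm x)"
    proof (rule norm_c0_leI)
      show "cmod (c0_nth x n) \<le> 8 / 7 * (?n + 1 / 8 * norm x)" for n using lower[of n] by simp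
    qed
    then show "3 / 4 * norm x \<le> ?n" by simp
  qed simp
qed

text \<open>Iterated limits: \<open>\<psi>\<close> is a generalized limit of the evaluations at \<open>t n\<close>, and the images
  \<open>g M\<close> of the partial sums of the humps have a weak cluster point \<open>y\<close>; one order of the
  limits yields \<open>\<bar>\<psi> y\<bar> \<ge> 1/4\<close>, the other one \<open>\<bar>\<psi> y\<bar> \<le> 1/24\<close>.\<close>

lemma not_weakly_compact_if_not_in_smaller_half_plane:
  assumes "\<nexists>\<epsilon>. 0 < \<epsilon> \<and> \<Phi> ` half_plane 0 \<subseteq> half_plane \<epsilon>"
  shows "\<not> weakly_compact_operator (composition_operator \<Phi>)"
proof
  let ?W = "weak_topology :: dirichlet_algebra topology"
  let ?B = "composition_operator \<Phi> ` cball 0 1"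
  assume "weakly_compact_operator (composition_operator \<Phi>)"
  then have K: "compactin ?W (?W closure_of ?B)" by (simp add: weakly_compact_operator_def)
  obtain t :: "nat \<Rightarrow> complex" and f :: "nat \<Rightarrow> dirichlet_algebra" where t: "\<forall>n. 0 < Re (t n)" and diag: "\<forall>n. 7 / 8 \<le> cmod (dirichlet_fun (f n) (\<Phi> (t n)))"
    and f: "\<forall>s N. 0 < Re s \<longrightarrow> (\<Sum>n<N. cmod (dirichlet_fun (f n) s)) \<le> 3"
    and off: "\<forall>n N. (\<Sum>m\<in>{..<N} - {n}. cmod (dirichlet_fun (f m) (\<Phi> (t n)))) \<le> 1 / 8"
    by (rule gliding_hump[OF assms])
  \<comment> \<open>The factor 1/3 brings the partial sums, bounded by 3, into the unit
    ball.\<close>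
  define g where "g M = composition_operator \<Phi> ((1 / 3) *\<^sub>R (\<Sum>m<M. f m))" for M
  define C where "C N = ?W closure_of (g ` {N..})" for N
  have "cmod (dirichlet_fun (\<Sum>m<M. f m) s) \<le> 3" if "0 < Re s" for M s
    using that f by (auto simp: dirichlet_fun_sum intro: order_trans[OF norm_sum])
  then have "norm (\<Sum>m<M. f m) \<le> 3" for M by (rule norm_dirichlet_leI)
  then have g_in: "g M \<in> ?B" for M unfolding g_def by (intro imageI) simp
  obtain y where y: "\<And>N. y \<in> C N"
  proof (rule compactin_decreasing_nonempty[OF K, of C])
    show "C N \<subseteq> ?W closure_of ?B" for N
      unfolding C_def using g_in by (intro closure_of_mono) auto
    have "g ` {N..} \<subseteq> C N" for N unfolding C_def by (rule closure_of_subset) simp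
    then show "C N \<noteq> {}" for N by blast
    show "C n \<subseteq> C m" if "m \<le> n" for m n
      unfolding C_def using that by (intro closure_of_mono) auto
  qed (auto simp: C_def)
  \<comment> \<open>Closed conditions on the values of a functional along a tail of \<open>g\<close>
    pass to the cluster point.\<close>
  have cluster: "\<phi> y \<in> Q" if \<phi>: "bounded_clinear \<phi>" and "closed Q" "\<And>M. N \<le> M \<Longrightarrow> \<phi> (g M) \<in> Q"
    for \<phi> :: "dirichlet_algebra \<Rightarrow> complex" and Q N
  proof -
    have "\<phi> ` C N \<subseteq> euclidean closure_of (\<phi> ` g ` {N..})"
      using continuous_map_weak_topology[OF \<phi>] unfolding C_def continuous_map_eq_image_closure_subset by blast
    also have "\<dots> \<subseteq> Q" using that(2,3) by (intro closure_of_minimal) auto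
    finally show ?thesis using y[of N] by blast
  qed
  have g: "dirichlet_fun (g M) (t n) = (1 / 3) * (\<Sum>m<M. dirichlet_fun (f m) (\<Phi> (t n)))" for M n
    using t by (simp add: g_def composition_eval dirichlet_fun_simps dirichlet_fun_sum)
  have rest: "cmod (\<Sum>m\<in>{..<M} - {n}. dirichlet_fun (f m) (\<Phi> (t n))) \<le> 1 / 8" for M n
    by (rule order_trans[OF norm_sum off[rule_format]])
  have closed: "closed {z :: complex. 1 / 4 \<le> cmod z}"
    by (intro closed_Collect_le continuous_intros)
  \<comment> \<open>For M > n the n-th hump is included, so the value is at least (7/8 - 1/8) / 3 =
    1/4; the limit in M is taken first.\<close>
  have y_ge: "1 / 4 \<le> cmod (dirichlet_fun y (t n))" for n
  proof -
    have "dirichlet_fun y (t n) \<in> {z. 1 / 4 \<le> cmod z}"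
    proof (rule cluster[OF bounded_clinear_eval])
      fix M assume "Suc n \<le> M"
      then have "(\<Sum>m<M. dirichlet_fun (f m) (\<Phi> (t n))) = dirichlet_fun (f n) (\<Phi> (t n)) +
          (\<Sum>m\<in>{..<M} - {n}. dirichlet_fun (f m) (\<Phi> (t n)))" by (intro sum.remove) auto
      then have "7 / 8 - 1 / 8 \<le> cmod (\<Sum>m<M. dirichlet_fun (f m) (\<Phi> (t n)))"
        using norm_diff_ineq[of "dirichlet_fun (f n) (\<Phi> (t n))"
            "\<Sum>m\<in>{..<M} - {n}. dirichlet_fun (f m) (\<Phi> (t n))"] diag[rule_format, of n] rest[where M = M and n = n] by simp
      then show "dirichlet_fun (g M) (t n) \<in> {z. 1 / 4 \<le> cmod z}" by (simp add: g norm_mult)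
    qed (rule closed)
    then show ?thesis by simp
  qed
  obtain \<psi> where \<psi>: "bounded_clinear \<psi>"
    "\<And>h Q. closed Q \<Longrightarrow> \<forall>\<^sub>F n in sequentially. dirichlet_fun h (t n) \<in> Q \<Longrightarrow> \<psi> h \<in> Q"
    using generalized_limit_functional[of "\<lambda>n h. dirichlet_fun h (t n)"]
      bounded_clinear_eval norm_dirichlet_fun_le by blast
  have "\<psi> y \<in> {z. 1 / 4 \<le> cmod z}"
    using y_ge by (intro \<psi>(2) closed) simp
  moreover have "\<psi> y \<in> cball 0 (1 / 24)"
  proof (rule cluster[OF \<psi>(1), of _ 0])
    fix M
    \<comment> \<open>For n \<ge> M the hump that is high at \<open>t n\<close> is missing from the
      sum, and the others contribute at most (1/8) / 3; here the limit in n is taken first.\<close>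
    have "cmod (dirichlet_fun (g M) (t n)) \<le> 1 / 24" if "M \<le> n" for n
    proof -
      have "{..<M} - {n} = {..<M}" using that by auto
      then show ?thesis using rest[where M = M and n = n] by (simp add: g norm_mult)
    qed
    then show "\<psi> (g M) \<in> cball 0 (1 / 24)"
      by (intro \<psi>(2) eventually_sequentiallyI[of M]) auto
  qed simp
  ultimately show False by simp
qed

end

theorem theorem3p3:
  fixes \<Phi> :: "complex \<Rightarrow> complex"
  assumes "\<Phi> ` half_plane 0 \<subseteq> half_plane 0"
    and "\<And>f. f \<in> dirichlet_functions \<Longrightarrow> comp_fun \<Phi> f \<in> dirichlet_functions"
    and "bounded_clinear (composition_operator \<Phi>)"
  shows "((\<exists>\<epsilon>>0. \<Phi> ` half_plane 0 \<subseteq> half_plane \<epsilon>)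
            \<longleftrightarrow> compact_operator (composition_operator \<Phi>))
       \<and> (compact_operator (composition_operator \<Phi>)
            \<longleftrightarrow> weakly_compact_operator (composition_operator \<Phi>))
       \<and> (weakly_compact_operator (composition_operator \<Phi>)
            \<longleftrightarrow> \<not> fixes_copy TYPE(c0) (composition_operator \<Phi>))"
proof -
  interpret bounded_composition \<Phi> by unfold_locales (use assms in auto)
  have "weakly_compact_operator (composition_operator \<Phi>)" if "compact_operator (composition_operator \<Phi>)"
    using that by (rule compact_imp_weakly_compact) (metis bounded_clinear_eval dirichlet_fun_eqI)
  then show ?thesis
    using compact_if_image_in_smaller_half_plane compact_not_fixes_c0
      fixes_c0_if_not_in_smaller_half_plane not_weakly_compact_if_not_in_smaller_half_plane by blast
qed

end
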